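(* There exist positive constants $c_2, c_3$ such that for every sufficiently large integer $i$ there is an integer $m$ with $\log m \in [\log i, (\log i)^{c_2}]$ and $$\lambda(m) < (\log m)^{c_3 \log\log\log m}.$$
   Context: For a positive integer $m$, $\lambda(m)$ denotes the Carmichael function, i.e. the least positive integer such that $b^{\lambda(m)} \equiv 1 \pmod m$ for all $b \in \mathbb{Z}$ with $\gcd(b,m)=1$. $\log$ is the natural logarithm. *)

theory Defs
  imports Complex_Main "HOL-Number_Theory.Number_Theory"
begin

text \<open>
  The library defines \<^const>\<open>Carmichael\<close> as the least common multiple of the orders of the
  units modulo \<open>m\<close>. For positive \<open>m\<close> this is the least positive universal exponent.
\<close>

lemma Carmichael_eq_Least:
  fixes m :: nat
  assumes "m > 0"
  shows "Carmichael m =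
    (LEAST l. l > 0 \<and> (\<forall>b::int. coprime b (int m) \<longrightarrow> [b ^ l = 1] (mod int m)))"
proof (rule Least_equality [symmetric], intro conjI allI impI)
  show "Carmichael m > 0" by (rule Carmichael_pos)
next
  fix b :: int
  assume b: "coprime b (int m)"
  define a where "a = nat (b mod int m)"
  have a: "int a = b mod int m" using assms by (simp add: a_def)
  have "coprime (int a) (int m)" using b assms by (simp add: a)
  hence "coprime m a" by (simp add: coprime_commute)
  hence "[a ^ Carmichael m = 1] (mod m)" by (intro Carmichael_divides) auto
  hence "[int a ^ Carmichael m = 1] (mod int m)"
    by (metis cong_int_iff of_nat_1 of_nat_power)
  thus "[b ^ Carmichael m = 1] (mod int m)"
    by (simp add: a cong_def power_mod)
next
  fix l :: nat
  assume l: "l > 0 \<and> (\<forall>b::int. coprime b (int m) \<longrightarrow> [b ^ l = 1] (mod int m))"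
  have "Carmichael m dvd l" unfolding Carmichael_def
  proof (intro Lcm_least, safe)
    fix a assume "a \<in> totatives m"
    hence "coprime (int a) (int m)" by (simp add: totatives_def)
    hence "[int a ^ l = 1] (mod int m)" using l by blast
    hence "[a ^ l = 1] (mod m)" by (metis cong_int_iff of_nat_1 of_nat_power)
    thus "ord m a dvd l" using ord_divides by blast
  qed
  thus "Carmichael m \<le> l" using l by (intro dvd_imp_le) auto
qed

end

theory Submission
  imports "HOL-Computational_Algebra.Squarefree" "HOL-Analysis.L2_Norm"
    "HOL-Real_Asymp.Real_Asymp" Defs
begin

text \<open>
  A product \<open>m\<close> of distinct primes \<open>q\<close> for which \<open>q - 1\<close> always divides a fixed \<open>n\<close> has
  \<open>Carmichael m\<close> dividing \<open>n\<close>, by Fermat's theorem.  The theorem therefore asks for integers \<open>n\<close>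
  with an exceptionally large number of divisors of the form \<open>q - 1\<close>, of the same order
  \<open>exp (c * ln n / ln (ln n))\<close>, up to the constant, as the largest possible number of divisors.

  Let \<open>K\<close> be a product of \<open>k\<close> primes of size at most \<open>y\<close>, a fixed power of \<open>k\<close>, and let
  \<open>z = y ^ (5 * k)\<close>.  If the primes up to \<open>z\<close> fall into the class of \<open>1\<close> modulo the divisors \<open>d\<close> of
  \<open>K\<close> about as often as expected, then \<open>d\<close> times the weighted number of these primes, summed over
  the \<open>2 ^ k\<close> divisors \<open>d\<close>, is of order \<open>2 ^ k * z\<close>.  Write such a prime as \<open>1 + d * j\<close>.  By the
  pigeonhole principle some \<open>j \<le> z\<close> occurs for at least \<open>2 ^ k\<close> divisors, up to a power of \<open>k\<close>
  (\<open>weighted_psi_pigeonhole\<close>), and the primes obtained from them satisfy \<open>q - 1 dvd j * K\<close>.  Now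
  \<open>j * K\<close> is at most \<open>exp\<close> of a constant times \<open>k * ln k\<close>, while the logarithm of the product \<open>m\<close>
  of the primes is about \<open>2 ^ k\<close>; as \<open>k\<close> is of order \<open>ln (ln m)\<close> this is the claim.  Choosing \<open>k\<close> as a
  multiple of \<open>ln (ln i)\<close> places \<open>ln m\<close> in the required interval.

  The integer \<open>K\<close> is found greedily (\<open>weighted_psi_doubling\<close>).  Multiplying \<open>K\<close> by a prime \<open>p\<close>
  doubles the weighted sum if, for the average divisor \<open>d\<close>, the primes in the class of \<open>1\<close>
  modulo \<open>d\<close> are evenly distributed modulo \<open>p\<close>.  For one fixed \<open>d\<close> this holds for almost all primes
  \<open>p \<le> y\<close> (\<open>equidistribution_mod_primes\<close>), with an exceptional set so thin that a suitable \<open>p\<close>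
  remains after averaging over the divisors.  Since only the step from \<open>d\<close> to \<open>d * p\<close> is examined,
  no information on the zeros of Dirichlet L-functions enters, although \<open>d\<close> is as large as a
  power of \<open>z\<close>.

  The equidistribution statement follows from Vaughan's identity (\<open>vaughan_identity\<close>).  Sums with a
  smooth variable are trivially small.  For bilinear sums the congruence \<open>m * n = 1\<close> modulo \<open>d\<close> is
  resolved by fixing the class of \<open>m\<close>; then both variables run through progressions that are much
  longer than \<open>y ^ 3\<close>, and an elementary large sieve (\<open>large_sieve_variance\<close>) shows that they are
  evenly distributed modulo \<open>p\<close> in mean square.
\<close>

section \<open>Residue classes and the Cauchy-Schwarz inequality\<close>

lemma count_residue_class_lessThan:
  fixes q r n :: nat
  assumes "q > 0"
  shows "\<bar>real (card {l. l < n \<and> [l = r] (mod q)}) - real n / real q\<bar> \<le> 1"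
proof -
  define s where "s = r mod q"
  have s: "s < q" using assms by (simp add: s_def)
  have eq: "{l. l < n \<and> [l = r] (mod q)} = (\<lambda>i. q * i + s) ` {..<(n + q - 1 - s) div q}"
  proof (intro equalityI subsetI)
    fix l assume "l \<in> {l. l < n \<and> [l = r] (mod q)}"
    hence l: "l < n" "l mod q = s" unfolding Cong.cong_def s_def by auto
    have l': "l = q * (l div q) + s" using l(2) by (metis mult_div_mod_eq)
    have "Suc (l div q) * q \<le> n + q - 1 - s"
      using l l' s by (simp add: algebra_simps)
    hence "Suc (l div q) \<le> (n + q - 1 - s) div q"
      using assms by (simp add: less_eq_div_iff_mult_less_eq)
    thus "l \<in> (\<lambda>i. q * i + s) ` {..<(n + q - 1 - s) div q}"
      using l' by (intro image_eqI[of _ _ "l div q"]) auto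
  next
    fix l assume "l \<in> (\<lambda>i. q * i + s) ` {..<(n + q - 1 - s) div q}"
    then obtain i where i: "l = q * i + s" "Suc i \<le> (n + q - 1 - s) div q"
      unfolding image_iff Bex_def lessThan_iff Suc_le_eq by blast
    have "Suc i * q \<le> n + q - 1 - s"
      using i(2) assms by (simp add: less_eq_div_iff_mult_less_eq)
    hence "l < n" using i(1) s assms by (simp add: algebra_simps)
    moreover have "l mod q = s" using i(1) s by simp
    ultimately show "l \<in> {l. l < n \<and> [l = r] (mod q)}" by (simp add: Cong.cong_def s_def)
  qed
  have "inj_on (\<lambda>i. q * i + s) {..<(n + q - 1 - s) div q}"
    using assms by (auto simp: inj_on_def)
  hence card: "card {l. l < n \<and> [l = r] (mod q)} = (n + q - 1 - s) div q"
    by (simp add: eq card_image)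
  define t where "t = (n + q - 1 - s) div q"
  have "q * t + (n + q - 1 - s) mod q = n + q - 1 - s" by (simp add: t_def)
  moreover have "(n + q - 1 - s) mod q < q" using assms by simp
  ultimately have "q * t \<le> n + q - 1 - s" "n + q - 1 - s < q * t + q" by linarith+
  hence "q * t \<le> n + q" "n \<le> q * t + q" using s by linarith+
  hence "real q * real t \<le> real n + real q" "real n \<le> real q * real t + real q"
    by (metis of_nat_le_iff of_nat_add of_nat_mult)+
  thus ?thesis using assms unfolding card t_def[symmetric]
    by (simp add: abs_le_iff field_simps)
qed

lemma sum_mult_le_sqrt:
  fixes f g :: "'a \<Rightarrow> real"
  shows "\<bar>\<Sum>i\<in>A. f i * g i\<bar> \<le> sqrt (\<Sum>i\<in>A. f i ^ 2) * sqrt (\<Sum>i\<in>A. g i ^ 2)"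
proof -
  have "\<bar>\<Sum>i\<in>A. f i * g i\<bar> \<le> (\<Sum>i\<in>A. \<bar>f i\<bar> * \<bar>g i\<bar>)"
    by (rule order_trans[OF sum_abs]) (simp add: abs_mult)
  also have "\<dots> \<le> L2_set f A * L2_set g A" by (rule L2_set_mult_ineq)
  finally show ?thesis by (simp add: L2_set_def)
qed

text \<open>
  The form of the Cauchy-Schwarz inequality that propagates through every summation below: bounds
  by a product of two square roots may be summed inside the roots.
\<close>

lemma sum_abs_le_sqrt_mult_sqrt:
  fixes f g F G :: "'a \<Rightarrow> real"
  assumes "\<And>i. i \<in> A \<Longrightarrow> \<bar>f i\<bar> \<le> sqrt (F i) * sqrt (G i)"
    and "\<And>i. i \<in> A \<Longrightarrow> F i \<ge> 0" "\<And>i. i \<in> A \<Longrightarrow> G i \<ge> 0"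
  shows "(\<Sum>i\<in>A. \<bar>f i\<bar>) \<le> sqrt (\<Sum>i\<in>A. F i) * sqrt (\<Sum>i\<in>A. G i)"
proof -
  have "(\<Sum>i\<in>A. \<bar>f i\<bar>) \<le> (\<Sum>i\<in>A. sqrt (F i) * sqrt (G i))"
    by (intro sum_mono assms)
  also have "\<dots> \<le> \<bar>\<dots>\<bar>" by simp
  also have "\<dots> \<le> sqrt (\<Sum>i\<in>A. sqrt (F i) ^ 2) * sqrt (\<Sum>i\<in>A. sqrt (G i) ^ 2)"
    by (rule sum_mult_le_sqrt)
  also have "\<dots> = sqrt (\<Sum>i\<in>A. F i) * sqrt (\<Sum>i\<in>A. G i)"
    using assms by simp
  finally show ?thesis .
qed

lemma cong_iff_mod_eq:
  fixes m a p :: nat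
  assumes "a < p"
  shows "[m = a] (mod p) \<longleftrightarrow> m mod p = a"
  using assms by (simp add: Cong.cong_def)

section \<open>A large sieve inequality for prime moduli\<close>

definition class_sum :: "nat set \<Rightarrow> (nat \<Rightarrow> real) \<Rightarrow> nat \<Rightarrow> nat \<Rightarrow> real" where
  "class_sum T f p a = (\<Sum>m | m \<in> T \<and> m mod p = a. f m)"

definition class_dev :: "nat set \<Rightarrow> (nat \<Rightarrow> real) \<Rightarrow> nat \<Rightarrow> nat \<Rightarrow> real" where
  "class_dev T f p a = class_sum T f p a - sum f T / real p"

definition class_var :: "nat set \<Rightarrow> (nat \<Rightarrow> real) \<Rightarrow> nat \<Rightarrow> real" where
  "class_var T f p = (\<Sum>a<p. class_dev T f p a ^ 2)"

lemma sum_by_residue: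
  fixes f :: "nat \<Rightarrow> real"
  assumes "finite T" "p > 0"
  shows "(\<Sum>m\<in>T. f m * g (m mod p)) = (\<Sum>a<p. class_sum T f p a * g a)"
proof -
  have "(\<Sum>m\<in>T. f m * g (m mod p)) = (\<Sum>a<p. \<Sum>m | m \<in> T \<and> m mod p = a. f m * g (m mod p))"
    by (rule sum.group [symmetric]) (use assms in auto)
  also have "\<dots> = (\<Sum>a<p. class_sum T f p a * g a)"
    unfolding class_sum_def sum_distrib_right by (intro sum.cong refl) auto
  finally show ?thesis .
qed

lemma sum_class_dev:
  assumes "finite T" "p > 0"
  shows "(\<Sum>a<p. class_dev T f p a) = 0"
  using sum_by_residue[OF assms, of f "\<lambda>_. 1"] assms
  by (simp add: class_dev_def sum_subtractf)

text \<open>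
  The Chinese remainder theorem as an equivalence, so that a set cut out by two congruences can be
  rewritten as a single residue class and counted.
\<close>

lemma crt_cong_iff:
  fixes a b p q :: nat
  assumes "coprime p q"
  obtains r where "\<And>m. [m = r] (mod (p * q)) \<longleftrightarrow> [m = a] (mod p) \<and> [m = b] (mod q)"
proof -
  from binary_chinese_remainder_nat[OF assms, of a b]
  obtain r where r: "[r = a] (mod p)" "[r = b] (mod q)" by blast
  have "[m = r] (mod (p * q)) \<longleftrightarrow> [m = a] (mod p) \<and> [m = b] (mod q)" for m
  proof
    assume "[m = r] (mod (p * q))"
    hence "[m = r] (mod p)" "[m = r] (mod q)" 
      by (metis cong_modulus_mult_nat, metis cong_modulus_mult_nat mult.commute)
    thus "[m = a] (mod p) \<and> [m = b] (mod q)" using r by (auto intro: cong_trans)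
  next
    assume "[m = a] (mod p) \<and> [m = b] (mod q)"
    hence "[m = r] (mod p)" "[m = r] (mod q)" using r by (meson cong_sym cong_trans)+
    thus "[m = r] (mod (p * q))" using assms by (intro coprime_cong_mult_nat) auto
  qed
  thus ?thesis using that by blast
qed

text \<open>
  Residues of a long progression modulo different small primes are almost independent: for
  \<open>p \<noteq> q\<close> the functions \<open>m \<mapsto> g p (m mod p)\<close> and \<open>m \<mapsto> g q (m mod q)\<close> built from the deviations
  \<open>g\<close> have mean zero over a full period, so their inner product over \<open>T\<close> only sees the incomplete
  period at the end.  Hence they behave like orthogonal functions, and the estimate is Bessel's
  inequality for \<open>\<alpha>\<close>, with the cubic term absorbing the failure of exact orthogonality.  The term
  \<open>y ^ 3\<close> is worse than the optimal \<open>y ^ 2\<close>, which is harmless because \<open>y\<close> will be a power of the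
  logarithm of \<open>X\<close>; in return neither exponential sums nor characters are involved.  The sum runs
  over a progression modulo \<open>d\<close> so that the result can be used inside a fixed class modulo \<open>d\<close>.
\<close>

theorem large_sieve_variance:
  fixes \<alpha> :: "nat \<Rightarrow> real" and X d c y :: nat
  assumes "finite P" and P: "\<And>p. p \<in> P \<Longrightarrow> prime p \<and> p \<le> y \<and> \<not> p dvd d" and "d > 0"
  defines "T \<equiv> {m. m < X \<and> [m = c] (mod d)}"
  shows "(\<Sum>p\<in>P. real p * class_var T \<alpha> p) \<le> (real X / real d + 2 * real y ^ 3) * (\<Sum>m\<in>T. \<alpha> m ^ 2)"
proof -
  define S where "S = (\<Sum>p\<in>P. real p * class_var T \<alpha> p)"
  define N where "N = real X / real d"
  define g where "g = class_dev T \<alpha>"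
  have finT: "finite T" by (simp add: T_def)
  have ppos: "p > 0" if "p \<in> P" for p using P[OF that] prime_gt_0_nat by blast
  have var0: "class_var T \<alpha> p \<ge> 0" for p by (simp add: class_var_def sum_nonneg)
  have S0: "S \<ge> 0" unfolding S_def by (intro sum_nonneg mult_nonneg_nonneg var0) auto
  \<comment> \<open>The dual vector: its inner product with \<open>\<alpha>\<close> is exactly the quantity to be bounded.\<close>
  define h where "h = (\<lambda>m. \<Sum>p\<in>P. real p * g p (m mod p))"
  have "(\<Sum>m\<in>T. \<alpha> m * h m) = (\<Sum>p\<in>P. real p * (\<Sum>m\<in>T. \<alpha> m * g p (m mod p)))"
    unfolding h_def sum_distrib_left by (subst sum.swap) (simp add: mult_ac)
  also have "\<dots> = S" unfolding S_def
  proof (intro sum.cong refl)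
    fix p assume p: "p \<in> P"
    have "(\<Sum>m\<in>T. \<alpha> m * g p (m mod p)) = (\<Sum>a<p. class_sum T \<alpha> p a * g p a)"
      by (rule sum_by_residue[OF finT ppos[OF p]])
    also have "\<dots> = (\<Sum>a<p. g p a * g p a + sum \<alpha> T / real p * g p a)"
      by (simp add: g_def class_dev_def algebra_simps)
    also have "\<dots> = (\<Sum>a<p. g p a * g p a)"
      using sum_class_dev[OF finT ppos[OF p], of \<alpha>]
      by (simp only: sum.distrib sum_distrib_left [symmetric] g_def)
    finally show "real p * (\<Sum>m\<in>T. \<alpha> m * g p (m mod p)) = real p * class_var T \<alpha> p"
      by (simp add: class_var_def g_def power2_eq_square)
  qed
  finally have S_eq: "S = (\<Sum>m\<in>T. \<alpha> m * h m)" ..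
  have "S ^ 2 \<le> (sqrt (\<Sum>m\<in>T. \<alpha> m ^ 2) * sqrt (\<Sum>m\<in>T. h m ^ 2)) ^ 2"
    using sum_mult_le_sqrt[of \<alpha> h T] S0 unfolding S_eq by (intro power_mono) auto
  also have "\<dots> = (\<Sum>m\<in>T. \<alpha> m ^ 2) * (\<Sum>m\<in>T. h m ^ 2)"
    by (simp add: power_mult_distrib sum_nonneg)
  finally have CS: "S ^ 2 \<le> (\<Sum>m\<in>T. \<alpha> m ^ 2) * (\<Sum>m\<in>T. h m ^ 2)" .

  \<comment> \<open>Off the diagonal the main term of the count cancels because the deviations sum to zero; the
    counting errors of at most 1 leave a product of two first moments.\<close>
  have cross: "(\<Sum>m\<in>T. g p (m mod p) * g q (m mod q)) \<le>
      (if p = q then (N / real p + 1) * class_var T \<alpha> p else 0) +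
       sqrt (real p * class_var T \<alpha> p) * sqrt (real q * class_var T \<alpha> q)"
    if p: "p \<in> P" and q: "q \<in> P" for p q
  proof (cases "p = q")
    case True
    have "(\<Sum>m\<in>T. g p (m mod p) * g q (m mod q)) = (\<Sum>m\<in>T. 1 * (g p (m mod p) ^ 2))"
      using True by (simp add: power2_eq_square)
    also have "\<dots> = (\<Sum>a<p. class_sum T (\<lambda>_. 1) p a * g p a ^ 2)"
      by (rule sum_by_residue[OF finT ppos[OF p]])
    also have "\<dots> \<le> (\<Sum>a<p. (N / real p + 1) * g p a ^ 2)"
    proof (intro sum_mono mult_right_mono)
      fix a assume a: "a \<in> {..<p}"
      have "coprime d p" using P[OF p] prime_imp_coprime coprime_commute by blast
      then obtain r where r: "\<And>m. [m = r] (mod (d * p)) \<longleftrightarrow> [m = c] (mod d) \<and> [m = a] (mod p)"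
        using crt_cong_iff by blast
      have "{m \<in> T. m mod p = a} = {l. l < X \<and> [l = r] (mod (d * p))}"
        using a by (auto simp: r T_def cong_iff_mod_eq)
      hence "class_sum T (\<lambda>_. 1) p a = real (card {l. l < X \<and> [l = r] (mod (d * p))})"
        by (simp add: class_sum_def)
      also have "\<dots> \<le> N / real p + 1"
        using count_residue_class_lessThan[of "d * p" X r] ppos[OF p] \<open>d > 0\<close>
        by (simp add: N_def abs_le_iff)
      finally show "class_sum T (\<lambda>_. 1) p a \<le> N / real p + 1" .
    qed auto
    also have "\<dots> = (N / real p + 1) * class_var T \<alpha> p"
      by (simp add: class_var_def g_def sum_distrib_left)
    also have "\<dots> \<le> \<dots> + sqrt (real p * class_var T \<alpha> p) * sqrt (real q * class_var T \<alpha> q)"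
      using var0 by (simp add: mult_nonneg_nonneg)
    finally show ?thesis using True by simp
  next
    case False
    have cpq: "coprime p q" using P[OF p] P[OF q] False by (simp add: primes_coprime)
    define M where "M = N / (real p * real q)"
    define k where "k = (\<lambda>a b. real (card {m\<in>T. m mod p = a \<and> m mod q = b}))"
    have k: "\<bar>k a b - M\<bar> \<le> 1" if "a < p" "b < q" for a b
    proof -
      have "coprime d p" "coprime d q"
        using P[OF p] P[OF q] prime_imp_coprime coprime_commute by blast+
      hence cd: "coprime d (p * q)" by simp
      obtain s where s: "\<And>m. [m = s] (mod (p * q)) \<longleftrightarrow> [m = a] (mod p) \<and> [m = b] (mod q)"
        using crt_cong_iff[OF cpq] by blast
      obtain r where r: "\<And>m. [m = r] (mod (d * (p * q))) \<longleftrightarrow> [m = c] (mod d) \<and> [m = s] (mod (p * q))"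
        using crt_cong_iff[OF cd] by blast
      have "{m\<in>T. m mod p = a \<and> m mod q = b} = {l. l < X \<and> [l = r] (mod (d * (p * q)))}"
        using that unfolding r s T_def by (auto simp: cong_iff_mod_eq)
      thus ?thesis
        using count_residue_class_lessThan[of "d * (p * q)" X r] ppos[OF p] ppos[OF q] \<open>d > 0\<close>
        by (simp add: k_def M_def N_def)
    qed
    have "(\<Sum>m\<in>T. g p (m mod p) * g q (m mod q)) =
          (\<Sum>a<p. (\<Sum>m | m \<in> T \<and> m mod p = a. g q (m mod q)) * g p a)"
      using sum_by_residue[OF finT ppos[OF p], of "\<lambda>m. g q (m mod q)" "g p"]
      by (simp add: class_sum_def mult.commute)
    also have "\<dots> = (\<Sum>a<p. \<Sum>b<q. k a b * (g p a * g q b))"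
    proof (intro sum.cong refl)
      fix a
      have "(\<Sum>m | m \<in> T \<and> m mod p = a. 1 * g q (m mod q)) =
             (\<Sum>b<q. class_sum {m\<in>T. m mod p = a} (\<lambda>_. 1) q b * g q b)"
        by (rule sum_by_residue) (use finT ppos[OF q] in auto)
      also have "\<dots> = (\<Sum>b<q. k a b * g q b)"
        by (simp add: class_sum_def k_def conj_assoc)
      finally show "(\<Sum>m | m \<in> T \<and> m mod p = a. g q (m mod q)) * g p a =
                    (\<Sum>b<q. k a b * (g p a * g q b))"
        by (simp add: sum_distrib_left mult_ac)
    qed
    also have "\<dots> = (\<Sum>a<p. \<Sum>b<q. (k a b - M) * (g p a * g q b)) +
                    (\<Sum>a<p. \<Sum>b<q. M * (g p a * g q b))"
      by (simp add: sum.distrib [symmetric] algebra_simps)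
    also have "(\<Sum>a<p. \<Sum>b<q. M * (g p a * g q b)) = M * ((\<Sum>a<p. g p a) * (\<Sum>b<q. g q b))"
      unfolding sum_product by (simp add: sum_distrib_left)
    also have "\<dots> = 0"
      using sum_class_dev[OF finT ppos[OF p], of \<alpha>] by (simp add: g_def)
    also have "(\<Sum>a<p. \<Sum>b<q. (k a b - M) * (g p a * g q b)) \<le>
               (\<Sum>a<p. \<Sum>b<q. \<bar>g p a\<bar> * \<bar>g q b\<bar>)"
    proof (intro sum_mono)
      fix a b assume "a \<in> {..<p}" "b \<in> {..<q}"
      hence "\<bar>(k a b - M) * (g p a * g q b)\<bar> \<le> 1 * \<bar>g p a * g q b\<bar>"
        unfolding abs_mult[of "k a b - M"] by (intro mult_right_mono k) auto
      hence "\<bar>(k a b - M) * (g p a * g q b)\<bar> \<le> \<bar>g p a\<bar> * \<bar>g q b\<bar>"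
        by (simp only: abs_mult mult_1)
      thus "(k a b - M) * (g p a * g q b) \<le> \<bar>g p a\<bar> * \<bar>g q b\<bar>"
        by (rule order_trans[OF abs_ge_self])
    qed
    also have "\<dots> = (\<Sum>a<p. 1 * \<bar>g p a\<bar>) * (\<Sum>b<q. 1 * \<bar>g q b\<bar>)"
      by (simp add: sum_product)
    also have "\<dots> \<le> (sqrt (\<Sum>a<p. 1 ^ 2) * sqrt (\<Sum>a<p. \<bar>g p a\<bar> ^ 2)) *
                    (sqrt (\<Sum>b<q. 1 ^ 2) * sqrt (\<Sum>b<q. \<bar>g q b\<bar> ^ 2))"
      by (intro mult_mono order_trans[OF abs_ge_self sum_mult_le_sqrt])
         (auto intro!: sum_nonneg mult_nonneg_nonneg)
    also have "\<dots> = sqrt (real p * class_var T \<alpha> p) * sqrt (real q * class_var T \<alpha> q)"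
      by (simp add: class_var_def g_def real_sqrt_mult)
    finally show ?thesis using False by simp
  qed

  have "(\<Sum>m\<in>T. h m ^ 2) = (\<Sum>m\<in>T. \<Sum>p\<in>P. \<Sum>q\<in>P. (real p * real q) * (g p (m mod p) * g q (m mod q)))"
    unfolding h_def power2_eq_square sum_product by (simp add: mult_ac)
  also have "\<dots> = (\<Sum>p\<in>P. \<Sum>q\<in>P. (real p * real q) * (\<Sum>m\<in>T. g p (m mod p) * g q (m mod q)))"
    unfolding sum_distrib_left by (subst sum.swap, rule sum.cong[OF refl], subst sum.swap) simp
  also have "\<dots> \<le> (\<Sum>p\<in>P. \<Sum>q\<in>P. (real p * real q) *
      ((if p = q then (N / real p + 1) * class_var T \<alpha> p else 0) +
       sqrt (real p * class_var T \<alpha> p) * sqrt (real q * class_var T \<alpha> q)))"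
    by (intro sum_mono mult_left_mono cross) auto
  also have "\<dots> = (\<Sum>p\<in>P. (real p * real p) * ((N / real p + 1) * class_var T \<alpha> p)) +
      (\<Sum>p\<in>P. real p * sqrt (real p * class_var T \<alpha> p)) ^ 2"
  proof -
    define D where "D = (\<lambda>p. (N / real p + 1) * class_var T \<alpha> p)"
    define u where "u = (\<lambda>p. sqrt (real p * class_var T \<alpha> p))"
    have "(\<Sum>q\<in>P. (real p * real q) * ((if p = q then D p else 0) + u p * u q)) =
          real p * real p * D p + (real p * u p) * (\<Sum>q\<in>P. real q * u q)" if "p \<in> P" for p
    proof -
      have "(\<Sum>q\<in>P. (real p * real q) * ((if p = q then D p else 0) + u p * u q)) =
            (\<Sum>q\<in>P. (if p = q then real p * real q * D p else 0) + (real p * u p) * (real q * u q))"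
        by (intro sum.cong refl) (simp add: algebra_simps)
      also have "\<dots> = (\<Sum>q\<in>P. (if p = q then real p * real q * D p else 0)) +
                      (real p * u p) * (\<Sum>q\<in>P. real q * u q)"
        by (simp only: sum.distrib sum_distrib_left)
      finally show ?thesis using that \<open>finite P\<close> by simp
    qed
    hence "(\<Sum>p\<in>P. \<Sum>q\<in>P. (real p * real q) * ((if p = q then D p else 0) + u p * u q)) =
           (\<Sum>p\<in>P. real p * real p * D p + (real p * u p) * (\<Sum>q\<in>P. real q * u q))"
      by (intro sum.cong refl) simp
    also have "\<dots> = (\<Sum>p\<in>P. real p * real p * D p) + (\<Sum>p\<in>P. real p * u p) ^ 2"
      by (simp only: sum.distrib power2_eq_square sum_distrib_right)
    finally show ?thesis by (simp only: D_def u_def)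
  qed
  finally have h_le: "(\<Sum>m\<in>T. h m ^ 2) \<le>
      (\<Sum>p\<in>P. (real p * real p) * ((N / real p + 1) * class_var T \<alpha> p)) +
      (\<Sum>p\<in>P. real p * sqrt (real p * class_var T \<alpha> p)) ^ 2" .
  have "(\<Sum>p\<in>P. (real p * real p) * ((N / real p + 1) * class_var T \<alpha> p)) \<le>
      (\<Sum>p\<in>P. (N + real y) * (real p * class_var T \<alpha> p))"
  proof (intro sum_mono)
    fix p assume p: "p \<in> P"
    have "(real p * real p) * ((N / real p + 1) * class_var T \<alpha> p) =
          (N + real p) * (real p * class_var T \<alpha> p)"
      using ppos[OF p] by (simp add: field_simps)
    also have "\<dots> \<le> (N + real y) * (real p * class_var T \<alpha> p)"
      using P[OF p] var0 by (intro mult_right_mono) auto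
    finally show "(real p * real p) * ((N / real p + 1) * class_var T \<alpha> p) \<le>
          (N + real y) * (real p * class_var T \<alpha> p)" .
  qed
  hence diag: "(\<Sum>p\<in>P. (real p * real p) * ((N / real p + 1) * class_var T \<alpha> p)) \<le> (N + real y) * S"
    by (simp add: S_def sum_distrib_left)
  have "(\<Sum>p\<in>P. real p * sqrt (real p * class_var T \<alpha> p)) ^ 2 \<le>
      (sqrt (\<Sum>p\<in>P. real p ^ 2) * sqrt (\<Sum>p\<in>P. sqrt (real p * class_var T \<alpha> p) ^ 2)) ^ 2"
    by (intro power_mono order_trans[OF abs_ge_self sum_mult_le_sqrt] sum_nonneg mult_nonneg_nonneg)
       (auto simp: var0)
  also have "\<dots> = (\<Sum>p\<in>P. real p ^ 2) * S"
    using var0 by (simp add: power_mult_distrib S_def sum_nonneg)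
  also have "\<dots> \<le> real y ^ 3 * S"
  proof (rule mult_right_mono[OF _ S0])
    have "(\<Sum>p\<in>P. real p ^ 2) \<le> (\<Sum>p\<in>P. real y ^ 2)"
      using P by (intro sum_mono power_mono) auto
    also have "\<dots> = real (card P) * real y ^ 2" by simp
    also have "\<dots> \<le> real y * real y ^ 2"
    proof (rule mult_right_mono)
      have "card P \<le> card {1..y}"
        by (rule card_mono) (use P ppos in \<open>auto simp: Suc_le_eq\<close>)
      thus "real (card P) \<le> real y" by simp
    qed simp
    finally show "(\<Sum>p\<in>P. real p ^ 2) \<le> real y ^ 3" by (simp add: power3_eq_cube power2_eq_square)
  qed
  finally have off: "(\<Sum>p\<in>P. real p * sqrt (real p * class_var T \<alpha> p)) ^ 2 \<le> real y ^ 3 * S" .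
  have "real y \<le> real y ^ 3"
    by (cases "y = 0") (auto intro: self_le_power)
  hence "(N + real y) * S + real y ^ 3 * S \<le> (N + 2 * real y ^ 3) * S"
    using mult_right_mono[OF _ S0, of "real y" "real y ^ 3"] by (simp add: algebra_simps)
  with h_le diag off have H: "(\<Sum>m\<in>T. h m ^ 2) \<le> (N + 2 * real y ^ 3) * S" by linarith
  have "S * S \<le> ((\<Sum>m\<in>T. \<alpha> m ^ 2) * (N + 2 * real y ^ 3)) * S"
    using order_trans[OF CS mult_left_mono[OF H]]
    by (simp add: power2_eq_square mult.assoc sum_nonneg)
  hence "S \<le> (\<Sum>m\<in>T. \<alpha> m ^ 2) * (N + 2 * real y ^ 3)"
  proof (cases "S = 0")
    case True
    thus ?thesis by (auto intro!: mult_nonneg_nonneg sum_nonneg simp: N_def)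
  next
    case False
    with S0 have "S > 0" by simp
    with \<open>S * S \<le> _\<close> show ?thesis by (simp add: mult_le_cancel_right)
  qed
  thus ?thesis by (simp add: S_def N_def mult.commute)
qed

section \<open>Bilinear forms in one residue class\<close>

text \<open>
  Summing \<open>prime_kernel p\<close> against a sequence gives \<open>p\<close> times the difference between its sum over
  the class of \<open>1\<close> modulo \<open>p\<close> and the mean over all nonzero classes.
\<close>

definition prime_kernel :: "nat \<Rightarrow> nat \<Rightarrow> real" where
  "prime_kernel p n = (if [n = 1] (mod p) then real p else 0) -
     (if p dvd n then 0 else real p / (real p - 1))"

text \<open>
  The same comparison within the class of \<open>1\<close> modulo \<open>d\<close>.  For \<open>p\<close> not dividing \<open>d\<close> it compares
  \<open>p\<close> times the sum over the class of \<open>1\<close> modulo \<open>d * p\<close> with \<open>p / (p - 1)\<close> times the sum over the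
  class of \<open>1\<close> modulo \<open>d\<close>, the multiples of \<open>p\<close> being left out.  As a kernel it is linear in the
  sequence, so that Vaughan's identity can be applied term by term.
\<close>

definition deviation_kernel :: "nat \<Rightarrow> nat \<Rightarrow> nat \<Rightarrow> real" where
  "deviation_kernel d p n = (if [n = 1] (mod d) then prime_kernel p n else 0)"

lemma prime_kernel_mod: "prime_kernel p (m * n) = prime_kernel p ((m mod p) * (n mod p))"
  by (simp add: prime_kernel_def Cong.cong_def mod_mult_eq dvd_eq_mod_eq_0)

lemma prime_kernel_eq_0:
  assumes "prime p" "p dvd n"
  shows "prime_kernel p n = 0"
proof -
  have "\<not> [n = 1] (mod p)"
    using assms by (metis cong_dvd_iff not_prime_unit)
  thus ?thesis using assms by (simp add: prime_kernel_def)
qed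

lemma inverse_mod_prime_unique:
  fixes a b c :: nat
  assumes "[a * b = 1] (mod p)" "[a * c = 1] (mod p)" "b < p" "c < p"
  shows "b = c"
proof -
  have "coprime a p" using assms(1) by (metis coprime_iff_invertible_nat One_nat_def)
  moreover have "[a * b = a * c] (mod p)" using assms by (meson cong_sym cong_trans)
  ultimately have "[b = c] (mod p)" using cong_mult_lcancel_nat by blast
  thus ?thesis using assms by (simp add: Cong.cong_def)
qed

text \<open>
  Rows and columns of the matrix \<open>prime_kernel p (a * b)\<close> sum to zero, so a bilinear form in this
  matrix does not change when constants are added to the class sums: only their deviations matter.
\<close>

lemma sum_prime_kernel:
  assumes p: "prime p" and a: "a < p"
  shows "(\<Sum>b<p. prime_kernel p (a * b)) = 0"
proof (cases "a = 0")
  case True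
  thus ?thesis using prime_kernel_eq_0[OF p, of 0] by simp
next
  case False
  have p2: "p \<ge> 2" using p prime_ge_2_nat by blast
  have ndvd: "\<not> p dvd a" using False a by (auto dest: dvd_imp_le)
  have "coprime a p" using ndvd p by (metis prime_imp_coprime coprime_commute)
  then obtain b0 where "[a * b0 = 1] (mod p)" using cong_solve_coprime_nat by (metis One_nat_def)
  hence b0: "[a * (b0 mod p) = 1] (mod p)" by (simp add: Cong.cong_def mod_mult_right_eq)
  have eq1: "{b. b < p \<and> [a * b = 1] (mod p)} = {b0 mod p}"
    using b0 inverse_mod_prime_unique[of a] p2 by auto
  have eq2: "{b. b < p \<and> \<not> p dvd a * b} = {1..<p}"
    using ndvd p by (auto simp: prime_dvd_mult_iff Suc_le_eq dest: dvd_imp_le intro: Nat.gr0I)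
  have "(\<Sum>b<p. if [a * b = 1] (mod p) then real p else 0) = (\<Sum>b | b < p \<and> [a * b = 1] (mod p). real p)"
    by (rule sum.mono_neutral_cong_right) auto
  also have "\<dots> = real p" unfolding eq1 by simp
  finally have s1: "(\<Sum>b<p. if [a * b = 1] (mod p) then real p else 0) = real p" .
  have "(\<Sum>b<p. if p dvd a * b then 0 else real p / (real p - 1)) =
        (\<Sum>b | b < p \<and> \<not> p dvd a * b. real p / (real p - 1))"
    by (rule sum.mono_neutral_cong_right) auto
  also have "\<dots> = real p" unfolding eq2 using p2 by (simp add: of_nat_diff)
  finally have s2: "(\<Sum>b<p. if p dvd a * b then 0 else real p / (real p - 1)) = real p" .
  show ?thesis unfolding prime_kernel_def sum_subtractf s1 s2 by simp
qed

lemma class_var_nonneg: "class_var T f p \<ge> 0"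
  by (simp add: class_var_def sum_nonneg)

text \<open>
  After replacing class sums by deviations, the part of the kernel supported on \<open>a * b = 1\<close> is a
  permutation matrix and the rest has rank one.  Each is bounded by the Cauchy-Schwarz inequality,
  whence the factor 2.
\<close>

lemma bilinear_prime_kernel:
  fixes \<alpha> \<beta> :: "nat \<Rightarrow> real"
  assumes p: "prime p" and fin: "finite T" "finite T'"
  shows "\<bar>\<Sum>m\<in>T. \<Sum>n\<in>T'. \<alpha> m * \<beta> n * prime_kernel p (m * n)\<bar> \<le>
         2 * real p * (sqrt (class_var T \<alpha> p) * sqrt (class_var T' \<beta> p))"
proof -
  have p2: "p \<ge> 2" using p prime_ge_2_nat by blast
  define x where "x = class_dev T \<alpha> p"
  define y where "y = class_dev T' \<beta> p"
  define s where "s = sum \<alpha> T / real p"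
  define t where "t = sum \<beta> T' / real p"
  define K where "K = (\<lambda>a b. prime_kernel p (a * b))"
  define nx where "nx = sqrt (class_var T \<alpha> p)"
  define ny where "ny = sqrt (class_var T' \<beta> p)"
  have row: "(\<Sum>b<p. K a b) = 0" if "a < p" for a
    using sum_prime_kernel[OF p that] by (simp add: K_def)
  have col: "(\<Sum>a<p. K a b) = 0" if "b < p" for b
    using sum_prime_kernel[OF p that] by (simp add: K_def mult.commute)
  have "(\<Sum>m\<in>T. \<Sum>n\<in>T'. \<alpha> m * \<beta> n * prime_kernel p (m * n)) =
        (\<Sum>m\<in>T. \<alpha> m * (\<Sum>n\<in>T'. \<beta> n * K (m mod p) (n mod p)))"
    by (subst prime_kernel_mod) (simp add: K_def sum_distrib_left mult_ac)
  also have "\<dots> = (\<Sum>m\<in>T. \<alpha> m * (\<Sum>b<p. class_sum T' \<beta> p b * K (m mod p) b))"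
    using p2 by (subst sum_by_residue[OF fin(2)]) auto
  also have "\<dots> = (\<Sum>a<p. class_sum T \<alpha> p a * (\<Sum>b<p. class_sum T' \<beta> p b * K a b))"
    using p2 by (subst sum_by_residue[OF fin(1)]) auto
  also have "\<dots> = (\<Sum>a<p. (x a + s) * (\<Sum>b<p. y b * K a b))"
  proof (intro sum.cong refl)
    fix a assume a: "a \<in> {..<p}"
    have "(\<Sum>b<p. class_sum T' \<beta> p b * K a b) = (\<Sum>b<p. y b * K a b + t * K a b)"
      by (simp add: y_def t_def class_dev_def algebra_simps)
    also have "\<dots> = (\<Sum>b<p. y b * K a b)"
      using row[of a] a by (simp only: sum.distrib sum_distrib_left [symmetric]) simp
    finally show "class_sum T \<alpha> p a * (\<Sum>b<p. class_sum T' \<beta> p b * K a b) =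
                  (x a + s) * (\<Sum>b<p. y b * K a b)"
      by (simp add: x_def s_def class_dev_def)
  qed
  also have "\<dots> = (\<Sum>a<p. x a * (\<Sum>b<p. y b * K a b)) + s * (\<Sum>a<p. \<Sum>b<p. y b * K a b)"
    by (simp only: ring_distribs sum.distrib sum_distrib_left [symmetric])
  also have "(\<Sum>a<p. \<Sum>b<p. y b * K a b) = (\<Sum>b<p. y b * (\<Sum>a<p. K a b))"
    by (subst sum.swap) (simp add: sum_distrib_left)
  also have "\<dots> = 0" using col by simp
  also have "(\<Sum>a<p. x a * (\<Sum>b<p. y b * K a b)) = (\<Sum>a<p. \<Sum>b<p. x a * y b * K a b)"
    by (simp add: sum_distrib_left mult_ac)
  finally have main: "(\<Sum>m\<in>T. \<Sum>n\<in>T'. \<alpha> m * \<beta> n * prime_kernel p (m * n)) =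
      (\<Sum>a<p. \<Sum>b<p. x a * y b * K a b)" by simp

  define R where "R = {(a, b). a < p \<and> b < p \<and> [a * b = 1] (mod p)}"
  have R_sub: "R \<subseteq> {..<p} \<times> {..<p}" by (auto simp: R_def)
  hence finR: "finite R" by (rule finite_subset) auto
  have nx: "(\<Sum>a<p. x a ^ 2) = nx ^ 2" and ny: "(\<Sum>b<p. y b ^ 2) = ny ^ 2"
    using class_var_nonneg by (simp_all add: nx_def ny_def class_var_def x_def y_def sum_nonneg)
  have nx0: "nx \<ge> 0" "ny \<ge> 0" by (simp_all add: nx_def ny_def class_var_nonneg)
  have "(\<Sum>a<p. \<Sum>b<p. x a * y b * K a b) =
        real p * (\<Sum>a<p. \<Sum>b<p. if [a * b = 1] (mod p) then x a * y b else 0) -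
        real p / (real p - 1) * (\<Sum>a<p. \<Sum>b<p. if p dvd a * b then 0 else x a * y b)"
    unfolding sum_distrib_left sum_subtractf [symmetric]
    by (intro sum.cong refl) (auto simp: K_def prime_kernel_def algebra_simps)
  also have "(\<Sum>a<p. \<Sum>b<p. if [a * b = 1] (mod p) then x a * y b else 0) = (\<Sum>(a, b)\<in>R. x a * y b)"
    unfolding sum.cartesian_product
    by (rule sum.mono_neutral_cong_right) (use R_sub in \<open>auto simp: R_def\<close>)
  also have "(\<Sum>a<p. \<Sum>b<p. if p dvd a * b then 0 else x a * y b) = (\<Sum>a=1..<p. x a) * (\<Sum>b=1..<p. y b)"
  proof -
    have "(\<Sum>a<p. \<Sum>b<p. if p dvd a * b then 0 else x a * y b) =
          (\<Sum>a<p. \<Sum>b<p. (if a = 0 then 0 else x a) * (if b = 0 then 0 else y b))"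
      using p by (intro sum.cong refl) (auto simp: prime_dvd_mult_iff dest: dvd_imp_le)
    also have "\<dots> = (\<Sum>a<p. if a = 0 then 0 else x a) * (\<Sum>b<p. if b = 0 then 0 else y b)"
      by (simp only: sum_product)
    also have "(\<Sum>a<p. if a = 0 then 0 else x a) = (\<Sum>a=1..<p. x a)"
      by (rule sum.mono_neutral_cong_right) auto
    also have "(\<Sum>b<p. if b = 0 then 0 else y b) = (\<Sum>b=1..<p. y b)"
      by (rule sum.mono_neutral_cong_right) auto
    finally show ?thesis .
  qed
  finally have split: "(\<Sum>a<p. \<Sum>b<p. x a * y b * K a b) = real p * (\<Sum>(a, b)\<in>R. x a * y b) -
        real p / (real p - 1) * ((\<Sum>a=1..<p. x a) * (\<Sum>b=1..<p. y b))" .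
  have R_bound: "\<bar>\<Sum>(a, b)\<in>R. x a * y b\<bar> \<le> nx * ny"
  proof -
    have "\<bar>\<Sum>(a, b)\<in>R. x a * y b\<bar> \<le> sqrt (\<Sum>i\<in>R. x (fst i) ^ 2) * sqrt (\<Sum>i\<in>R. y (snd i) ^ 2)"
      using sum_mult_le_sqrt[of "\<lambda>i. x (fst i)" "\<lambda>i. y (snd i)" R] by (simp add: case_prod_unfold)
    also have "\<dots> \<le> nx * ny"
    proof (intro mult_mono)
      have "inj_on fst R"
        using inverse_mod_prime_unique by (fastforce simp: inj_on_def R_def)
      hence "(\<Sum>i\<in>R. x (fst i) ^ 2) = (\<Sum>a\<in>fst ` R. x a ^ 2)" by (simp add: sum.reindex)
      also have "\<dots> \<le> (\<Sum>a<p. x a ^ 2)"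
        by (rule sum_mono2) (auto simp: R_def)
      finally show "sqrt (\<Sum>i\<in>R. x (fst i) ^ 2) \<le> nx"
        using nx0 by (simp add: nx real_le_lsqrt)
      have "inj_on snd R"
        using inverse_mod_prime_unique by (fastforce simp: inj_on_def R_def mult.commute)
      hence "(\<Sum>i\<in>R. y (snd i) ^ 2) = (\<Sum>a\<in>snd ` R. y a ^ 2)" by (simp add: sum.reindex)
      also have "\<dots> \<le> (\<Sum>a<p. y a ^ 2)"
        by (rule sum_mono2) (auto simp: R_def)
      finally show "sqrt (\<Sum>i\<in>R. y (snd i) ^ 2) \<le> ny"
        using nx0 by (simp add: ny real_le_lsqrt)
    qed (auto simp: nx0 sum_nonneg)
    finally show ?thesis .
  qed
  have part_bound: "\<bar>\<Sum>a=1..<p. f a\<bar> \<le> sqrt (real p - 1) * N"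
    if "(\<Sum>a<p. f a ^ 2) = N ^ 2" "N \<ge> 0" for f :: "nat \<Rightarrow> real" and N
  proof -
    have "\<bar>\<Sum>a=1..<p. 1 * f a\<bar> \<le> sqrt (\<Sum>a=1..<p. 1 ^ 2) * sqrt (\<Sum>a=1..<p. f a ^ 2)"
      by (rule sum_mult_le_sqrt)
    also have "\<dots> = sqrt (real p - 1) * sqrt (\<Sum>a=1..<p. f a ^ 2)"
      using p2 by (simp add: of_nat_diff)
    also have "\<dots> \<le> sqrt (real p - 1) * sqrt (\<Sum>a<p. f a ^ 2)"
      using p2 by (intro mult_left_mono real_sqrt_le_mono sum_mono2) auto
    finally show ?thesis using that by simp
  qed
  have "\<bar>(\<Sum>a=1..<p. x a) * (\<Sum>b=1..<p. y b)\<bar> \<le> (sqrt (real p - 1) * nx) * (sqrt (real p - 1) * ny)"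
    unfolding abs_mult by (intro mult_mono part_bound nx ny nx0) (use p2 nx0 in auto)
  also have "\<dots> = (real p - 1) * (nx * ny)"
    using p2 by (simp add: mult_ac flip: mult.assoc)
  finally have "real p / (real p - 1) * \<bar>(\<Sum>a=1..<p. x a) * (\<Sum>b=1..<p. y b)\<bar> \<le>
      real p / (real p - 1) * ((real p - 1) * (nx * ny))"
    using p2 by (intro mult_left_mono) auto
  also have "\<dots> = real p * (nx * ny)" using p2 by simp
  finally have second: "\<bar>real p / (real p - 1) * ((\<Sum>a=1..<p. x a) * (\<Sum>b=1..<p. y b))\<bar> \<le> real p * (nx * ny)"
    using p2 by (simp only: abs_mult[of "real p / (real p - 1)"]) simp
  have first: "\<bar>real p * (\<Sum>(a, b)\<in>R. x a * y b)\<bar> \<le> real p * (nx * ny)"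
    unfolding abs_mult using R_bound by (simp add: mult_left_mono)
  show ?thesis unfolding main split nx_def[symmetric] ny_def[symmetric]
  proof (rule order_trans[OF abs_triangle_ineq4 order_trans[OF add_mono[OF first second]]])
    show "real p * (nx * ny) + real p * (nx * ny) \<le> 2 * real p * (nx * ny)"
      by (simp only: mult_2 ring_distribs order_refl)
  qed
qed

text \<open>
  The condition \<open>m * n = 1\<close> modulo \<open>d\<close> pairs each class \<open>c\<close> of \<open>m\<close> with the inverse class of \<open>n\<close>.
  On each pair the large sieve bounds both variances, and since \<open>c\<close> and its inverse each run once
  through the invertible classes, a final application of the Cauchy-Schwarz inequality over \<open>c\<close>
  reassembles the full mean squares.  The large sieve is applied to progressions of length
  \<open>X / d\<close> and \<open>Y / d\<close>; this is what gives the saving of \<open>d\<close>.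
\<close>

lemma bilinear_box:
  fixes \<alpha> \<beta> :: "nat \<Rightarrow> real" and X Y d y :: nat
  assumes "finite P" and P: "\<And>p. p \<in> P \<Longrightarrow> prime p \<and> p \<le> y \<and> \<not> p dvd d" and d: "d > 0"
  shows "(\<Sum>p\<in>P. \<bar>\<Sum>m<X. \<Sum>n<Y. \<alpha> m * \<beta> n * deviation_kernel d p (m * n)\<bar>) \<le>
    2 * (sqrt ((real X / real d + 2 * real y ^ 3) * (\<Sum>m<X. \<alpha> m ^ 2)) *
         sqrt ((real Y / real d + 2 * real y ^ 3) * (\<Sum>n<Y. \<beta> n ^ 2)))"
proof -
  define T where "T = (\<lambda>c. {m. m < X \<and> [m = c] (mod d)})"
  define T' where "T' = (\<lambda>c. {n. n < Y \<and> [c * n = 1] (mod d)})"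
  define Q where "Q = (\<lambda>c p. \<Sum>m\<in>T c. \<Sum>n\<in>T' c. \<alpha> m * \<beta> n * prime_kernel p (m * n))"
  define W where "W = (\<lambda>c. (real X / real d + 2 * real y ^ 3) * (\<Sum>m\<in>T c. \<alpha> m ^ 2))"
  define W' where "W' = (\<lambda>c. (real Y / real d + 2 * real y ^ 3) * (\<Sum>n\<in>T' c. \<beta> n ^ 2))"
  have fin: "finite (T c)" "finite (T' c)" for c by (simp_all add: T_def T'_def)
  have T_mod: "T c = {m\<in>{..<X}. m mod d = c}" if "c < d" for c
    using that by (auto simp: T_def cong_iff_mod_eq)
  have split: "(\<Sum>m<X. \<Sum>n<Y. \<alpha> m * \<beta> n * deviation_kernel d p (m * n)) = (\<Sum>c<d. Q c p)" for p
  proof -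
    have "(\<Sum>m<X. \<Sum>n<Y. \<alpha> m * \<beta> n * deviation_kernel d p (m * n)) =
          (\<Sum>c<d. \<Sum>m\<in>{m\<in>{..<X}. m mod d = c}. \<Sum>n<Y. \<alpha> m * \<beta> n * deviation_kernel d p (m * n))"
      by (rule sum.group [symmetric]) (use d in auto)
    also have "\<dots> = (\<Sum>c<d. Q c p)"
    proof (intro sum.cong refl)
      fix c assume c: "c \<in> {..<d}"
      have "(\<Sum>n<Y. \<alpha> m * \<beta> n * deviation_kernel d p (m * n)) =
            (\<Sum>n\<in>T' c. \<alpha> m * \<beta> n * prime_kernel p (m * n))" if m: "m mod d = c" for m
      proof -
        have "[m * n = 1] (mod d) \<longleftrightarrow> [c * n = 1] (mod d)" for n
          using m unfolding Cong.cong_def by (metis mod_mult_left_eq)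
        thus ?thesis
          by (intro sum.mono_neutral_cong_right) (auto simp: T'_def deviation_kernel_def)
      qed
      thus "(\<Sum>m\<in>{m\<in>{..<X}. m mod d = c}. \<Sum>n<Y. \<alpha> m * \<beta> n * deviation_kernel d p (m * n)) = Q c p"
        using c unfolding Q_def by (simp add: T_mod)
    qed
    finally show ?thesis .
  qed
  have W: "(\<Sum>p\<in>P. real p * class_var (T c) \<alpha> p) \<le> W c" for c
    unfolding T_def W_def by (rule large_sieve_variance[OF assms])
  have W': "(\<Sum>p\<in>P. real p * class_var (T' c) \<beta> p) \<le> W' c" for c
  proof (cases "T' c = {}")
    case True
    thus ?thesis by (simp add: W'_def class_var_def class_dev_def class_sum_def)
  next
    case False
    then obtain n0 where n0: "[c * n0 = 1] (mod d)" by (auto simp: T'_def)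
    hence "coprime c d" by (metis coprime_iff_invertible_nat One_nat_def)
    hence "[c * n = 1] (mod d) \<longleftrightarrow> [n = n0] (mod d)" for n
      using n0 by (meson cong_mult_lcancel_nat cong_sym cong_trans)
    hence "T' c = {n. n < Y \<and> [n = n0] (mod d)}" by (simp add: T'_def)
    thus ?thesis unfolding W'_def using large_sieve_variance[OF assms, of Y n0 \<beta>] by simp
  qed
  have W0: "W c \<ge> 0" "W' c \<ge> 0" for c
    unfolding W_def W'_def by (auto intro!: mult_nonneg_nonneg add_nonneg_nonneg sum_nonneg)
  have per_class: "(\<Sum>p\<in>P. \<bar>Q c p\<bar>) \<le> 2 * (sqrt (W c) * sqrt (W' c))" for c
  proof -
    have "(\<Sum>p\<in>P. \<bar>Q c p\<bar>) \<le> (\<Sum>p\<in>P. 2 * \<bar>sqrt (real p * class_var (T c) \<alpha> p) * sqrt (real p * class_var (T' c) \<beta> p)\<bar>)"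
    proof (intro sum_mono)
      fix p assume p: "p \<in> P"
      have "\<bar>Q c p\<bar> \<le> 2 * real p * (sqrt (class_var (T c) \<alpha> p) * sqrt (class_var (T' c) \<beta> p))"
        unfolding Q_def using P[OF p] fin by (intro bilinear_prime_kernel) auto
      also have "\<dots> = 2 * ((sqrt (real p) * sqrt (real p)) * (sqrt (class_var (T c) \<alpha> p) * sqrt (class_var (T' c) \<beta> p)))"
        by simp
      also have "\<dots> = 2 * (sqrt (real p * class_var (T c) \<alpha> p) * sqrt (real p * class_var (T' c) \<beta> p))"
        by (simp only: real_sqrt_mult mult_ac)
      also have "\<dots> \<le> 2 * \<bar>sqrt (real p * class_var (T c) \<alpha> p) * sqrt (real p * class_var (T' c) \<beta> p)\<bar>"
        by simp
      finally show "\<bar>Q c p\<bar> \<le> 2 * \<bar>sqrt (real p * class_var (T c) \<alpha> p) * sqrt (real p * class_var (T' c) \<beta> p)\<bar>" .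
    qed
    also have "\<dots> = 2 * (\<Sum>p\<in>P. \<bar>sqrt (real p * class_var (T c) \<alpha> p) * sqrt (real p * class_var (T' c) \<beta> p)\<bar>)"
      by (simp add: sum_distrib_left)
    also have "\<dots> \<le> 2 * (sqrt (\<Sum>p\<in>P. real p * class_var (T c) \<alpha> p) * sqrt (\<Sum>p\<in>P. real p * class_var (T' c) \<beta> p))"
      by (intro mult_left_mono sum_abs_le_sqrt_mult_sqrt) (auto simp: class_var_nonneg)
    also have "\<dots> \<le> 2 * (sqrt (W c) * sqrt (W' c))"
      by (intro mult_left_mono mult_mono real_sqrt_le_mono W W' real_sqrt_ge_zero W0 sum_nonneg)
         (auto simp: class_var_nonneg)
    finally show ?thesis .
  qed
  have "(\<Sum>p\<in>P. \<bar>\<Sum>m<X. \<Sum>n<Y. \<alpha> m * \<beta> n * deviation_kernel d p (m * n)\<bar>) \<le> (\<Sum>p\<in>P. \<Sum>c<d. \<bar>Q c p\<bar>)"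
    unfolding split by (intro sum_mono sum_abs)
  also have "\<dots> = (\<Sum>c<d. \<Sum>p\<in>P. \<bar>Q c p\<bar>)" by (rule sum.swap)
  also have "\<dots> \<le> (\<Sum>c<d. 2 * \<bar>sqrt (W c) * sqrt (W' c)\<bar>)"
    using per_class W0 by (intro sum_mono) simp
  also have "\<dots> = 2 * (\<Sum>c<d. \<bar>sqrt (W c) * sqrt (W' c)\<bar>)" by (simp add: sum_distrib_left)
  also have "\<dots> \<le> 2 * (sqrt (\<Sum>c<d. W c) * sqrt (\<Sum>c<d. W' c))"
    by (intro mult_left_mono sum_abs_le_sqrt_mult_sqrt) (auto simp: W0)
  also have "\<dots> \<le> 2 * (sqrt ((real X / real d + 2 * real y ^ 3) * (\<Sum>m<X. \<alpha> m ^ 2)) *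
         sqrt ((real Y / real d + 2 * real y ^ 3) * (\<Sum>n<Y. \<beta> n ^ 2)))"
  proof (intro mult_left_mono mult_mono real_sqrt_le_mono)
    have "(\<Sum>m<X. \<alpha> m ^ 2) = (\<Sum>c<d. \<Sum>m\<in>{m\<in>{..<X}. m mod d = c}. \<alpha> m ^ 2)"
      by (rule sum.group [symmetric]) (use d in auto)
    also have "\<dots> = (\<Sum>c<d. \<Sum>m\<in>T c. \<alpha> m ^ 2)" by (intro sum.cong refl) (simp add: T_mod)
    finally show "(\<Sum>c<d. W c) \<le> (real X / real d + 2 * real y ^ 3) * (\<Sum>m<X. \<alpha> m ^ 2)"
      by (simp add: W_def sum_distrib_left)
    have disj: "T' c \<inter> T' c' = {}" if "c < d" "c' < d" "c \<noteq> c'" for c c'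
      using that inverse_mod_prime_unique[of _ c d c'] by (auto simp: T'_def mult.commute)
    have "(\<Sum>c<d. \<Sum>n\<in>T' c. \<beta> n ^ 2) = (\<Sum>n\<in>(\<Union>c<d. T' c). \<beta> n ^ 2)"
      using disj fin by (subst sum.UNION_disjoint) auto
    also have "\<dots> \<le> (\<Sum>n<Y. \<beta> n ^ 2)"
      by (rule sum_mono2) (auto simp: T'_def)
    finally show "(\<Sum>c<d. W' c) \<le> (real Y / real d + 2 * real y ^ 3) * (\<Sum>n<Y. \<beta> n ^ 2)"
      unfolding W'_def sum_distrib_left [symmetric] by (intro mult_left_mono) auto
  qed (auto intro!: sum_nonneg W0 mult_nonneg_nonneg)
  finally show ?thesis .
qed

text \<open>
  Exactly one binary digit position decides the comparison of \<open>n\<close> with \<open>H\<close>: the highest one at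
  which they differ.  There \<open>H\<close> has digit 1, \<open>n\<close> has digit 0, and the higher digits agree.  The
  summand for position \<open>b\<close> expresses this through the quotients by \<open>2 ^ b\<close>.
\<close>

lemma less_iff_binary_digits:
  fixes n H r :: nat
  assumes "H < 2 ^ r"
  shows "(\<Sum>b<r. if odd (H div 2 ^ b) \<and> n div 2 ^ b + 1 = H div 2 ^ b then 1 else 0 :: real) =
         (if n < H then 1 else 0)"
  using assms
proof (induction r arbitrary: n H)
  case 0
  thus ?case by simp
next
  case (Suc r)
  have "H div 2 < 2 ^ r" using Suc.prems by (simp add: less_mult_imp_div_less)
  note IH = Suc.IH[OF this, of "n div 2"]
  have "(\<Sum>b<Suc r. if odd (H div 2 ^ b) \<and> n div 2 ^ b + 1 = H div 2 ^ b then 1 else 0 :: real) =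
        (if odd H \<and> n + 1 = H then 1 else 0) + (if n div 2 < H div 2 then 1 else 0)"
    unfolding sum.lessThan_Suc_shift using IH by (simp add: div_mult2_eq)
  also have "\<dots> = (if n < H then 1 else 0)"
  proof -
    have "n < H \<longleftrightarrow> (odd H \<and> n + 1 = H) \<or> n div 2 < H div 2" by presburger
    moreover have "\<not> ((odd H \<and> n + 1 = H) \<and> n div 2 < H div 2)" by presburger
    ultimately show ?thesis by auto
  qed
  finally show ?case .
qed

lemma sum_swap_innermost:
  "(\<Sum>b\<in>A. \<Sum>v\<in>B. \<Sum>m\<in>C. g b v m) = (\<Sum>m\<in>C. \<Sum>b\<in>A. \<Sum>v\<in>B. g b v m)"
proof -
  have "(\<Sum>b\<in>A. \<Sum>v\<in>B. \<Sum>m\<in>C. g b v m) = (\<Sum>b\<in>A. \<Sum>m\<in>C. \<Sum>v\<in>B. g b v m)"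
    by (rule sum.cong[OF refl], rule sum.swap)
  also have "\<dots> = (\<Sum>m\<in>C. \<Sum>b\<in>A. \<Sum>v\<in>B. g b v m)" by (rule sum.swap)
  finally show ?thesis .
qed

text \<open>
  The condition \<open>n < H m\<close> couples the two variables.  By binary digits it splits into \<open>r\<close>
  levels, and on level \<open>b\<close> it only asks that two functions, one of \<open>m\<close> and one of \<open>n\<close>, take a
  common value \<open>v\<close>.  For a fixed level the sets of \<open>m\<close>, and likewise of \<open>n\<close>, that belong to
  different \<open>v\<close> are disjoint, so summing the box estimate over \<open>v\<close> costs nothing and only the
  number \<open>r\<close> of levels is lost.
\<close>

lemma bilinear_hyperbola:
  fixes \<alpha> \<beta> :: "nat \<Rightarrow> real" and X Y d y r :: nat and H :: "nat \<Rightarrow> nat"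
  assumes "finite P" and P: "\<And>p. p \<in> P \<Longrightarrow> prime p \<and> p \<le> y \<and> \<not> p dvd d" and d: "d > 0"
    and H: "\<And>m. m < X \<Longrightarrow> H m \<le> Y" and Y: "Y < 2 ^ r"
  shows "(\<Sum>p\<in>P. \<bar>\<Sum>m<X. \<Sum>n<H m. \<alpha> m * \<beta> n * deviation_kernel d p (m * n)\<bar>) \<le>
    2 * real r * (sqrt ((real X / real d + 2 * real y ^ 3) * (\<Sum>m<X. \<alpha> m ^ 2)) *
         sqrt ((real Y / real d + 2 * real y ^ 3) * (\<Sum>n<Y. \<beta> n ^ 2)))"
proof -
  define A where "A = real X / real d + 2 * real y ^ 3"
  define B where "B = real Y / real d + 2 * real y ^ 3"
  have AB: "A \<ge> 0" "B \<ge> 0" by (simp_all add: A_def B_def)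
  \<comment> \<open>A level \<open>b\<close> and a value \<open>v\<close> select the \<open>m\<close> and the \<open>n\<close> that are compared at digit \<open>b\<close>.\<close>
  define \<alpha>' where "\<alpha>' = (\<lambda>b v m. if odd (H m div 2 ^ b) \<and> H m div 2 ^ b = v + 1 then \<alpha> m else 0)"
  define \<beta>' where "\<beta>' = (\<lambda>b v n. if n div 2 ^ b = v then \<beta> n else 0)"
  define Q where "Q = (\<lambda>b v p. \<Sum>m<X. \<Sum>n<Y. \<alpha>' b v m * \<beta>' b v n * deviation_kernel d p (m * n))"
  have split: "(\<Sum>m<X. \<Sum>n<H m. \<alpha> m * \<beta> n * deviation_kernel d p (m * n)) = (\<Sum>b<r. \<Sum>v<Y. Q b v p)" for p
  proof -
    have "(\<Sum>b<r. \<Sum>v<Y. Q b v p) =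
          (\<Sum>m<X. \<Sum>n<Y. \<Sum>b<r. \<Sum>v<Y. \<alpha>' b v m * \<beta>' b v n * deviation_kernel d p (m * n))"
    proof -
      have "(\<Sum>b<r. \<Sum>v<Y. Q b v p) = (\<Sum>m<X. \<Sum>b<r. \<Sum>v<Y. \<Sum>n<Y. \<alpha>' b v m * \<beta>' b v n * deviation_kernel d p (m * n))"
        unfolding Q_def by (rule sum_swap_innermost)
      also have "\<dots> = (\<Sum>m<X. \<Sum>n<Y. \<Sum>b<r. \<Sum>v<Y. \<alpha>' b v m * \<beta>' b v n * deviation_kernel d p (m * n))"
        by (rule sum.cong[OF refl], rule sum_swap_innermost)
      finally show ?thesis .
    qed
    also have "\<dots> = (\<Sum>m<X. \<Sum>n<H m. \<alpha> m * \<beta> n * deviation_kernel d p (m * n))"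
    proof (rule sum.cong[OF refl])
      fix m assume m: "m \<in> {..<X}"
      have "(\<Sum>b<r. \<Sum>v<Y. \<alpha>' b v m * \<beta>' b v n * deviation_kernel d p (m * n)) =
            (if n < H m then \<alpha> m * \<beta> n * deviation_kernel d p (m * n) else 0)" if n: "n < Y" for n
      proof -
        have "(\<Sum>v<Y. \<alpha>' b v m * \<beta>' b v n * deviation_kernel d p (m * n)) =
              (if odd (H m div 2 ^ b) \<and> n div 2 ^ b + 1 = H m div 2 ^ b then 1 else 0) *
              (\<alpha> m * \<beta> n * deviation_kernel d p (m * n))" for b
        proof -
          have "(\<Sum>v<Y. \<alpha>' b v m * \<beta>' b v n * deviation_kernel d p (m * n)) =
            (\<Sum>v<Y. if n div 2 ^ b = v then \<alpha>' b v m * \<beta> n * deviation_kernel d p (m * n) else 0)"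
            by (intro sum.cong refl) (simp add: \<beta>'_def)
          also have "\<dots> = \<alpha>' b (n div 2 ^ b) m * \<beta> n * deviation_kernel d p (m * n)"
            using n le_less_trans[OF div_le_dividend[of n "2 ^ b"], of Y] by (subst sum.delta') auto
          finally show ?thesis by (auto simp: \<alpha>'_def)
        qed
        hence "(\<Sum>b<r. \<Sum>v<Y. \<alpha>' b v m * \<beta>' b v n * deviation_kernel d p (m * n)) =
              (\<Sum>b<r. if odd (H m div 2 ^ b) \<and> n div 2 ^ b + 1 = H m div 2 ^ b then 1 else 0) *
              (\<alpha> m * \<beta> n * deviation_kernel d p (m * n))"
          by (simp only: sum_distrib_right)
        also have "(\<Sum>b<r. if odd (H m div 2 ^ b) \<and> n div 2 ^ b + 1 = H m div 2 ^ b then 1 else 0 :: real) =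
                   (if n < H m then 1 else 0)"
          by (rule less_iff_binary_digits) (use H[of m] m Y in auto)
        finally show ?thesis by simp
      qed
      hence "(\<Sum>n<Y. \<Sum>b<r. \<Sum>v<Y. \<alpha>' b v m * \<beta>' b v n * deviation_kernel d p (m * n)) =
             (\<Sum>n<Y. if n < H m then \<alpha> m * \<beta> n * deviation_kernel d p (m * n) else 0)"
        by (intro sum.cong refl) auto
      also have "\<dots> = (\<Sum>n<H m. \<alpha> m * \<beta> n * deviation_kernel d p (m * n))"
        by (rule sum.mono_neutral_cong_right) (use H[of m] m in auto)
      finally show "(\<Sum>n<Y. \<Sum>b<r. \<Sum>v<Y. \<alpha>' b v m * \<beta>' b v n * deviation_kernel d p (m * n)) =
             (\<Sum>n<H m. \<alpha> m * \<beta> n * deviation_kernel d p (m * n))" .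
    qed
    finally show ?thesis by (rule sym)
  qed
  have level: "(\<Sum>v<Y. \<Sum>p\<in>P. \<bar>Q b v p\<bar>) \<le> 2 * (sqrt (A * (\<Sum>m<X. \<alpha> m ^ 2)) * sqrt (B * (\<Sum>n<Y. \<beta> n ^ 2)))" for b
  proof -
    define F where "F = (\<lambda>v. A * (\<Sum>m<X. \<alpha>' b v m ^ 2))"
    define G where "G = (\<lambda>v. B * (\<Sum>n<Y. \<beta>' b v n ^ 2))"
    have FG0: "F v \<ge> 0" "G v \<ge> 0" for v
      using AB by (auto simp: F_def G_def intro!: mult_nonneg_nonneg sum_nonneg)
    have "(\<Sum>v<Y. \<Sum>p\<in>P. \<bar>Q b v p\<bar>) \<le> (\<Sum>v<Y. 2 * (sqrt (F v) * sqrt (G v)))"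
      unfolding Q_def F_def G_def A_def B_def
      by (intro sum_mono bilinear_box[OF assms(1-3)])
    also have "\<dots> = 2 * (\<Sum>v<Y. \<bar>sqrt (F v) * sqrt (G v)\<bar>)"
      unfolding sum_distrib_left using FG0 by (intro sum.cong refl) simp
    also have "\<dots> \<le> 2 * (sqrt (\<Sum>v<Y. F v) * sqrt (\<Sum>v<Y. G v))"
      by (intro mult_left_mono sum_abs_le_sqrt_mult_sqrt) (auto simp: FG0)
    also have "\<dots> \<le> 2 * (sqrt (A * (\<Sum>m<X. \<alpha> m ^ 2)) * sqrt (B * (\<Sum>n<Y. \<beta> n ^ 2)))"
    proof (intro mult_left_mono mult_mono real_sqrt_le_mono)
      have "(\<Sum>v<Y. \<Sum>m<X. \<alpha>' b v m ^ 2) \<le> (\<Sum>m<X. \<alpha> m ^ 2)"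
      proof (subst sum.swap, rule sum_mono)
        fix m
        have "(\<Sum>v<Y. \<alpha>' b v m ^ 2) \<le> (\<Sum>v<Y. if H m div 2 ^ b - 1 = v then \<alpha> m ^ 2 else 0)"
          by (intro sum_mono) (auto simp: \<alpha>'_def)
        also have "\<dots> \<le> \<alpha> m ^ 2" by (subst sum.delta') auto
        finally show "(\<Sum>v<Y. \<alpha>' b v m ^ 2) \<le> \<alpha> m ^ 2" .
      qed
      thus "(\<Sum>v<Y. F v) \<le> A * (\<Sum>m<X. \<alpha> m ^ 2)"
        unfolding F_def sum_distrib_left [symmetric] using AB by (intro mult_left_mono)
      have "(\<Sum>v<Y. \<Sum>n<Y. \<beta>' b v n ^ 2) \<le> (\<Sum>n<Y. \<beta> n ^ 2)"
      proof (subst sum.swap, rule sum_mono)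
        fix n
        have "(\<Sum>v<Y. \<beta>' b v n ^ 2) \<le> (\<Sum>v<Y. if n div 2 ^ b = v then \<beta> n ^ 2 else 0)"
          by (intro sum_mono) (auto simp: \<beta>'_def)
        also have "\<dots> \<le> \<beta> n ^ 2" by (subst sum.delta') auto
        finally show "(\<Sum>v<Y. \<beta>' b v n ^ 2) \<le> \<beta> n ^ 2" .
      qed
      thus "(\<Sum>v<Y. G v) \<le> B * (\<Sum>n<Y. \<beta> n ^ 2)"
        unfolding G_def sum_distrib_left [symmetric] using AB by (intro mult_left_mono)
    qed (auto intro!: sum_nonneg FG0 mult_nonneg_nonneg AB)
    finally show ?thesis .
  qed
  have "(\<Sum>p\<in>P. \<bar>\<Sum>m<X. \<Sum>n<H m. \<alpha> m * \<beta> n * deviation_kernel d p (m * n)\<bar>) \<le>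
        (\<Sum>p\<in>P. \<Sum>b<r. \<Sum>v<Y. \<bar>Q b v p\<bar>)"
    unfolding split by (intro sum_mono order_trans[OF sum_abs] sum_mono sum_abs)
  also have "\<dots> = (\<Sum>b<r. \<Sum>v<Y. \<Sum>p\<in>P. \<bar>Q b v p\<bar>)"
    by (subst sum.swap, rule sum.cong[OF refl], rule sum.swap)
  also have "\<dots> \<le> (\<Sum>b<r. 2 * (sqrt (A * (\<Sum>m<X. \<alpha> m ^ 2)) * sqrt (B * (\<Sum>n<Y. \<beta> n ^ 2))))"
    by (intro sum_mono level)
  also have "\<dots> = 2 * real r * (sqrt (A * (\<Sum>m<X. \<alpha> m ^ 2)) * sqrt (B * (\<Sum>n<Y. \<beta> n ^ 2)))"
    by simp
  finally show ?thesis by (simp only: A_def B_def)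
qed

section \<open>Vaughan's identity\<close>

definition moebius :: "nat \<Rightarrow> real" where
  "moebius n = (if squarefree n then (-1) ^ card (prime_factors n) else 0)"

lemma abs_moebius_le: "\<bar>moebius n\<bar> \<le> 1"
  by (simp add: moebius_def)

lemma moebius_prime_mult:
  assumes "prime p" "\<not> p dvd e"
  shows "moebius (p * e) = - moebius e"
proof -
  have cop: "coprime p e" using assms by (simp add: prime_imp_coprime)
  have sq: "squarefree (p * e) \<longleftrightarrow> squarefree e"
    using squarefree_mult_coprime[OF cop squarefree_prime] squarefree_mono[of e "p * e"] assms(1)
    by auto
  have "e \<noteq> 0" using assms by (metis dvd_0_right)
  hence "prime_factors (p * e) = insert p (prime_factors e)"
    using assms(1) by (subst prime_factors_product) (auto simp: prime_prime_factors prime_gt_0_nat)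
  moreover have "p \<notin> prime_factors e" using assms by auto
  ultimately show ?thesis by (simp add: moebius_def sq)
qed

text \<open>
  For a prime \<open>p\<close> dividing \<open>n\<close>, multiplication by \<open>p\<close> pairs the squarefree divisors prime to \<open>p\<close>
  with those divisible by \<open>p\<close>, and the two members of a pair cancel.
\<close>

lemma sum_moebius_divisors:
  assumes "n > 0"
  shows "(\<Sum>e | e dvd n. moebius e) = (if n = 1 then 1 else 0)"
proof (cases "n = 1")
  case True
  thus ?thesis by (simp add: moebius_def)
next
  case False
  then obtain p where p: "prime p" "p dvd n" using prime_factor_nat by blast
  define A0 where "A0 = {e. e dvd n \<and> squarefree e \<and> \<not> p dvd e}"
  define A1 where "A1 = {e. e dvd n \<and> squarefree e \<and> p dvd e}"
  have fin: "finite {e. e dvd n}" using assms by simp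
  have fin': "finite A0" "finite A1" by (rule finite_subset[OF _ fin], force simp: A0_def A1_def)+
  have "(\<Sum>e | e dvd n. moebius e) = (\<Sum>e\<in>A0 \<union> A1. moebius e)"
    by (rule sum.mono_neutral_right) (use fin in \<open>auto simp: A0_def A1_def moebius_def\<close>)
  also have "\<dots> = (\<Sum>e\<in>A0. moebius e) + (\<Sum>e\<in>A1. moebius e)"
    by (rule sum.union_disjoint) (use fin' in \<open>auto simp: A0_def A1_def\<close>)
  also have "(\<Sum>e\<in>A1. moebius e) = (\<Sum>e\<in>A0. moebius (p * e))"
  proof (rule sum.reindex_bij_witness[of _ "\<lambda>e. p * e" "\<lambda>e. e div p"])
    fix e assume e: "e \<in> A1"
    then obtain e' where e': "e = p * e'" by (auto simp: A1_def)
    have "\<not> p dvd e'"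
    proof
      assume "p dvd e'"
      then obtain e'' where "e' = p * e''" by blast
      hence "p ^ 2 dvd e" by (simp add: e' power2_eq_square)
      moreover have "squarefree e" using e by (simp add: A1_def)
      ultimately have "is_unit p" unfolding squarefree_def by blast
      thus False using p by (simp add: not_prime_unit)
    qed
    moreover have "squarefree e'" using e squarefree_mono[of e' e] by (auto simp: A1_def e')
    moreover have "e' dvd n" using e by (auto simp: A1_def e' dest: dvd_mult_right)
    ultimately show "e div p \<in> A0" "p * (e div p) = e"
      using p prime_gt_0_nat[of p] by (auto simp: e' A0_def)
    thus "moebius (p * (e div p)) = moebius e" by simp
  next
    fix e assume e: "e \<in> A0"
    have cop: "coprime p e" using e p by (simp add: A0_def prime_imp_coprime)
    show "p * e div p = e" using p prime_gt_0_nat[of p] by simp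
    have "squarefree (p * e)"
      using e p by (intro squarefree_mult_coprime[OF cop squarefree_prime]) (auto simp: A0_def)
    thus "p * e \<in> A1" using e p cop by (auto simp: A0_def A1_def divides_mult)
  qed
  also have "\<dots> = - (\<Sum>e\<in>A0. moebius e)"
    using p by (simp add: moebius_prime_mult A0_def sum_negf)
  finally show ?thesis using False by simp
qed

lemma sum_divisors_eq_sum_hyperbola:
  fixes F :: "nat \<Rightarrow> nat \<Rightarrow> real"
  shows "(\<Sum>n=1..z. \<Sum>m | m dvd n. F m (n div m)) = (\<Sum>m=1..z. \<Sum>l=1..z div m. F m l)"
proof -
  have "(\<Sum>n=1..z. \<Sum>m | m dvd n. F m (n div m)) =
        (\<Sum>(n, m)\<in>(SIGMA n:{1..z}. {m. m dvd n}). F m (n div m))"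
    by (subst sum.Sigma) auto
  also have "\<dots> = (\<Sum>(m, l)\<in>(SIGMA m:{1..z}. {1..z div m}). F m l)"
  proof (rule sum.reindex_bij_witness[of _ "\<lambda>(m, l). (m * l, m)" "\<lambda>(n, m). (m, n div m)"], goal_cases)
    case (2 a)
    then obtain n m where a: "a = (n, m)" "1 \<le> n" "n \<le> z" "m dvd n" by auto
    have "m > 0" "m \<le> n" using a by (auto intro: Nat.gr0I dvd_imp_le)
    thus ?case using a by (auto simp: Suc_le_eq div_le_mono div_greater_zero_iff)
  next
    case (4 a)
    then obtain m l where a: "a = (m, l)" "1 \<le> m" "1 \<le> l" "l \<le> z div m" by auto
    hence "m * l \<le> z" by (simp add: less_eq_div_iff_mult_less_eq mult.commute)
    thus ?case using a by auto
  qed auto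
  also have "\<dots> = (\<Sum>m=1..z. \<Sum>l=1..z div m. F m l)"
    by (subst sum.Sigma) auto
  finally show ?thesis .
qed

definition mangoldt_above :: "nat \<Rightarrow> nat \<Rightarrow> real" where
  "mangoldt_above U n = (if n > U then mangoldt n else 0)"

text \<open>
  The error made when the divisor sum of the Moebius function is truncated at \<open>V\<close>.
\<close>

definition moebius_remainder :: "nat \<Rightarrow> nat \<Rightarrow> real" where
  "moebius_remainder V l = (\<Sum>b | b dvd l \<and> b \<le> V. moebius b) - (if l = 1 then 1 else 0)"

text \<open>
  Let \<open>M\<close> be the Moebius function truncated at \<open>V\<close> and \<open>E\<close> the remainder, so that the Dirichlet
  convolution of \<open>M\<close> with the constant 1 is the unit plus \<open>E\<close>.  The triple convolution of the
  von Mangoldt function, \<open>M\<close> and 1 is computed in two ways.  Grouping the von Mangoldt function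
  with 1 gives the logarithm, hence the first sum.  Splitting the von Mangoldt function at \<open>U\<close>
  gives the second sum from the lower part, and from the upper part its convolution with the unit
  plus \<open>E\<close>.  In the third sum both variables are large, because \<open>E\<close> vanishes up to \<open>V\<close>.
\<close>

theorem vaughan_identity:
  fixes w :: "nat \<Rightarrow> real"
  shows "(\<Sum>n=1..z. mangoldt_above U n * w n) =
     (\<Sum>b=1..V. moebius b * (\<Sum>l=1..z div b. ln (real l) * w (b * l)))
   - (\<Sum>a=1..U. \<Sum>b=1..V. mangoldt a * moebius b * (\<Sum>c=1..z div (a * b). w (a * b * c)))
   - (\<Sum>m=1..z. \<Sum>l=1..z div m. mangoldt_above U m * moebius_remainder V l * w (m * l))"
proof -
  \<comment> \<open>The contribution of a fixed value \<open>a\<close> of the first variable to the triple convolution.\<close>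
  define I where "I = (\<lambda>a. \<Sum>b=1..V. moebius b * (\<Sum>c=1..z div (a * b). w (a * b * c)))"
  have I_eq: "I a = (if a \<le> z then w a else 0) + (\<Sum>l=1..z div a. moebius_remainder V l * w (a * l))"
    if a: "a > 0" for a
  proof -
    have "(\<Sum>l=1..z div a. \<Sum>b | b dvd l. (if b \<le> V then moebius b else 0) * w (a * b * (l div b))) =
          (\<Sum>b=1..z div a. \<Sum>c=1..z div a div b. (if b \<le> V then moebius b else 0) * w (a * b * c))"
      by (rule sum_divisors_eq_sum_hyperbola)
    also have "\<dots> = (\<Sum>b=1..V. \<Sum>c=1..z div a div b. moebius b * w (a * b * c))"
      by (rule sum.mono_neutral_cong) (auto simp: div_eq_0_iff not_le)
    also have "\<dots> = I a" by (simp add: I_def sum_distrib_left div_mult2_eq)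
    also have "(\<Sum>l=1..z div a. \<Sum>b | b dvd l. (if b \<le> V then moebius b else 0) * w (a * b * (l div b))) =
          (\<Sum>l=1..z div a. (if l = 1 then w a else 0) + moebius_remainder V l * w (a * l))"
    proof (rule sum.cong[OF refl])
      fix l assume l: "l \<in> {1..z div a}"
      have "(\<Sum>b | b dvd l. (if b \<le> V then moebius b else 0) * w (a * b * (l div b))) =
            (\<Sum>b | b dvd l. (if b \<le> V then moebius b else 0) * w (a * l))"
        by (rule sum.cong[OF refl]) (auto simp: mult.assoc)
      also have "\<dots> = (\<Sum>b | b dvd l. (if b \<le> V then moebius b else 0)) * w (a * l)"
        by (simp only: sum_distrib_right)
      also have "(\<Sum>b | b dvd l. (if b \<le> V then moebius b else 0)) = (\<Sum>b | b dvd l \<and> b \<le> V. moebius b)"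
        by (rule sum.mono_neutral_cong_right) (use l in auto)
      finally show "(\<Sum>b | b dvd l. (if b \<le> V then moebius b else 0) * w (a * b * (l div b))) =
          (if l = 1 then w a else 0) + moebius_remainder V l * w (a * l)"
        by (simp add: moebius_remainder_def algebra_simps)
    qed
    also have "\<dots> = (\<Sum>l=1..z div a. if l = 1 then w a else 0) + (\<Sum>l=1..z div a. moebius_remainder V l * w (a * l))"
      by (rule sum.distrib)
    also have "(\<Sum>l=1..z div a. if l = 1 then w a else 0) = (if a \<le> z then w a else 0)"
      using a by (simp add: sum.delta Suc_le_eq div_greater_zero_iff)
    finally show ?thesis by simp
  qed
  have I_0: "I a = 0" if "a > z" for a
    using that by (simp add: I_def div_mult2_eq)
  have A: "(\<Sum>a=1..z. mangoldt_above U a * I a) = (\<Sum>a=1..z. mangoldt_above U a * w a) +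
      (\<Sum>m=1..z. \<Sum>l=1..z div m. mangoldt_above U m * moebius_remainder V l * w (m * l))"
    unfolding sum.distrib [symmetric]
    by (rule sum.cong[OF refl]) (simp add: I_eq ring_distribs sum_distrib_left mult.assoc)
  have "(\<Sum>a=1..z. mangoldt a * I a) =
        (\<Sum>a=1..z. mangoldt_above U a * I a) + (\<Sum>a=1..z. (if a \<le> U then mangoldt a else 0) * I a)"
    unfolding sum.distrib [symmetric] by (rule sum.cong[OF refl]) (simp add: mangoldt_above_def)
  also have "(\<Sum>a=1..z. (if a \<le> U then mangoldt a else 0) * I a) = (\<Sum>a=1..U. mangoldt a * I a)"
    by (rule sum.mono_neutral_cong) (auto simp: I_0 not_le)
  finally have B: "(\<Sum>a=1..z. mangoldt a * I a) =
        (\<Sum>a=1..z. mangoldt_above U a * I a) + (\<Sum>a=1..U. mangoldt a * I a)" .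
  have "(\<Sum>a=1..z. mangoldt a * I a) =
        (\<Sum>b=1..V. \<Sum>a=1..z. mangoldt a * (moebius b * (\<Sum>c=1..z div (a * b). w (a * b * c))))"
    unfolding I_def sum_distrib_left by (rule sum.swap)
  also have "\<dots> = (\<Sum>b=1..V. moebius b * (\<Sum>l=1..z div b. ln (real l) * w (b * l)))"
  proof (rule sum.cong[OF refl])
    fix b assume b: "b \<in> {1..V}"
    have "(\<Sum>l=1..z div b. ln (real l) * w (b * l)) =
          (\<Sum>l=1..z div b. \<Sum>a | a dvd l. mangoldt a * w (a * b * (l div a)))"
    proof (rule sum.cong[OF refl])
      fix l assume l: "l \<in> {1..z div b}"
      have "ln (real l) * w (b * l) = (\<Sum>a | a dvd l. mangoldt a) * w (b * l)"
        using l by (subst mangoldt_sum) auto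
      also have "\<dots> = (\<Sum>a | a dvd l. mangoldt a * w (b * l))" by (simp only: sum_distrib_right)
      also have "\<dots> = (\<Sum>a | a dvd l. mangoldt a * w (a * b * (l div a)))"
      proof (rule sum.cong[OF refl])
        fix a assume "a \<in> {a. a dvd l}"
        hence "a * b * (l div a) = b * l"
          by (simp add: mult.commute[of a b] mult.assoc)
        thus "mangoldt a * w (b * l) = mangoldt a * w (a * b * (l div a))" by (simp only:)
      qed
      finally show "ln (real l) * w (b * l) = \<dots>" .
    qed
    also have "\<dots> = (\<Sum>a=1..z div b. \<Sum>c=1..z div b div a. mangoldt a * w (a * b * c))"
      by (rule sum_divisors_eq_sum_hyperbola)
    also have "\<dots> = (\<Sum>a=1..z. \<Sum>c=1..z div b div a. mangoldt a * w (a * b * c))"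
      by (rule sum.mono_neutral_cong) (auto simp: div_eq_0_iff not_le dest: order_trans[OF _ div_le_dividend])
    also have "\<dots> = (\<Sum>a=1..z. mangoldt a * (\<Sum>c=1..z div (a * b). w (a * b * c)))"
      by (simp add: sum_distrib_left div_mult2_eq [symmetric] mult.commute)
    finally show "(\<Sum>a=1..z. mangoldt a * (moebius b * (\<Sum>c=1..z div (a * b). w (a * b * c)))) =
                  moebius b * (\<Sum>l=1..z div b. ln (real l) * w (b * l))"
      by (simp add: sum_distrib_left mult.left_commute)
  qed
  finally have C: "(\<Sum>a=1..z. mangoldt a * I a) =
      (\<Sum>b=1..V. moebius b * (\<Sum>l=1..z div b. ln (real l) * w (b * l)))" .
  have D: "(\<Sum>a=1..U. mangoldt a * I a) =
      (\<Sum>a=1..U. \<Sum>b=1..V. mangoldt a * moebius b * (\<Sum>c=1..z div (a * b). w (a * b * c)))"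
    unfolding I_def by (simp only: sum_distrib_left mult.assoc)
  show ?thesis using A B C D by linarith
qed

abbreviation divisor_count :: "nat \<Rightarrow> nat" where
  "divisor_count n \<equiv> card {d. d dvd n}"

lemma moebius_remainder_eq_0:
  assumes "l > 0" "l \<le> V"
  shows "moebius_remainder V l = 0"
proof -
  have "{b. b dvd l \<and> b \<le> V} = {b. b dvd l}" using assms by (auto dest: dvd_imp_le)
  thus ?thesis using sum_moebius_divisors[OF assms(1)] by (simp add: moebius_remainder_def)
qed

lemma abs_moebius_remainder_le:
  assumes "l > 0" "V > 0"
  shows "\<bar>moebius_remainder V l\<bar> \<le> real (divisor_count l)"
proof (cases "l \<le> V")
  case True
  thus ?thesis using moebius_remainder_eq_0 assms by simp
next
  case False
  hence "\<bar>moebius_remainder V l\<bar> = \<bar>\<Sum>b | b dvd l \<and> b \<le> V. moebius b\<bar>"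
    using assms by (simp add: moebius_remainder_def)
  also have "\<dots> \<le> (\<Sum>b | b dvd l \<and> b \<le> V. \<bar>moebius b\<bar>)" by (rule sum_abs)
  also have "\<dots> \<le> (\<Sum>b | b dvd l \<and> b \<le> V. 1)" by (intro sum_mono abs_moebius_le)
  also have "\<dots> \<le> real (divisor_count l)"
    using assms by (auto intro!: card_mono)
  finally show ?thesis .
qed

lemma divisor_count_mult_le:
  assumes "a > 0" "b > 0"
  shows "divisor_count (a * b) \<le> divisor_count a * divisor_count b"
proof -
  have sub: "{d. d dvd a * b} \<subseteq> (\<lambda>(x, y). x * y) ` ({d. d dvd a} \<times> {d. d dvd b})"
  proof
    fix d assume "d \<in> {d. d dvd a * b}"
    then obtain x y where "d = x * y" "x dvd a" "y dvd b" using division_decomp by blast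
    thus "d \<in> (\<lambda>(x, y). x * y) ` ({d. d dvd a} \<times> {d. d dvd b})" by auto
  qed
  have "divisor_count (a * b) \<le> card ({d. d dvd a} \<times> {d. d dvd b})"
    by (rule surj_card_le[OF _ sub]) (use assms in simp)
  thus ?thesis by (simp add: card_cartesian_product)
qed

section \<open>Mean squares of the divisor function and Chebyshev's bounds\<close>

text \<open>
  Logarithms are measured by numbers of binary digits throughout: a bound \<open>N < 2 ^ r\<close> makes \<open>r\<close>
  an upper bound for the logarithm of \<open>N\<close>, for harmonic sums and for exponents of prime powers.
\<close>

lemma harmonic_sum_le:
  assumes "N < 2 ^ r"
  shows "(\<Sum>a=1..N. 1 / real a) \<le> real r"
  using assms
proof (induction r arbitrary: N)
  case 0
  thus ?case by simp
next
  case (Suc r)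
  have "(\<Sum>a=1..N. 1 / real a) \<le> (\<Sum>a\<in>{1..2 ^ r - 1} \<union> {2 ^ r..<2 ^ Suc r}. 1 / real a)"
    using Suc.prems by (intro sum_mono2) auto
  also have "\<dots> = (\<Sum>a=1..2 ^ r - 1. 1 / real a) + (\<Sum>a=2 ^ r..<2 ^ Suc r. 1 / real a)"
    by (rule sum.union_disjoint) auto
  also have "(\<Sum>a=2 ^ r..<2 ^ Suc r. 1 / real a) \<le> (\<Sum>a=(2::nat) ^ r..<2 ^ Suc r. 1 / 2 ^ r)"
  proof (rule sum_mono)
    fix a :: nat assume "a \<in> {2 ^ r..<2 ^ Suc r}"
    hence "real (2 ^ r) \<le> real a" by (simp only: of_nat_le_iff atLeastLessThan_iff)
    hence "(2::real) ^ r \<le> real a" by simp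
    moreover have "(0::real) < 2 ^ r" by simp
    ultimately show "1 / real a \<le> 1 / 2 ^ r" by (intro divide_left_mono mult_pos_pos) linarith+
  qed
  also have "\<dots> = 1" by simp
  finally show ?case using Suc.IH[of "2 ^ r - 1"] by simp
qed

text \<open>
  One factor of the square is expanded as a sum over divisors, and submultiplicativity of the
  divisor function separates the variables; this leaves three harmonic sums.
\<close>

lemma sum_divisor_count_square_le:
  assumes "N < 2 ^ r"
  shows "(\<Sum>n=1..N. real (divisor_count n) ^ 2) \<le> real N * real r ^ 3"
proof -
  have real_div: "real (a div b) \<le> real a / real b" for a b :: nat
    by (simp add: of_nat_div_le_of_nat)
  have linear: "(\<Sum>l=1..M. real (divisor_count l)) \<le> real M * real r" if "M \<le> N" for M
  proof -
    have "(\<Sum>l=1..M. real (divisor_count l)) = (\<Sum>a=1..M. \<Sum>c=1..M div a. 1)"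
      using sum_divisors_eq_sum_hyperbola[of "\<lambda>_ _. 1" M] by simp
    also have "\<dots> \<le> (\<Sum>a=1..M. real M * (1 / real a))"
      by (intro sum_mono) (use real_div in auto)
    also have "\<dots> \<le> real M * real r"
      unfolding sum_distrib_left [symmetric] using harmonic_sum_le[of M r] assms that
      by (intro mult_left_mono) auto
    finally show ?thesis .
  qed
  have log: "(\<Sum>m=1..N. real (divisor_count m) / real m) \<le> real r * real r"
  proof -
    have "(\<Sum>m=1..N. real (divisor_count m) / real m) = (\<Sum>m=1..N. \<Sum>a | a dvd m. 1 / (real a * real (m div a)))"
    proof (rule sum.cong[OF refl])
      fix m assume "m \<in> {1..N}"
      have "(\<Sum>a | a dvd m. 1 / (real a * real (m div a))) = (\<Sum>a | a dvd m. 1 / real m)"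
        by (rule sum.cong[OF refl]) (auto simp flip: of_nat_mult)
      thus "real (divisor_count m) / real m = (\<Sum>a | a dvd m. 1 / (real a * real (m div a)))"
        by simp
    qed
    also have "\<dots> = (\<Sum>a=1..N. \<Sum>c=1..N div a. 1 / (real a * real c))"
      by (rule sum_divisors_eq_sum_hyperbola)
    also have "\<dots> = (\<Sum>a=1..N. 1 / real a * (\<Sum>c=1..N div a. 1 / real c))"
      by (simp add: sum_distrib_left)
    also have "\<dots> \<le> (\<Sum>a=1..N. 1 / real a * real r)"
      by (intro sum_mono mult_left_mono harmonic_sum_le le_less_trans[OF div_le_dividend assms]) auto
    also have "\<dots> \<le> real r * real r"
      unfolding sum_distrib_right [symmetric] by (intro mult_right_mono harmonic_sum_le assms) auto
    finally show ?thesis .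
  qed
  have "(\<Sum>n=1..N. real (divisor_count n) ^ 2) = (\<Sum>n=1..N. \<Sum>m | m dvd n. real (divisor_count (m * (n div m))))"
  proof (rule sum.cong[OF refl])
    fix n
    have "(\<Sum>m | m dvd n. real (divisor_count (m * (n div m)))) = (\<Sum>m | m dvd n. real (divisor_count n))"
      by (rule sum.cong[OF refl]) auto
    thus "real (divisor_count n) ^ 2 = (\<Sum>m | m dvd n. real (divisor_count (m * (n div m))))"
      by (simp add: power2_eq_square)
  qed
  also have "\<dots> = (\<Sum>m=1..N. \<Sum>l=1..N div m. real (divisor_count (m * l)))"
    by (rule sum_divisors_eq_sum_hyperbola)
  also have "\<dots> \<le> (\<Sum>m=1..N. \<Sum>l=1..N div m. real (divisor_count m) * real (divisor_count l))"
  proof (intro sum_mono)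
    fix m l assume "m \<in> {1..N}" "l \<in> {1..N div m}"
    hence "divisor_count (m * l) \<le> divisor_count m * divisor_count l"
      by (intro divisor_count_mult_le) auto
    thus "real (divisor_count (m * l)) \<le> real (divisor_count m) * real (divisor_count l)"
      by (simp only: of_nat_le_iff flip: of_nat_mult)
  qed
  also have "\<dots> = (\<Sum>m=1..N. real (divisor_count m) * (\<Sum>l=1..N div m. real (divisor_count l)))"
    by (simp only: sum_distrib_left)
  also have "\<dots> \<le> (\<Sum>m=1..N. real (divisor_count m) * (real N / real m * real r))"
    by (intro sum_mono mult_left_mono order_trans[OF linear] mult_right_mono real_div div_le_dividend) auto
  also have "\<dots> = (\<Sum>m=1..N. real (divisor_count m) / real m) * (real N * real r)"
    unfolding sum_distrib_right by (intro sum.cong refl) simp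
  also have "\<dots> \<le> (real r * real r) * (real N * real r)"
    by (intro mult_right_mono log) auto
  finally show ?thesis by (simp add: power3_eq_cube mult_ac)
qed

lemma ln_le_of_less_power2:
  assumes "n < 2 ^ r"
  shows "ln (real n) \<le> real r"
proof (cases "n = 0")
  case False
  have "real n \<le> 2 ^ r" using assms by (metis less_imp_le of_nat_le_iff of_nat_numeral of_nat_power)
  hence "ln (real n) \<le> ln (2 ^ r)" using False by (subst ln_le_cancel_iff) auto
  also have "\<dots> = real r * ln 2" by (simp add: ln_realpow)
  also have "\<dots> \<le> real r * 1" using ln_le_minus_one[of "2::real"] by (intro mult_left_mono) auto
  finally show ?thesis by simp
qed simp

lemma mangoldt_le_of_less_power2:
  assumes "n < 2 ^ r"
  shows "(mangoldt n :: real) \<le> real r"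
  using Prime_Powers.mangoldt_le[of n] ln_le_of_less_power2[OF assms] by (cases "n = 0") auto

lemma primepow_exponent_less:
  fixes p a r :: nat
  assumes "prime p" "p ^ a < 2 ^ r"
  shows "a < r"
proof -
  have "2 ^ a \<le> p ^ a" using prime_ge_2_nat[OF assms(1)] by (intro power_mono) auto
  hence "(2::nat) ^ a < 2 ^ r" using assms(2) by linarith
  thus ?thesis by simp
qed

text \<open>
  Chebyshev's argument: the central binomial coefficient is at least \<open>4 ^ N / (2 * N)\<close>, while the
  formula for the logarithm of a factorial shows that its logarithm is at most the sum of the
  von Mangoldt function up to \<open>2 * N\<close>.
\<close>

lemma psi_lower_bound:
  assumes "z \<ge> 12"
  shows "(\<Sum>n=1..z. mangoldt n) \<ge> real z / 8"
proof -
  define N where "N = z div 2"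
  have N: "N \<ge> 6" "2 * N \<le> z" "z \<le> 2 * N + 1" using assms by (auto simp: N_def)
  have ln_fact_eq: "ln (fact x) = (\<Sum>a=1..z. mangoldt a * real (x div a))" if "x \<le> z" for x
  proof -
    have "ln (fact x) = (\<Sum>l=1..x. ln (real l))"
      unfolding fact_prod of_nat_prod by (subst ln_prod) auto
    also have "\<dots> = (\<Sum>l=1..x. \<Sum>a | a dvd l. mangoldt a)"
      by (rule sum.cong[OF refl]) (subst mangoldt_sum, auto)
    also have "\<dots> = (\<Sum>a=1..x. \<Sum>c=1..x div a. mangoldt a)"
      by (rule sum_divisors_eq_sum_hyperbola)
    also have "\<dots> = (\<Sum>a=1..x. mangoldt a * real (x div a))" by (simp add: mult.commute)
    also have "\<dots> = (\<Sum>a=1..z. mangoldt a * real (x div a))"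
      by (rule sum.mono_neutral_left) (use that in auto)
    finally show ?thesis .
  qed
  have "real (2 * N choose N) = fact (2 * N) / (fact N * fact N)"
    by (subst binomial_fact) (auto simp: mult_2)
  hence "ln (real (2 * N choose N)) = ln (fact (2 * N)) - 2 * ln (fact N)"
    by (simp add: ln_div ln_mult)
  also have "\<dots> = (\<Sum>a=1..z. mangoldt a * (real (2 * N div a) - 2 * real (N div a)))"
    using N unfolding right_diff_distrib sum_subtractf
    by (simp add: ln_fact_eq sum_distrib_left mult.left_commute)
  also have "\<dots> \<le> (\<Sum>a=1..z. mangoldt a * 1)"
  proof (intro sum_mono mult_left_mono mangoldt_nonneg)
    fix a assume "a \<in> {1..z}"
    hence a: "a > 0" by simp
    have "2 * N < (2 * (N div a) + 2) * a"
      using dividend_less_div_times[of a N] a by (simp add: algebra_simps)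
    hence "2 * N div a < 2 * (N div a) + 2"
      using a by (simp add: less_mult_imp_div_less)
    hence "2 * N div a \<le> 2 * (N div a) + 1" by simp
    hence "real (2 * N div a) \<le> 2 * real (N div a) + 1" by linarith
    thus "real (2 * N div a) - 2 * real (N div a) \<le> 1" by simp
  qed
  finally have upper: "ln (real (2 * N choose N)) \<le> (\<Sum>n=1..z. mangoldt n)" by simp
  have "ln (4 ^ N / (2 * real N)) \<le> ln (real (2 * N choose N))"
    using central_binomial_lower_bound[of N] N by (subst ln_le_cancel_iff) auto
  moreover have "ln (4 ^ N / (2 * real N)) = real N * ln 4 - ln (2 * real N)"
    using N by (simp add: ln_div ln_realpow)
  moreover have ln4: "ln (4 :: real) = 2 * ln 2" using ln_realpow[of 2 2] by simp
  moreover have "ln 2 \<ge> (1 / 2 :: real)" using ln_le_minus_one[of "1 / 2 :: real"] by (simp add: ln_div)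
  moreover have "ln (2 :: real) \<le> 1" using ln_le_minus_one[of "2::real"] by simp
  moreover have "ln (2 * real N) \<le> real N / 2 - 1 + 2 * ln 2"
  proof -
    have "ln (2 * real N) = ln (real N / 2) + ln 4"
      using ln_mult[of "real N / 2" 4] N by simp
    moreover have "ln (real N / 2) \<le> real N / 2 - 1" using N by (intro ln_le_minus_one) auto
    ultimately show ?thesis using ln4 by linarith
  qed
  moreover have "real N * ln 4 \<ge> real N * 1" using calculation(3,4) by (intro mult_left_mono) auto
  ultimately have "(\<Sum>n=1..z. mangoldt n) \<ge> real N - (real N / 2 + 1)" using upper by linarith
  moreover have "real z \<le> 2 * real N + 1" "real N \<ge> 6" using N by linarith+
  ultimately show ?thesis by linarith
qed

text \<open>
  Every prime power up to \<open>y\<close> is determined by its prime and an exponent below \<open>r\<close>.  The two lost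
  factors \<open>r\<close> do not matter below.
\<close>

lemma prime_count_lower_bound:
  assumes "y \<ge> 12" "y < 2 ^ r"
  shows "real (card {p. prime p \<and> p \<le> y}) * real r ^ 2 \<ge> real y / 8"
proof -
  define Q where "Q = {p. prime p \<and> p \<le> y}"
  have finQ: "finite Q" by (auto simp: Q_def)
  have sub: "{n\<in>{1..y}. primepow n} \<subseteq> (\<lambda>(p, a). p ^ a) ` (Q \<times> {..<r})"
  proof
    fix n assume n: "n \<in> {n\<in>{1..y}. primepow n}"
    then obtain p a where pa: "prime p" "a > 0" "n = p ^ a" by (auto simp: primepow_def)
    have "p \<le> p ^ a" using pa prime_ge_1_nat[of p] by (intro self_le_power)
    moreover have le: "p ^ a \<le> y" using n pa(3) by simp
    moreover have "a < r" using pa(1) le_less_trans[OF le assms(2)] by (rule primepow_exponent_less)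
    ultimately have "(p, a) \<in> Q \<times> {..<r}" using pa(1) by (simp add: Q_def)
    thus "n \<in> (\<lambda>(p, a). p ^ a) ` (Q \<times> {..<r})"
      using pa(3) by (intro image_eqI[of _ _ "(p, a)"]) simp_all
  qed
  have "card {n\<in>{1..y}. primepow n} \<le> card (Q \<times> {..<r})"
    by (rule surj_card_le[OF _ sub]) (use finQ in simp)
  hence card: "card {n\<in>{1..y}. primepow n} \<le> card Q * r" by (simp add: card_cartesian_product)
  have "real y / 8 \<le> (\<Sum>n=1..y. mangoldt n)" by (rule psi_lower_bound[OF assms(1)])
  also have "\<dots> = (\<Sum>n | n \<in> {1..y} \<and> primepow n. mangoldt n)"
    by (rule sum.mono_neutral_right) (auto simp: mangoldt_def)
  also have "\<dots> \<le> (\<Sum>n | n \<in> {1..y} \<and> primepow n. real r)"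
    by (intro sum_mono mangoldt_le_of_less_power2) (use assms in auto)
  also have "\<dots> = real (card {n\<in>{1..y}. primepow n}) * real r" by simp
  also have "\<dots> \<le> real (card Q * r) * real r"
    using card by (intro mult_right_mono of_nat_mono) auto
  finally show ?thesis by (simp add: Q_def power2_eq_square mult_ac)
qed

lemma sum_mangoldt_multiples_le:
  assumes "prime p" "z < 2 ^ r"
  shows "(\<Sum>n | n \<in> {1..z} \<and> p dvd n. mangoldt n) \<le> real r ^ 2"
proof -
  have sub: "{n\<in>{1..z}. p dvd n \<and> primepow n} \<subseteq> (\<lambda>a. p ^ a) ` {..<r}"
  proof
    fix n assume n: "n \<in> {n\<in>{1..z}. p dvd n \<and> primepow n}"
    then have "primepow n" "p dvd n" "n \<le> z" by simp_all
    then obtain q a where qa: "prime q" "a > 0" "n = q ^ a" unfolding primepow_def by blast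
    have "p dvd q ^ a" using \<open>p dvd n\<close> unfolding qa(3) .
    hence "p dvd q" using assms(1) prime_dvd_power by blast
    hence "p = q" using assms(1) qa(1) by (intro primes_dvd_imp_eq)
    moreover have "q ^ a < 2 ^ r" using \<open>n \<le> z\<close> assms(2) unfolding qa(3) by (rule le_less_trans)
    hence "a < r" by (rule primepow_exponent_less[OF qa(1)])
    ultimately show "n \<in> (\<lambda>a. p ^ a) ` {..<r}" using qa(3) by (intro image_eqI[of _ _ a]) simp_all
  qed
  have card: "card {n\<in>{1..z}. p dvd n \<and> primepow n} \<le> r"
    using surj_card_le[OF _ sub] by simp
  have "(\<Sum>n | n \<in> {1..z} \<and> p dvd n. mangoldt n) = (\<Sum>n | n \<in> {1..z} \<and> p dvd n \<and> primepow n. mangoldt n :: real)"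
    by (rule sum.mono_neutral_right) (auto simp: mangoldt_def)
  also have "\<dots> \<le> (\<Sum>n | n \<in> {1..z} \<and> p dvd n \<and> primepow n. real r)"
    by (intro sum_mono mangoldt_le_of_less_power2) (use assms in auto)
  also have "\<dots> = real (card {n\<in>{1..z}. p dvd n \<and> primepow n}) * real r" by simp
  also have "\<dots> \<le> real r * real r"
    using card by (intro mult_right_mono) auto
  finally show ?thesis by (simp add: power2_eq_square)
qed

section \<open>Primes congruent to 1 modulo the products dp\<close>

lemma count_residue_class_interval:
  fixes q r j X :: nat
  assumes "q > 0" "j \<le> X + 1"
  shows "\<bar>real (card {l\<in>{j..X}. [l = r] (mod q)}) - (real (X + 1) - real j) / real q\<bar> \<le> 2"
proof -
  define A where "A = (\<lambda>n. {l. l < n \<and> [l = r] (mod q)})"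
  define B where "B = {l\<in>{j..X}. [l = r] (mod q)}"
  have fin: "finite (A j)" "finite B" by (simp_all add: A_def B_def)
  have "l < X + 1 \<longleftrightarrow> l < j \<or> l \<in> {j..X}" for l using assms(2) by auto
  hence "A (X + 1) = A j \<union> B" unfolding A_def B_def by blast
  moreover have "A j \<inter> B = {}" unfolding A_def B_def by fastforce
  ultimately have "card (A (X + 1)) = card (A j) + card B"
    using card_Un_disjoint[OF fin] by presburger
  hence "real (card (A (X + 1))) = real (card (A j)) + real (card B)" by (simp only: of_nat_add)
  moreover have "\<bar>real (card (A n)) - real n / real q\<bar> \<le> 1" for n
    unfolding A_def by (rule count_residue_class_lessThan[OF assms(1)])
  from this[of "X + 1"] this[of j]
    have "\<bar>real (card (A (X + 1))) - real (X + 1) / real q\<bar> \<le> 1" "\<bar>real (card (A j)) - real j / real q\<bar> \<le> 1" .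
  ultimately have "\<bar>real (card B) - (real (X + 1) / real q - real j / real q)\<bar> \<le> 2"
    unfolding abs_le_iff by linarith
  thus ?thesis by (simp only: B_def diff_divide_distrib)
qed

text \<open>
  The \<open>l\<close> for which \<open>m * l\<close> lies in a given class modulo \<open>d\<close> and modulo \<open>p\<close> form one class
  modulo \<open>d * p\<close>, so all the counts compared by the kernel differ by at most 4.  Being bounded
  without any loss in the length of the interval, this settles the sums with a smooth variable.
\<close>

lemma abs_sum_kernel_le:
  fixes d p m j X :: nat
  assumes p: "prime p" "\<not> p dvd d" and d: "d > 0" and j: "j \<le> X + 1"
  shows "\<bar>\<Sum>l=j..X. deviation_kernel d p (m * l)\<bar> \<le> 4 * real p"
proof (cases "coprime m d \<and> \<not> p dvd m")
  case False
  have "deviation_kernel d p (m * l) = 0" for l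
  proof (cases "p dvd m")
    case True
    thus ?thesis using prime_kernel_eq_0[OF p(1), of "m * l"] by (simp add: deviation_kernel_def)
  next
    case False
    with \<open>\<not> (coprime m d \<and> \<not> p dvd m)\<close> have "\<not> coprime m d" by simp
    hence "\<not> [m * l = 1] (mod d)" by (metis coprime_iff_invertible_nat One_nat_def)
    thus ?thesis by (simp add: deviation_kernel_def)
  qed
  thus ?thesis by simp
next
  case True
  have p2: "p \<ge> 2" using p prime_ge_2_nat by blast
  have "coprime d p" using p by (metis prime_imp_coprime coprime_commute)
  have "coprime m p" using p True by (metis prime_imp_coprime coprime_commute)
  hence "coprime m (d * p)" using True by simp
  then obtain m' where m': "[m * m' = 1] (mod (d * p))" using cong_solve_coprime_nat by (metis One_nat_def)
  define c where "c = (real (X + 1) - real j) / real (d * p)"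
  define N where "N = (\<lambda>a. real (card {l\<in>{j..X}. [m * l = 1] (mod d) \<and> [m * l = a] (mod p)}))"
  have N: "\<bar>N a - c\<bar> \<le> 2" for a
  proof -
    obtain s where s: "\<And>l. [l = s] (mod (d * p)) \<longleftrightarrow> [l = 1] (mod d) \<and> [l = a] (mod p)"
      using crt_cong_iff[OF \<open>coprime d p\<close>] by blast
    have "[m * l = s] (mod (d * p)) \<longleftrightarrow> [l = m' * s] (mod (d * p))" for l
    proof -
      have "[m * (m' * s) = s] (mod (d * p))"
        using cong_scalar_right[OF m', of s] by (simp add: mult.assoc)
      hence "[m * l = s] (mod (d * p)) \<longleftrightarrow> [m * l = m * (m' * s)] (mod (d * p))"
        by (meson cong_sym cong_trans)
      also have "\<dots> \<longleftrightarrow> [l = m' * s] (mod (d * p))"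
        using \<open>coprime m (d * p)\<close> by (rule cong_mult_lcancel_nat)
      finally show ?thesis .
    qed
    hence "{l\<in>{j..X}. [m * l = 1] (mod d) \<and> [m * l = a] (mod p)} = {l\<in>{j..X}. [l = m' * s] (mod (d * p))}"
      by (simp only: s [symmetric])
    thus ?thesis unfolding N_def c_def
      using count_residue_class_interval[of "d * p" j X "m' * s"] j d p2 by simp
  qed
  define L where "L = {l\<in>{j..X}. [m * l = 1] (mod d)}"
  have finL: "finite L" by (simp add: L_def)
  have "(\<Sum>l=j..X. deviation_kernel d p (m * l)) = (\<Sum>l\<in>L. prime_kernel p (m * l))"
    by (rule sum.mono_neutral_cong_right) (auto simp: L_def deviation_kernel_def)
  also have "\<dots> = (\<Sum>l\<in>L. if [m * l = 1] (mod p) then real p else 0) -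
                  (\<Sum>l\<in>L. if p dvd m * l then 0 else real p / (real p - 1))"
    by (simp only: prime_kernel_def sum_subtractf)
  also have "(\<Sum>l\<in>L. if [m * l = 1] (mod p) then real p else 0) =
             (\<Sum>l | l \<in> {j..X} \<and> [m * l = 1] (mod d) \<and> [m * l = 1] (mod p). real p)"
    by (rule sum.mono_neutral_cong_right) (auto simp: L_def)
  also have "\<dots> = real p * N 1" by (simp add: N_def mult.commute)
  also have "(\<Sum>l\<in>L. if p dvd m * l then 0 else real p / (real p - 1)) =
             (\<Sum>l | l \<in> L \<and> \<not> p dvd m * l. real p / (real p - 1))"
    by (rule sum.mono_neutral_cong_right) (use finL in auto)
  also have "\<dots> = (\<Sum>a=1..<p. \<Sum>l | l \<in> {l\<in>L. \<not> p dvd m * l} \<and> m * l mod p = a. real p / (real p - 1))"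
    by (rule sum.group [symmetric])
       (use finL p2 in \<open>auto simp: dvd_eq_mod_eq_0 Suc_le_eq\<close>)
  also have "\<dots> = (\<Sum>a=1..<p. real p / (real p - 1) * N a)"
  proof (rule sum.cong[OF refl])
    fix a assume a: "a \<in> {1..<p}"
    have "{l. l \<in> {l\<in>L. \<not> p dvd m * l} \<and> m * l mod p = a} =
          {l\<in>{j..X}. [m * l = 1] (mod d) \<and> [m * l = a] (mod p)}"
      using a by (auto simp: L_def cong_iff_mod_eq dvd_eq_mod_eq_0)
    thus "(\<Sum>l | l \<in> {l\<in>L. \<not> p dvd m * l} \<and> m * l mod p = a. real p / (real p - 1)) =
          real p / (real p - 1) * N a"
      by (simp only: N_def sum_constant mult.commute)
  qed
  also have "\<dots> = real p / (real p - 1) * (\<Sum>a=1..<p. N a)" by (simp only: sum_distrib_left)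
  finally have eq: "(\<Sum>l=j..X. deviation_kernel d p (m * l)) = real p * N 1 - real p / (real p - 1) * (\<Sum>a=1..<p. N a)" .
  have "real p * N 1 = real p / (real p - 1) * (\<Sum>a=1..<p. N 1)"
    using p2 by (simp add: of_nat_diff)
  hence "(\<Sum>l=j..X. deviation_kernel d p (m * l)) = real p / (real p - 1) * (\<Sum>a=1..<p. N 1 - N a)"
    by (simp only: eq sum_subtractf right_diff_distrib)
  also have "\<bar>\<dots>\<bar> = real p / (real p - 1) * \<bar>\<Sum>a=1..<p. N 1 - N a\<bar>"
    using p2 by (simp add: abs_mult)
  also have "\<dots> \<le> real p / (real p - 1) * (\<Sum>a=1..<p. 4)"
  proof (intro mult_left_mono order_trans[OF sum_abs] sum_mono)
    fix a show "\<bar>N 1 - N a\<bar> \<le> 4" using N[of 1] N[of a] by linarith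
  qed (use p2 in auto)
  also have "\<dots> = 4 * real p" using p2 by (simp add: of_nat_diff field_simps)
  finally show ?thesis .
qed

text \<open>
  Partial summation against the increasing function \<open>ln\<close>, carried out by induction downwards from
  \<open>X\<close>.
\<close>

lemma abs_sum_ln_mult_le:
  fixes f :: "nat \<Rightarrow> real"
  assumes bound: "\<And>j. 1 \<le> j \<Longrightarrow> j \<le> X \<Longrightarrow> \<bar>\<Sum>l=j..X. f l\<bar> \<le> C" and X: "X \<ge> 1"
  shows "\<bar>\<Sum>l=1..X. ln (real l) * f l\<bar> \<le> C * ln (real X)"
proof -
  have "\<bar>(\<Sum>l=j..X. ln (real l) * f l) - ln (real j) * (\<Sum>l=j..X. f l)\<bar> \<le> C * (ln (real X) - ln (real j))"
    if "1 \<le> j" "j \<le> X" for j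
    using that(2,1)
  proof (induction j rule: inc_induct)
    case base
    show ?case by simp
  next
    case (step n)
    define S where "S = (\<Sum>l=Suc n..X. f l)"
    define T where "T = (\<Sum>l=Suc n..X. ln (real l) * f l)"
    have n: "{n..X} = insert n {Suc n..X}" using step by auto
    have "ln (real n) \<le> ln (real (Suc n))" using step by (subst ln_le_cancel_iff) auto
    moreover have "\<bar>S\<bar> \<le> C" unfolding S_def using step by (intro bound) auto
    ultimately have "(ln (real (Suc n)) - ln (real n)) * \<bar>S\<bar> \<le> (ln (real (Suc n)) - ln (real n)) * C"
      by (intro mult_left_mono) auto
    hence "\<bar>(ln (real (Suc n)) - ln (real n)) * S\<bar> \<le> (ln (real (Suc n)) - ln (real n)) * C"
      using \<open>ln (real n) \<le> ln (real (Suc n))\<close> by (simp add: abs_mult)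
    moreover have "\<bar>T - ln (real (Suc n)) * S\<bar> \<le> C * (ln (real X) - ln (real (Suc n)))"
      using step unfolding S_def T_def by simp
    moreover have "(\<Sum>l=n..X. ln (real l) * f l) - ln (real n) * (\<Sum>l=n..X. f l) =
        (T - ln (real (Suc n)) * S) + (ln (real (Suc n)) - ln (real n)) * S"
      unfolding n by (simp add: S_def T_def algebra_simps)
    ultimately show ?case by (simp add: algebra_simps abs_le_iff)
  qed
  from this[of 1] show ?thesis using X by simp
qed

lemma mangoldt_above_nonneg: "mangoldt_above U n \<ge> 0"
  by (simp add: mangoldt_above_def mangoldt_nonneg)

lemma mangoldt_above_le: "n < 2 ^ r \<Longrightarrow> mangoldt_above U n \<le> real r"
  by (simp add: mangoldt_above_def mangoldt_le_of_less_power2)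

text \<open>
  The first two sums of Vaughan's identity have one free variable with a smooth weight, while the
  other variables are bounded in terms of \<open>U\<close>.  Bounding the inner sum trivially suffices since
  \<open>U ^ 2\<close> will be much smaller than \<open>z / d\<close>.
\<close>

lemma type_one_bound:
  fixes d p U z r :: nat
  assumes p: "prime p" "\<not> p dvd d" and d: "d > 0" and z: "z + 1 < 2 ^ r" and U: "U \<le> z" "U \<ge> 1"
  shows "\<bar>(\<Sum>b=1..U. moebius b * (\<Sum>l=1..z div b. ln (real l) * deviation_kernel d p (b * l)))\<bar> \<le> 4 * real p * real r * real U"
    and "\<bar>\<Sum>a=1..U. \<Sum>b=1..U. mangoldt a * moebius b * (\<Sum>c=1..z div (a * b). deviation_kernel d p (a * b * c))\<bar>
      \<le> 4 * real p * real r * real U ^ 2"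
proof -
  have "\<bar>(\<Sum>b=1..U. moebius b * (\<Sum>l=1..z div b. ln (real l) * deviation_kernel d p (b * l)))\<bar> \<le>
        (\<Sum>b=1..U. 1 * (4 * real p * real r))"
  proof (intro order_trans[OF sum_abs] sum_mono, unfold abs_mult, intro mult_mono)
    fix b assume b: "b \<in> {1..U}"
    hence zb: "z div b \<ge> 1" using U by (auto simp: Suc_le_eq div_greater_zero_iff)
    have "\<bar>\<Sum>l=1..z div b. ln (real l) * deviation_kernel d p (b * l)\<bar> \<le> 4 * real p * ln (real (z div b))"
      by (intro abs_sum_ln_mult_le abs_sum_kernel_le p d zb) auto
    also have "\<dots> \<le> 4 * real p * real r"
      using le_less_trans[OF div_le_dividend[of z b], of "2 ^ r"] z
      by (intro mult_left_mono ln_le_of_less_power2) auto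
    finally show "\<bar>\<Sum>l=1..z div b. ln (real l) * deviation_kernel d p (b * l)\<bar> \<le> 4 * real p * real r" .
  qed (auto simp: abs_moebius_le)
  thus "\<bar>(\<Sum>b=1..U. moebius b * (\<Sum>l=1..z div b. ln (real l) * deviation_kernel d p (b * l)))\<bar> \<le> 4 * real p * real r * real U"
    by (simp add: mult_ac)
  have "\<bar>\<Sum>a=1..U. \<Sum>b=1..U. mangoldt a * moebius b * (\<Sum>c=1..z div (a * b). deviation_kernel d p (a * b * c))\<bar> \<le>
        (\<Sum>a=1..U. \<Sum>b=1..U. (real r * 1) * (4 * real p))"
  proof (intro order_trans[OF sum_abs] sum_mono, unfold abs_mult, intro mult_mono)
    fix a b assume "a \<in> {1..U}" "b \<in> {1..U}"
    show "\<bar>mangoldt a :: real\<bar> \<le> real r"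
      using \<open>a \<in> {1..U}\<close> U z by (simp add: mangoldt_le_of_less_power2)
    show "\<bar>\<Sum>c=1..z div (a * b). deviation_kernel d p (a * b * c)\<bar> \<le> 4 * real p"
      by (intro abs_sum_kernel_le p d) auto
  qed (auto simp: abs_moebius_le)
  thus "\<bar>\<Sum>a=1..U. \<Sum>b=1..U. mangoldt a * moebius b * (\<Sum>c=1..z div (a * b). deviation_kernel d p (a * b * c))\<bar>
      \<le> 4 * real p * real r * real U ^ 2"
    by (simp add: power2_eq_square mult_ac)
qed

text \<open>
  One dyadic block of the third sum of Vaughan's identity.  If the block contributes, both \<open>m\<close> and
  \<open>z / m\<close> exceed \<open>U\<close> up to a factor 2, and the condition on \<open>U\<close> makes the lengths of both
  progressions modulo \<open>d\<close> dominate \<open>y ^ 3\<close> in the bilinear estimate.  The product of the two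
  lengths is then of order \<open>z / d ^ 2\<close>, and the mean squares of the coefficients supply another
  factor \<open>z\<close> under the square root.
\<close>

lemma type_two_dyadic_bound:
  fixes d y U z r s :: nat
  assumes "finite P" and P: "\<And>p. p \<in> P \<Longrightarrow> prime p \<and> p \<le> y \<and> \<not> p dvd d" and d: "d > 0"
    and z: "z + 1 < 2 ^ r" and U: "4 * d * y ^ 3 \<le> U" "U \<ge> 1" and r: "r \<ge> 1"
  shows "(\<Sum>p\<in>P. \<bar>\<Sum>m=2 ^ s..<2 ^ Suc s. \<Sum>l=1..z div m.
            mangoldt_above U m * moebius_remainder U l * deviation_kernel d p (m * l)\<bar>) \<le>
         10 * real r ^ 4 * (real z / real d)"
proof (cases "2 ^ Suc s \<le> U \<or> z div 2 ^ s \<le> U \<or> z < 2 ^ s")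
  case True
  have summand_eq_0: "mangoldt_above U m * moebius_remainder U l = 0"
    if "m \<in> {2 ^ s..<2 ^ Suc s}" "l \<in> {1..z div m}" for m l
  proof -
    have "z div m \<le> z div 2 ^ s" using that by (intro div_le_mono2) auto
    with that have l: "1 \<le> l" "l \<le> z div 2 ^ s" by auto
    from True consider "2 ^ Suc s \<le> U" | "z div 2 ^ s \<le> U" | "z < 2 ^ s" by blast
    thus ?thesis
    proof cases
      case 1
      thus ?thesis using that by (simp add: mangoldt_above_def)
    next
      case 2
      thus ?thesis using l by (simp add: moebius_remainder_eq_0)
    next
      case 3
      thus ?thesis using l by simp
    qed
  qed
  have "(\<Sum>m=2 ^ s..<2 ^ Suc s. \<Sum>l=1..z div m.
            mangoldt_above U m * moebius_remainder U l * deviation_kernel d p (m * l)) = 0" for p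
    by (intro sum.neutral ballI) (simp only: summand_eq_0 mult_zero_left)
  thus ?thesis by simp
next
  case False
  hence big: "U < 2 ^ Suc s" "U < z div 2 ^ s" "2 ^ s \<le> z" by auto
  define X where "X = (2 :: nat) ^ Suc s"
  define Y where "Y = z div 2 ^ s + 1"
  define \<alpha> where "\<alpha> = (\<lambda>m. if m < 2 ^ s then 0 else mangoldt_above U m)"
  define \<beta> where "\<beta> = (\<lambda>l. if l = 0 then 0 else moebius_remainder U l)"
  define H where "H = (\<lambda>m. if m < 2 ^ s then 0 else z div m + 1)"
  define t where "t = (2 :: real) ^ s"
  have t0: "t > 0" by (simp add: t_def)
  have Hle: "H m \<le> Y" if "m < X" for m
    unfolding H_def Y_def by (auto intro: div_le_mono2)
  have Yr: "Y < 2 ^ r" using z div_le_dividend[of z "2 ^ s"] unfolding Y_def by linarith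
  have rewrite: "(\<Sum>m=2 ^ s..<2 ^ Suc s. \<Sum>l=1..z div m.
            mangoldt_above U m * moebius_remainder U l * deviation_kernel d p (m * l)) =
       (\<Sum>m<X. \<Sum>n<H m. \<alpha> m * \<beta> n * deviation_kernel d p (m * n))" for p
  proof -
    have "(\<Sum>m<X. \<Sum>n<H m. \<alpha> m * \<beta> n * deviation_kernel d p (m * n)) =
          (\<Sum>m=2 ^ s..<2 ^ Suc s. \<Sum>n<H m. \<alpha> m * \<beta> n * deviation_kernel d p (m * n))"
      by (rule sum.mono_neutral_right) (auto simp: X_def \<alpha>_def)
    also have "\<dots> = (\<Sum>m=2 ^ s..<2 ^ Suc s. \<Sum>l=1..z div m.
            mangoldt_above U m * moebius_remainder U l * deviation_kernel d p (m * l))"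
    proof (rule sum.cong[OF refl])
      fix m :: nat assume "m \<in> {2 ^ s..<2 ^ Suc s}"
      thus "(\<Sum>n<H m. \<alpha> m * \<beta> n * deviation_kernel d p (m * n)) =
            (\<Sum>l=1..z div m. mangoldt_above U m * moebius_remainder U l * deviation_kernel d p (m * l))"
        by (intro sum.mono_neutral_cong_right) (auto simp: H_def \<alpha>_def \<beta>_def)
    qed
    finally show ?thesis ..
  qed
  have y3: "4 * real d * real y ^ 3 \<le> real U"
    using U(1) by (metis of_nat_le_iff of_nat_mult of_nat_numeral of_nat_power)
  have real_zs: "real (z div 2 ^ s) \<le> real z / t"
    using of_nat_div_le_of_nat[of z "2 ^ s", where ?'a = real] by (simp add: t_def)
  have A: "(real X / real d + 2 * real y ^ 3) * (\<Sum>m<X. \<alpha> m ^ 2) \<le> (4 * t / real d) * (2 * t * real r ^ 2)"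
  proof (intro mult_mono)
    have "real U \<le> real X" using big(1) unfolding X_def by (intro of_nat_mono less_imp_le)
    hence "4 * real d * real y ^ 3 \<le> 2 * t" using y3 by (simp add: X_def t_def)
    hence "2 * real y ^ 3 \<le> t / real d" using d by (simp add: field_simps)
    moreover have "real X / real d = 2 * (t / real d)" "4 * t / real d = 4 * (t / real d)"
      by (simp_all add: X_def t_def)
    moreover have "t / real d \<ge> 0" using t0 by simp
    ultimately show "real X / real d + 2 * real y ^ 3 \<le> 4 * t / real d" by linarith
    have "(\<Sum>m<X. \<alpha> m ^ 2) \<le> (\<Sum>m<X. real r ^ 2)"
    proof (intro sum_mono power_mono)
      fix m assume m: "m \<in> {..<X}"
      show "\<alpha> m \<ge> 0" by (simp add: \<alpha>_def mangoldt_above_nonneg)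
      have "(2::nat) ^ s < 2 ^ r" using big(3) z by linarith
      hence "Suc s \<le> r" by simp
      hence "(2::nat) ^ Suc s \<le> 2 ^ r" by (intro power_increasing) auto
      thus "\<alpha> m \<le> real r"
        using m unfolding \<alpha>_def X_def by (auto intro: mangoldt_above_le)
    qed
    thus "(\<Sum>m<X. \<alpha> m ^ 2) \<le> 2 * t * real r ^ 2" by (simp add: X_def t_def)
  qed (use t0 in \<open>auto intro!: sum_nonneg\<close>)
  have B: "(real Y / real d + 2 * real y ^ 3) * (\<Sum>n<Y. \<beta> n ^ 2) \<le> (3 * (real z / t) / real d) * (real z / t * real r ^ 3)"
  proof (intro mult_mono)
    have u: "real U \<le> real z / t" using big(2) real_zs by linarith
    hence "4 * real d * real y ^ 3 \<le> real z / t" using y3 by linarith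
    moreover have "4 * real d * real y ^ 3 = 2 * (2 * real y ^ 3 * real d)" "0 \<le> 2 * real y ^ 3 * real d"
      by simp_all
    ultimately have "2 * real y ^ 3 * real d \<le> real z / t" by linarith
    hence "2 * real y ^ 3 \<le> (real z / t) / real d" using d by (subst pos_le_divide_eq) auto
    moreover have "real Y \<le> 2 * (real z / t)"
      using real_zs u U(2) by (simp add: Y_def)
    hence "real Y / real d \<le> 2 * (real z / t) / real d" using d by (intro divide_right_mono) auto
    ultimately have "real Y / real d + 2 * real y ^ 3 \<le> 2 * (real z / t) / real d + (real z / t) / real d"
      by linarith
    also have "\<dots> = 3 * (real z / t) / real d" using d t0 by (simp add: field_simps)
    finally show "real Y / real d + 2 * real y ^ 3 \<le> 3 * (real z / t) / real d" .
    have "(\<Sum>n<Y. \<beta> n ^ 2) = (\<Sum>n=1..z div 2 ^ s. moebius_remainder U n ^ 2)"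
      by (rule sum.mono_neutral_cong_right) (auto simp: Y_def \<beta>_def)
    also have "\<dots> \<le> (\<Sum>n=1..z div 2 ^ s. real (divisor_count n) ^ 2)"
    proof (rule sum_mono)
      fix n assume "n \<in> {1..z div 2 ^ s}"
      hence "\<bar>moebius_remainder U n\<bar> \<le> real (divisor_count n)"
        using U by (intro abs_moebius_remainder_le) auto
      thus "moebius_remainder U n ^ 2 \<le> real (divisor_count n) ^ 2"
        by (simp add: power2_le_iff_abs_le)
    qed
    also have "\<dots> \<le> real (z div 2 ^ s) * real r ^ 3"
      using Yr by (intro sum_divisor_count_square_le) (simp add: Y_def)
    also have "\<dots> \<le> real z / t * real r ^ 3" by (intro mult_right_mono real_zs) auto
    finally show "(\<Sum>n<Y. \<beta> n ^ 2) \<le> real z / t * real r ^ 3" .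
  qed (use t0 in \<open>auto intro!: sum_nonneg\<close>)
  have "(\<Sum>p\<in>P. \<bar>\<Sum>m=2 ^ s..<2 ^ Suc s. \<Sum>l=1..z div m.
            mangoldt_above U m * moebius_remainder U l * deviation_kernel d p (m * l)\<bar>) \<le>
     2 * real r * (sqrt ((real X / real d + 2 * real y ^ 3) * (\<Sum>m<X. \<alpha> m ^ 2)) *
         sqrt ((real Y / real d + 2 * real y ^ 3) * (\<Sum>n<Y. \<beta> n ^ 2)))"
    unfolding rewrite by (rule bilinear_hyperbola[OF assms(1-3) Hle Yr])
  also have "\<dots> \<le> 2 * real r * (sqrt ((4 * t / real d) * (2 * t * real r ^ 2)) *
      sqrt ((3 * (real z / t) / real d) * (real z / t * real r ^ 3)))"
    using t0 by (intro mult_left_mono mult_mono real_sqrt_le_mono A B) (auto intro!: sum_nonneg mult_nonneg_nonneg)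
  also have "\<dots> \<le> 2 * real r * (5 * real r ^ 3 * (real z / real d))"
  proof (rule mult_left_mono)
    have "sqrt ((4 * t / real d) * (2 * t * real r ^ 2)) * sqrt ((3 * (real z / t) / real d) * (real z / t * real r ^ 3)) =
          sqrt (24 * (real r ^ 2 * real r ^ 3) * (real z / real d) ^ 2)"
      unfolding real_sqrt_mult [symmetric] using t0 d
      by (simp add: field_simps power2_eq_square)
    also have "real r ^ 2 * real r ^ 3 = real r ^ 5" by (simp flip: power_add)
    also have "sqrt (24 * real r ^ 5 * (real z / real d) ^ 2) \<le> sqrt ((5 * real r ^ 3 * (real z / real d)) ^ 2)"
    proof (rule real_sqrt_le_mono)
      have square: "(5 * real r ^ 3 * w) ^ 2 = 25 * real r ^ 6 * w ^ 2" for w :: real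
        by (simp add: power_mult_distrib flip: power_mult)
      have "real r ^ 5 \<le> real r ^ 6" using r by (intro power_increasing) auto
      hence "24 * real r ^ 5 \<le> 25 * real r ^ 6" using zero_le_power[of "real r" 6] by linarith
      hence "24 * real r ^ 5 * (real z / real d) ^ 2 \<le> 25 * real r ^ 6 * (real z / real d) ^ 2"
        by (intro mult_right_mono) auto
      thus "24 * real r ^ 5 * (real z / real d) ^ 2 \<le> (5 * real r ^ 3 * (real z / real d)) ^ 2"
        unfolding square .
    qed
    also have "\<dots> = 5 * real r ^ 3 * (real z / real d)" by simp
    finally show "sqrt ((4 * t / real d) * (2 * t * real r ^ 2)) *
      sqrt ((3 * (real z / t) / real d) * (real z / t * real r ^ 3)) \<le> 5 * real r ^ 3 * (real z / real d)" .
  qed simp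
  also have "\<dots> = 10 * real r ^ 4 * (real z / real d)"
    using power_Suc2[of "real r" 3] by simp
  finally show ?thesis .
qed

lemma sum_dyadic_blocks:
  fixes f :: "nat \<Rightarrow> real"
  shows "(\<Sum>s<r. \<Sum>m=2 ^ s..<2 ^ Suc s. f m) = (\<Sum>m=1..<2 ^ r. f m)"
proof (induction r)
  case (Suc r)
  have "(\<Sum>m=1..<2 ^ r. f m) + (\<Sum>m=2 ^ r..<2 ^ Suc r. f m) = (\<Sum>m=1..<2 ^ Suc r. f m)"
    by (rule sum.atLeastLessThan_concat) auto
  thus ?case using Suc by simp
qed simp

text \<open>
  For a single modulus \<open>d\<close>, the primes in the class of \<open>1\<close> modulo \<open>d\<close> are equidistributed modulo
  most primes \<open>p \<le> y\<close>.  Each \<open>p\<close> on its own contributes at most about \<open>z / d\<close>, up to logarithms,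
  so the estimate has content once the number of primes \<open>p\<close> exceeds a fixed power of \<open>r\<close>.  Only classes
  modulo \<open>d\<close> are refined to classes modulo \<open>d * p\<close>; nothing is claimed about the number of primes
  in the class modulo \<open>d\<close> itself, which is why no zeros of L-functions interfere.
\<close>

theorem equidistribution_mod_primes:
  fixes d y U z r :: nat
  assumes "finite P" and P: "\<And>p. p \<in> P \<Longrightarrow> prime p \<and> p \<le> y \<and> \<not> p dvd d" and d: "d > 0"
    and z: "z + 1 < 2 ^ r" and U: "4 * d * y ^ 3 \<le> U" "U \<ge> 1" "U \<le> z" and r: "r \<ge> 1"
  shows "(\<Sum>p\<in>P. \<bar>\<Sum>n=1..z. mangoldt_above U n * deviation_kernel d p n\<bar>) \<le>
         10 * real r ^ 5 * (real z / real d) + 8 * real r * real U ^ 2 * real y ^ 2"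
proof -
  define A where "A = (\<lambda>p. \<Sum>b=1..U. moebius b * (\<Sum>l=1..z div b. ln (real l) * deviation_kernel d p (b * l)))"
  define B where "B = (\<lambda>p. \<Sum>a=1..U. \<Sum>b=1..U. mangoldt a * moebius b * (\<Sum>c=1..z div (a * b). deviation_kernel d p (a * b * c)))"
  define Q where "Q = (\<lambda>p m. \<Sum>l=1..z div m. mangoldt_above U m * moebius_remainder U l * deviation_kernel d p (m * l))"
  have Q_sum: "(\<Sum>m=1..z. Q p m) = (\<Sum>s<r. \<Sum>m=2 ^ s..<2 ^ Suc s. Q p m)" for p
  proof -
    have "(\<Sum>m=1..<2 ^ r. Q p m) = (\<Sum>m=1..z. Q p m)"
      by (rule sum.mono_neutral_right) (use z in \<open>auto simp: Q_def not_le\<close>)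
    thus ?thesis by (simp only: sum_dyadic_blocks)
  qed
  have two: "(\<Sum>p\<in>P. \<bar>\<Sum>m=1..z. Q p m\<bar>) \<le> 10 * real r ^ 5 * (real z / real d)"
  proof -
    have "(\<Sum>p\<in>P. \<bar>\<Sum>m=1..z. Q p m\<bar>) \<le> (\<Sum>p\<in>P. \<Sum>s<r. \<bar>\<Sum>m=2 ^ s..<2 ^ Suc s. Q p m\<bar>)"
      unfolding Q_sum by (intro sum_mono sum_abs)
    also have "\<dots> = (\<Sum>s<r. \<Sum>p\<in>P. \<bar>\<Sum>m=2 ^ s..<2 ^ Suc s. Q p m\<bar>)" by (rule sum.swap)
    also have "\<dots> \<le> (\<Sum>s<r. 10 * real r ^ 4 * (real z / real d))"
      unfolding Q_def by (intro sum_mono type_two_dyadic_bound[OF assms(1-3) z U(1,2) r])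
    also have "\<dots> = 10 * real r ^ 5 * (real z / real d)"
      using power_Suc2[of "real r" 4] by simp
    finally show ?thesis .
  qed
  have one: "(\<Sum>p\<in>P. \<bar>A p\<bar> + \<bar>B p\<bar>) \<le> 8 * real r * real U ^ 2 * real y ^ 2"
  proof -
    have "(\<Sum>p\<in>P. \<bar>A p\<bar> + \<bar>B p\<bar>) \<le> (\<Sum>p\<in>P. 8 * real r * real U ^ 2 * real y)"
    proof (rule sum_mono)
      fix p assume p: "p \<in> P"
      have "\<bar>A p\<bar> + \<bar>B p\<bar> \<le> 4 * real p * real r * real U + 4 * real p * real r * real U ^ 2"
        unfolding A_def B_def using P[OF p] d z U by (intro add_mono type_one_bound) auto
      also have "real U \<le> real U ^ 2" using U by (intro self_le_power) auto
      hence "4 * real p * real r * real U + 4 * real p * real r * real U ^ 2 \<le>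
             4 * real p * real r * real U ^ 2 + 4 * real p * real r * real U ^ 2"
        by (intro add_right_mono mult_left_mono) auto
      also have "\<dots> = 8 * real r * real U ^ 2 * real p" by simp
      also have "\<dots> \<le> 8 * real r * real U ^ 2 * real y" using P[OF p] by (intro mult_left_mono) auto
      finally show "\<bar>A p\<bar> + \<bar>B p\<bar> \<le> 8 * real r * real U ^ 2 * real y" by simp
    qed
    also have "\<dots> = real (card P) * (8 * real r * real U ^ 2 * real y)" by simp
    also have "\<dots> \<le> real y * (8 * real r * real U ^ 2 * real y)"
    proof (rule mult_right_mono)
      have "p \<in> {1..y}" if "p \<in> P" for p
        using P[OF that] prime_ge_1_nat[of p] by simp
      hence "card P \<le> card {1..y}" by (intro card_mono subsetI) auto
      thus "real (card P) \<le> real y" by simp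
    qed auto
    finally show ?thesis by (simp add: power2_eq_square mult_ac)
  qed
  have "(\<Sum>p\<in>P. \<bar>\<Sum>n=1..z. mangoldt_above U n * deviation_kernel d p n\<bar>) \<le>
        (\<Sum>p\<in>P. (\<bar>A p\<bar> + \<bar>B p\<bar>) + \<bar>\<Sum>m=1..z. Q p m\<bar>)"
  proof (rule sum_mono)
    fix p
    have "(\<Sum>n=1..z. mangoldt_above U n * deviation_kernel d p n) = A p - B p - (\<Sum>m=1..z. Q p m)"
      unfolding A_def B_def Q_def by (rule vaughan_identity)
    thus "\<bar>\<Sum>n=1..z. mangoldt_above U n * deviation_kernel d p n\<bar> \<le> (\<bar>A p\<bar> + \<bar>B p\<bar>) + \<bar>\<Sum>m=1..z. Q p m\<bar>"
      by linarith
  qed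
  also have "\<dots> = (\<Sum>p\<in>P. \<bar>A p\<bar> + \<bar>B p\<bar>) + (\<Sum>p\<in>P. \<bar>\<Sum>m=1..z. Q p m\<bar>)"
    by (rule sum.distrib)
  finally show ?thesis using one two by linarith
qed

section \<open>A modulus with many divisors d such that 1 + dj is prime\<close>

definition psi_class :: "nat \<Rightarrow> nat \<Rightarrow> nat \<Rightarrow> real" where
  "psi_class U z d = (\<Sum>n | n \<in> {1..z} \<and> [n = 1] (mod d). mangoldt_above U n)"

text \<open>
  The factor \<open>d\<close> makes every divisor of \<open>K\<close> contribute about equally when primes are well
  distributed.
\<close>

definition weighted_psi :: "nat \<Rightarrow> nat \<Rightarrow> nat \<Rightarrow> real" where
  "weighted_psi U z K = (\<Sum>d | d dvd K. real d * psi_class U z d)"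

text \<open>
  The multiples of \<open>p\<close> that the kernel leaves out carry von Mangoldt weight at most \<open>r ^ 2\<close>, and
  the factor \<open>p / (p - 1) \<ge> 1\<close> helps.
\<close>

lemma psi_class_mult_prime_ge:
  assumes p: "prime p" "\<not> p dvd d" and z: "z < 2 ^ r"
  shows "real p * psi_class U z (d * p) \<ge>
     psi_class U z d - real r ^ 2 - \<bar>\<Sum>n=1..z. mangoldt_above U n * deviation_kernel d p n\<bar>"
proof -
  have p2: "p \<ge> 2" using p prime_ge_2_nat by blast
  have cop: "coprime d p" using p by (metis prime_imp_coprime coprime_commute)
  define A where "A = {n. n \<in> {1..z} \<and> [n = 1] (mod d)}"
  have finA: "finite A" by (simp add: A_def)
  define S where "S = (\<Sum>n | n \<in> A \<and> \<not> p dvd n. mangoldt_above U n)"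
  have crt: "[n = 1] (mod (d * p)) \<longleftrightarrow> [n = 1] (mod d) \<and> [n = 1] (mod p)" for n :: nat
    using cop coprime_cong_mult_nat[of n 1 d p] cong_modulus_mult_nat[of n 1 d p]
      cong_modulus_mult_nat[of n 1 p d] by (auto simp: mult.commute)
  have "(\<Sum>n=1..z. mangoldt_above U n * deviation_kernel d p n) = (\<Sum>n\<in>A. mangoldt_above U n * prime_kernel p n)"
    by (rule sum.mono_neutral_cong_right) (auto simp: A_def deviation_kernel_def)
  also have "\<dots> = (\<Sum>n\<in>A. if [n = 1] (mod p) then real p * mangoldt_above U n else 0) -
                  (\<Sum>n\<in>A. if p dvd n then 0 else real p / (real p - 1) * mangoldt_above U n)"
    unfolding sum_subtractf [symmetric] by (rule sum.cong[OF refl]) (simp add: prime_kernel_def algebra_simps)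
  also have "(\<Sum>n\<in>A. if [n = 1] (mod p) then real p * mangoldt_above U n else 0) =
             (\<Sum>n | n \<in> {1..z} \<and> [n = 1] (mod (d * p)). real p * mangoldt_above U n)"
    by (rule sum.mono_neutral_cong_right) (auto simp: A_def crt[unfolded One_nat_def])
  also have "\<dots> = real p * psi_class U z (d * p)" by (simp add: psi_class_def sum_distrib_left)
  also have "(\<Sum>n\<in>A. if p dvd n then 0 else real p / (real p - 1) * mangoldt_above U n) =
             (\<Sum>n | n \<in> A \<and> \<not> p dvd n. real p / (real p - 1) * mangoldt_above U n)"
    by (rule sum.mono_neutral_cong_right) (use finA in auto)
  also have "\<dots> = real p / (real p - 1) * S" by (simp add: S_def sum_distrib_left)
  finally have eq: "real p * psi_class U z (d * p) =
      (\<Sum>n=1..z. mangoldt_above U n * deviation_kernel d p n) + real p / (real p - 1) * S" by simp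
  have S0: "S \<ge> 0" unfolding S_def by (intro sum_nonneg mangoldt_above_nonneg)
  have "1 * S \<le> real p / (real p - 1) * S"
    using p2 by (intro mult_right_mono S0) (simp add: field_simps)
  moreover have "psi_class U z d \<le> S + real r ^ 2"
  proof -
    have "psi_class U z d = (\<Sum>n\<in>{n. n \<in> A \<and> \<not> p dvd n} \<union> {n. n \<in> A \<and> p dvd n}. mangoldt_above U n)"
      unfolding psi_class_def A_def by (rule sum.cong) auto
    also have "\<dots> = S + (\<Sum>n | n \<in> A \<and> p dvd n. mangoldt_above U n)"
      unfolding S_def by (rule sum.union_disjoint) (use finA in auto)
    also have "(\<Sum>n | n \<in> A \<and> p dvd n. mangoldt_above U n) \<le> (\<Sum>n | n \<in> A \<and> p dvd n. mangoldt n)"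
      by (intro sum_mono) (simp add: mangoldt_above_def mangoldt_nonneg)
    also have "\<dots> \<le> (\<Sum>n | n \<in> {1..z} \<and> p dvd n. mangoldt n)"
      by (rule sum_mono2) (auto simp: A_def mangoldt_nonneg)
    also have "\<dots> \<le> real r ^ 2" by (rule sum_mangoldt_multiples_le[OF p(1) z])
    finally show ?thesis by simp
  qed
  ultimately show ?thesis unfolding eq by linarith
qed

lemma divisors_mult_prime:
  fixes K p :: nat
  assumes "prime p" "\<not> p dvd K" "K > 0"
  shows "{d. d dvd K * p} = {d. d dvd K} \<union> (\<lambda>d. d * p) ` {d. d dvd K}"
    and "{d. d dvd K} \<inter> (\<lambda>d. d * p) ` {d. d dvd K} = {}"
    and "inj_on (\<lambda>d. d * p) {d. d dvd K}"
proof -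
  show "inj_on (\<lambda>d. d * p) {d. d dvd K}"
    using prime_gt_0_nat[OF assms(1)] by (simp add: inj_on_def)
  show "{d. d dvd K} \<inter> (\<lambda>d. d * p) ` {d. d dvd K} = {}"
    using assms(2) by (auto dest: dvd_mult_right)
  show "{d. d dvd K * p} = {d. d dvd K} \<union> (\<lambda>d. d * p) ` {d. d dvd K}"
  proof (intro equalityI subsetI)
    fix d assume d: "d \<in> {d. d dvd K * p}"
    show "d \<in> {d. d dvd K} \<union> (\<lambda>d. d * p) ` {d. d dvd K}"
    proof (cases "p dvd d")
      case True
      then obtain e where "d = e * p" by (metis dvdE mult.commute)
      thus ?thesis using d prime_gt_0_nat[OF assms(1)] by auto
    next
      case False
      hence "coprime d p" using assms(1) by (metis prime_imp_coprime coprime_commute)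
      thus ?thesis using d by (simp add: coprime_dvd_mult_left_iff)
    qed
  qed auto
qed

text \<open>
  The integer \<open>K\<close> is built one prime at a time.  Each divisor \<open>d\<close> of \<open>K\<close> gives rise to the two
  divisors \<open>d\<close> and \<open>d * p\<close> of \<open>K * p\<close>, which contribute about the same as soon as primes in the
  class modulo \<open>d\<close> are equidistributed modulo \<open>p\<close>.  Weighted over the divisors of \<open>K\<close>, the total
  discrepancy over all admissible \<open>p\<close> is bounded, so some \<open>p\<close> has at most the average
  discrepancy; \<open>e\<close> bounds this average for one divisor.  Hence the weighted sum doubles at each
  step, up to an error that grows linearly in the number of steps.
\<close>

theorem weighted_psi_doubling:
  fixes y U z r k :: nat and e :: real
  assumes z: "z + 1 < 2 ^ r" and U: "4 * y ^ (k + 3) \<le> U" "U \<ge> 1" "U \<le> z" and r: "r \<ge> 1" and y: "y \<ge> 1"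
    and k: "k < card {p. prime p \<and> p \<le> y}"
    and e: "(10 * real r ^ 5 * real z + 8 * real r * real U ^ 2 * real y ^ 2 * real y ^ k) /
             (real (card {p. prime p \<and> p \<le> y}) - real k) + real y ^ k * real r ^ 2 \<le> e"
    and j: "j \<le> k"
  shows "\<exists>K>0. K \<le> y ^ j \<and> card (prime_factors K) \<le> j \<and> divisor_count K = 2 ^ j \<and>
           weighted_psi U z K \<ge> 2 ^ j * (psi_class U z 1 - real j * e)"
  using j
proof (induction j)
  case 0
  show ?case by (rule exI[of _ 1]) (simp add: weighted_psi_def)
next
  case (Suc j)
  then obtain K where K: "K > 0" "K \<le> y ^ j" "card (prime_factors K) \<le> j" "divisor_count K = 2 ^ j"
    and G: "weighted_psi U z K \<ge> 2 ^ j * (psi_class U z 1 - real j * e)" by auto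
  \<comment> \<open>The candidates for the next prime factor, and the discrepancy \<open>D d p\<close> of each.\<close>
  define P where "P = {p. prime p \<and> p \<le> y} - prime_factors K"
  define D where "D = (\<lambda>d p. \<bar>\<Sum>n=1..z. mangoldt_above U n * deviation_kernel d p n\<bar>)"
  define E where "E = 10 * real r ^ 5 * real z + 8 * real r * real U ^ 2 * real y ^ 2 * real y ^ k"
  have finP: "finite P" by (simp add: P_def)
  have P: "prime p \<and> p \<le> y \<and> \<not> p dvd K" if "p \<in> P" for p
    using that K(1) by (simp add: P_def in_prime_factors_iff) blast
  have "card {p. prime p \<and> p \<le> y} - card (prime_factors K) \<le> card P"
    unfolding P_def by (rule diff_card_le_card_Diff) simp
  hence cardP: "real (card {p. prime p \<and> p \<le> y}) - real k \<le> real (card P)"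
    using K(3) Suc.prems by linarith
  have cardP0: "real (card {p. prime p \<and> p \<le> y}) - real k > 0" using k by simp
  have E0: "E \<ge> 0" by (simp add: E_def)
  have yj: "y ^ j \<le> y ^ k" using y Suc.prems by (intro power_increasing) auto
  have finK: "finite {d. d dvd K}" using K(1) by simp
  have dK: "d > 0 \<and> d \<le> y ^ k" if "d dvd K" for d
  proof -
    have "d \<le> K" using that K(1) by (rule dvd_imp_le)
    moreover have "d > 0" using that K(1) by (rule dvd_pos_nat[rotated])
    ultimately show ?thesis using K(2) yj by linarith
  qed
  have total: "(\<Sum>p\<in>P. \<Sum>d | d dvd K. real d * D d p) \<le> 2 ^ j * E"
  proof -
    have "(\<Sum>p\<in>P. \<Sum>d | d dvd K. real d * D d p) = (\<Sum>d | d dvd K. real d * (\<Sum>p\<in>P. D d p))"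
      by (subst sum.swap) (simp only: sum_distrib_left)
    also have "\<dots> \<le> (\<Sum>d | d dvd K. E)"
    proof (rule sum_mono)
      fix d assume "d \<in> {d. d dvd K}"
      hence d: "d dvd K" "d > 0" "d \<le> y ^ k" using dK[of d] by auto
      have "(\<Sum>p\<in>P. D d p) \<le> 10 * real r ^ 5 * (real z / real d) + 8 * real r * real U ^ 2 * real y ^ 2"
        unfolding D_def
      proof (rule equidistribution_mod_primes[OF finP _ d(2) z _ U(2,3) r])
        show "prime p \<and> p \<le> y \<and> \<not> p dvd d" if "p \<in> P" for p
          using P[OF that] d(1) dvd_trans by blast
        have "4 * d * y ^ 3 \<le> 4 * y ^ k * y ^ 3"
          by (intro mult_right_mono mult_left_mono d(3)) auto
        also have "\<dots> = 4 * y ^ (k + 3)" by (simp add: power_add)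
        finally show "4 * d * y ^ 3 \<le> U" using U(1) by linarith
      qed
      hence "real d * (\<Sum>p\<in>P. D d p) \<le> real d * (10 * real r ^ 5 * (real z / real d) + 8 * real r * real U ^ 2 * real y ^ 2)"
        by (intro mult_left_mono) auto
      also have "\<dots> = 10 * real r ^ 5 * real z + 8 * real r * real U ^ 2 * real y ^ 2 * real d"
        using d(2) by (simp add: field_simps)
      also have "\<dots> \<le> E"
      proof -
        have "real d \<le> real y ^ k" using d(3) by (metis of_nat_le_iff of_nat_power)
        thus ?thesis unfolding E_def by (intro add_left_mono mult_left_mono) auto
      qed
      finally show "real d * (\<Sum>p\<in>P. D d p) \<le> E" .
    qed
    also have "\<dots> = 2 ^ j * E" by (simp add: K(4))
    finally show ?thesis .
  qed
  obtain p where p: "p \<in> P" "(\<Sum>d | d dvd K. real d * D d p) \<le> 2 ^ j * E / real (card P)"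
  proof -
    have "P \<noteq> {}" using cardP cardP0 by auto
    hence cp: "real (card P) > 0" using finP by (simp add: card_gt_0_iff)
    have "\<exists>p\<in>P. (\<Sum>d | d dvd K. real d * D d p) \<le> 2 ^ j * E / real (card P)"
    proof (rule ccontr)
      assume "\<not> (\<exists>p\<in>P. (\<Sum>d | d dvd K. real d * D d p) \<le> 2 ^ j * E / real (card P))"
      hence "2 ^ j * E / real (card P) < (\<Sum>d | d dvd K. real d * D d p)" if "p \<in> P" for p
        using that not_le by blast
      hence "(\<Sum>p\<in>P. 2 ^ j * E / real (card P)) < (\<Sum>p\<in>P. \<Sum>d | d dvd K. real d * D d p)"
        by (intro sum_strict_mono finP \<open>P \<noteq> {}\<close>)
      moreover have "(\<Sum>p\<in>P. 2 ^ j * E / real (card P)) = 2 ^ j * E" using cp by simp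
      ultimately show False using total by linarith
    qed
    thus ?thesis using that by blast
  qed
  have pp: "prime p" "p \<le> y" "\<not> p dvd K" using P[OF p(1)] by auto
  note div = divisors_mult_prime[OF pp(1,3) K(1)]
  have "2 ^ j * E / real (card P) \<le> 2 ^ j * (E / (real (card {p. prime p \<and> p \<le> y}) - real k))"
  proof -
    have "E / real (card P) \<le> E / (real (card {p. prime p \<and> p \<le> y}) - real k)"
      by (rule divide_left_mono[OF cardP E0]) (use cardP cardP0 in \<open>intro mult_pos_pos; linarith\<close>)
    thus ?thesis unfolding times_divide_eq_right[symmetric] by (intro mult_left_mono) auto
  qed
  moreover have "(\<Sum>d | d dvd K. real d * real r ^ 2) \<le> 2 ^ j * (real y ^ k * real r ^ 2)"
  proof -
    have "(\<Sum>d | d dvd K. real d * real r ^ 2) \<le> (\<Sum>d | d dvd K. real y ^ k * real r ^ 2)"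
    proof (intro sum_mono mult_right_mono)
      fix d assume "d \<in> {d. d dvd K}"
      hence "d \<le> y ^ k" using dK[of d] by auto
      thus "real d \<le> real y ^ k" by (metis of_nat_le_iff of_nat_power)
    qed auto
    thus ?thesis by (simp add: K(4))
  qed
  ultimately have err: "(\<Sum>d | d dvd K. real d * D d p) + (\<Sum>d | d dvd K. real d * real r ^ 2) \<le> 2 ^ j * e"
  proof -
    have "2 ^ j * (E / (real (card {p. prime p \<and> p \<le> y}) - real k) + real y ^ k * real r ^ 2) \<le> 2 ^ j * e"
      using e unfolding E_def by (intro mult_left_mono) auto
    thus ?thesis
      using p(2) \<open>2 ^ j * E / real (card P) \<le> _\<close> \<open>(\<Sum>d | d dvd K. real d * real r ^ 2) \<le> _\<close>
      unfolding distrib_left by linarith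
  qed
  define f where "f = (\<lambda>d. real d * psi_class U z d)"
  have "weighted_psi U z (K * p) = (\<Sum>d\<in>{d. d dvd K}. f d) + (\<Sum>d\<in>(\<lambda>d. d * p) ` {d. d dvd K}. f d)"
    unfolding weighted_psi_def f_def[symmetric] div(1)
    by (rule sum.union_disjoint[OF finK finite_imageI[OF finK] div(2)])
  also have "(\<Sum>d\<in>(\<lambda>d. d * p) ` {d. d dvd K}. f d) = (\<Sum>d | d dvd K. f (d * p))"
    by (simp only: sum.reindex[OF div(3)] o_def)
  finally have split: "weighted_psi U z (K * p) = (\<Sum>d | d dvd K. f d) + (\<Sum>d | d dvd K. f (d * p))" .
  have "(\<Sum>d | d dvd K. f d - real d * D d p - real d * real r ^ 2) \<le> (\<Sum>d | d dvd K. f (d * p))"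
  proof (rule sum_mono)
    fix d assume "d \<in> {d. d dvd K}"
    hence "\<not> p dvd d" using pp(3) dvd_trans by blast
    hence "real p * psi_class U z (d * p) \<ge> psi_class U z d - real r ^ 2 - D d p"
      unfolding D_def using z by (intro psi_class_mult_prime_ge pp(1)) auto
    hence "real d * (real p * psi_class U z (d * p)) \<ge> real d * (psi_class U z d - real r ^ 2 - D d p)"
      by (intro mult_left_mono) auto
    thus "f d - real d * D d p - real d * real r ^ 2 \<le> f (d * p)"
      by (simp add: f_def algebra_simps)
  qed
  hence "weighted_psi U z (K * p) \<ge> 2 * (\<Sum>d | d dvd K. f d) - 2 ^ j * e"
    unfolding sum_subtractf split using err by linarith
  moreover have "(\<Sum>d | d dvd K. f d) \<ge> 2 ^ j * (psi_class U z 1 - real j * e)"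
    using G by (simp only: weighted_psi_def f_def)
  moreover have "2 * (2 ^ j * (psi_class U z 1 - real j * e)) - 2 ^ j * e \<ge>
             2 ^ Suc j * (psi_class U z 1 - real (Suc j) * e)"
  proof -
    have "0 \<le> E / (real (card {p. prime p \<and> p \<le> y}) - real k) + real y ^ k * real r ^ 2"
      using cardP0 E0 by simp
    hence "e \<ge> 0" using e unfolding E_def by linarith
    hence "(2::real) ^ j * e \<ge> 0" by simp
    thus ?thesis by (simp add: algebra_simps)
  qed
  ultimately have G': "weighted_psi U z (K * p) \<ge> 2 ^ Suc j * (psi_class U z 1 - real (Suc j) * e)"
    by linarith
  have "divisor_count (K * p) = 2 ^ Suc j"
    unfolding div(1) card_Un_disjoint[OF finK finite_imageI[OF finK] div(2)] card_image[OF div(3)]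
    by (simp add: K(4))
  moreover have "K * p \<le> y ^ Suc j"
    unfolding power_Suc2 by (rule mult_le_mono[OF K(2) pp(2)])
  moreover have "card (prime_factors (K * p)) \<le> Suc j"
  proof -
    have "prime_factors (K * p) = insert p (prime_factors K)"
      using K(1) pp prime_gt_0_nat[of p] by (subst prime_factors_product) (auto simp: prime_prime_factors)
    thus ?thesis using K(3) by (simp add: card_insert_if)
  qed
  moreover have "K * p > 0" using K(1) prime_gt_0_nat[OF pp(1)] by simp
  ultimately show ?case using G' by blast
qed

text \<open>
  Each \<open>n > 1\<close> counted in the class modulo \<open>d\<close> is \<open>1 + d * j\<close> with \<open>d \<le> z / j\<close>.  For every cofactor
  \<open>j\<close> the contribution is thus at most \<open>r * z / j\<close> times the number of admissible divisors, and
  the harmonic sum over \<open>j\<close> costs only another factor \<open>r\<close>.  Therefore one \<open>j\<close> serves many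
  divisors at once.
\<close>

lemma weighted_psi_pigeonhole:
  fixes U z r K :: nat and M :: real
  assumes z: "z < 2 ^ r" and U: "U \<ge> 1" and K: "K > 0"
    and big: "weighted_psi U z K > real z * real r ^ 2 * M"
  shows "\<exists>j\<in>{1..z}. real (card {d. d dvd K \<and> 1 + d * j \<le> z \<and> primepow (1 + d * j)}) > M"
proof (rule ccontr)
  define c where "c = (\<lambda>j. {d. d dvd K \<and> 1 + d * j \<le> z \<and> primepow (1 + d * j)})"
  assume "\<not> ?thesis"
  hence small: "real (card (c j)) \<le> M" if "j \<in> {1..z}" for j
    using that by (auto simp: c_def not_less)
  have finK: "finite {d. d dvd K}" using K by simp
  have finc: "finite (c j)" for j by (rule finite_subset[OF _ finK]) (auto simp: c_def)
  have psi: "psi_class U z d = (\<Sum>j=1..z. if 1 + d * j \<le> z then mangoldt_above U (1 + d * j) else 0)"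
    if d: "d > 0" for d
  proof -
    have "(\<Sum>j=1..z. if 1 + d * j \<le> z then mangoldt_above U (1 + d * j) else 0) =
          (\<Sum>j | j \<in> {1..z} \<and> 1 + d * j \<le> z. mangoldt_above U (1 + d * j))"
      by (rule sum.mono_neutral_cong_right) auto
    also have "\<dots> = (\<Sum>n\<in>(\<lambda>j. 1 + d * j) ` {j. j \<in> {1..z} \<and> 1 + d * j \<le> z}. mangoldt_above U n)"
      using d by (subst sum.reindex) (auto simp: inj_on_def)
    also have "\<dots> = psi_class U z d"
      unfolding psi_class_def
    proof (rule sum.mono_neutral_left)
      show "(\<lambda>j. 1 + d * j) ` {j. j \<in> {1..z} \<and> 1 + d * j \<le> z} \<subseteq> {n. n \<in> {1..z} \<and> [n = 1] (mod d)}"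
      proof
        fix n assume "n \<in> (\<lambda>j. 1 + d * j) ` {j. j \<in> {1..z} \<and> 1 + d * j \<le> z}"
        then obtain j where j: "n = 1 + d * j" "1 + d * j \<le> z" by blast
        have "[n = 1] (mod d)" unfolding Cong.cong_def j(1) by (rule mod_mult_self2)
        thus "n \<in> {n. n \<in> {1..z} \<and> [n = 1] (mod d)}" using j by simp
      qed
      show "\<forall>n\<in>{n. n \<in> {1..z} \<and> [n = 1] (mod d)} - (\<lambda>j. 1 + d * j) ` {j. j \<in> {1..z} \<and> 1 + d * j \<le> z}.
              mangoldt_above U n = 0"
      proof
        fix n assume n: "n \<in> {n. n \<in> {1..z} \<and> [n = 1] (mod d)} - (\<lambda>j. 1 + d * j) ` {j. j \<in> {1..z} \<and> 1 + d * j \<le> z}"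
        hence n1: "1 \<le> n" "n \<le> z" "[n = 1] (mod d)" by auto
        have "n = 1"
        proof (rule ccontr)
          assume "n \<noteq> 1"
          have "d dvd n - 1" using n1 by (metis cong_altdef_nat)
          then obtain j where j: "n = 1 + d * j" using n1(1) by (metis dvdE le_add_diff_inverse)
          have "j \<ge> 1" using j \<open>n \<noteq> 1\<close> by (cases j) auto
          have "1 * j \<le> d * j" using d by (intro mult_right_mono) auto
          hence "j \<le> z" using j n1(2) by linarith
          with \<open>j \<ge> 1\<close> j n1 n show False by auto
        qed
        thus "mangoldt_above U n = 0" by (simp add: mangoldt_above_def)
      qed
    qed auto
    finally show ?thesis ..
  qed
  have "weighted_psi U z K = (\<Sum>d | d dvd K. \<Sum>j=1..z. if 1 + d * j \<le> z then real d * mangoldt_above U (1 + d * j) else 0)"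
    unfolding weighted_psi_def
  proof (rule sum.cong[OF refl])
    fix d assume "d \<in> {d. d dvd K}"
    hence "d > 0" using K by (auto intro: Nat.gr0I)
    thus "real d * psi_class U z d = (\<Sum>j=1..z. if 1 + d * j \<le> z then real d * mangoldt_above U (1 + d * j) else 0)"
      unfolding psi[OF \<open>d > 0\<close>] sum_distrib_left by (intro sum.cong refl) simp
  qed
  also have "\<dots> = (\<Sum>j=1..z. \<Sum>d | d dvd K. if 1 + d * j \<le> z then real d * mangoldt_above U (1 + d * j) else 0)"
    by (rule sum.swap)
  also have "\<dots> \<le> (\<Sum>j=1..z. \<Sum>d\<in>c j. real z * (1 / real j) * real r)"
  proof (rule sum_mono)
    fix j assume j: "j \<in> {1..z}"
    have "(\<Sum>d | d dvd K. if 1 + d * j \<le> z then real d * mangoldt_above U (1 + d * j) else 0) =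
          (\<Sum>d\<in>c j. real d * mangoldt_above U (1 + d * j))"
      by (rule sum.mono_neutral_cong_right)
         (use finK in \<open>auto simp: c_def mangoldt_above_def mangoldt_def\<close>)
    also have "\<dots> \<le> (\<Sum>d\<in>c j. real z * (1 / real j) * real r)"
    proof (intro sum_mono mult_mono mangoldt_above_nonneg)
      fix d assume "d \<in> c j"
      hence d: "1 + d * j \<le> z" by (simp add: c_def)
      hence "real d * real j \<le> real z" by (metis add_leD2 of_nat_le_iff of_nat_mult)
      thus "real d \<le> real z * (1 / real j)" using j by (simp add: field_simps)
      show "mangoldt_above U (1 + d * j) \<le> real r" by (rule mangoldt_above_le[OF le_less_trans[OF d z]])
    qed simp
    finally show "(\<Sum>d | d dvd K. if 1 + d * j \<le> z then real d * mangoldt_above U (1 + d * j) else 0)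
       \<le> (\<Sum>d\<in>c j. real z * (1 / real j) * real r)" .
  qed
  also have "\<dots> = (\<Sum>j=1..z. real (card (c j)) * (real z * real r * (1 / real j)))"
    by (simp add: mult_ac)
  also have "\<dots> \<le> (\<Sum>j=1..z. M * (real z * real r * (1 / real j)))"
    by (intro sum_mono mult_right_mono small) auto
  also have "\<dots> = M * (real z * real r) * (\<Sum>j=1..z. 1 / real j)"
    by (simp add: sum_distrib_left mult_ac)
  also have "\<dots> \<le> M * (real z * real r) * real r"
  proof (cases "z = 0")
    case False
    hence "M \<ge> 0" using order_trans[OF _ small[of 1]] by auto
    thus ?thesis by (intro mult_left_mono harmonic_sum_le z) auto
  qed simp
  finally show False using big by (simp add: power2_eq_square mult_ac)
qed

section \<open>From shifted primes to Carmichael's function\<close>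

lemma dvd_power_minus_one:
  fixes q a :: nat
  assumes "q \<ge> 1"
  shows "q - 1 dvd q ^ a - 1"
proof -
  have "[q = 1] (mod (q - 1))" using assms by (simp add: cong_altdef_nat)
  hence "[q ^ a = 1 ^ a] (mod (q - 1))" by (rule cong_pow)
  thus ?thesis using assms by (simp add: cong_altdef_nat one_le_power)
qed

text \<open>
  If \<open>1 + d * j = q ^ a\<close> then \<open>q - 1\<close> divides \<open>q ^ a - 1 = d * j\<close>, so the base of a prime power is as
  good as a prime; a prime \<open>q\<close> arises from fewer than \<open>r\<close> of its powers.
\<close>

lemma many_primes_from_prime_powers:
  fixes K j z r :: nat
  assumes z: "z < 2 ^ r" and K: "K > 0" and j: "j \<ge> 1"
  defines "C \<equiv> {d. d dvd K \<and> 1 + d * j \<le> z \<and> primepow (1 + d * j)}"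
  shows "\<exists>R. finite R \<and> (\<forall>q\<in>R. prime q \<and> q \<le> z \<and> q - 1 dvd j * K) \<and>
           card C \<le> card R * r \<and> card R \<le> card C"
proof -
  have finC: "finite C" by (rule finite_subset[of _ "{d. d dvd K}"]) (use K in \<open>auto simp: C_def\<close>)
  define R where "R = (\<lambda>d. aprimedivisor (1 + d * j)) ` C"
  have R: "prime q \<and> (\<exists>a<r. 1 + d * j = q ^ a) \<and> q \<le> z \<and> q - 1 dvd j * K"
    if d: "d \<in> C" and q: "q = aprimedivisor (1 + d * j)" for d q
  proof -
    define n where "n = 1 + d * j"
    have n: "primepow n" "n \<le> z" "d dvd K" using d unfolding C_def n_def by blast+
    define a where "a = multiplicity q n"
    have na: "n = q ^ a" unfolding a_def q n_def[symmetric] by (rule primepow_decompose[OF n(1), symmetric])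
    have "n > 1" using primepow_gt_Suc_0[OF n(1)] by simp
    then obtain p where "prime p" "p dvd n" using prime_factor_nat[of n] by auto
    hence q': "prime q" "q dvd n"
      unfolding q n_def[symmetric] by (rule prime_aprimedivisor, rule aprimedivisor_dvd)
    have "q \<le> n" using q'(2) \<open>n > 1\<close> by (intro dvd_imp_le) auto
    moreover have "q ^ a < 2 ^ r" using n(2) z unfolding na by (rule le_less_trans)
    hence "a < r" by (rule primepow_exponent_less[OF q'(1)])
    moreover have "q - 1 dvd n - 1" unfolding na using prime_ge_1_nat[OF q'(1)] by (rule dvd_power_minus_one)
    hence "q - 1 dvd d * j" by (simp add: n_def)
    hence "q - 1 dvd j * K" using n(3) by (metis dvd_trans mult.commute mult_dvd_mono dvd_refl)
    ultimately show ?thesis using q' n na n_def by (metis le_trans)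
  qed
  have "inj_on (\<lambda>d. 1 + d * j) C" using j by (auto simp: inj_on_def)
  hence "card C = card ((\<lambda>d. 1 + d * j) ` C)" by (simp add: card_image)
  also have "\<dots> \<le> card (R \<times> {..<r})"
  proof (rule surj_card_le)
    show "finite (R \<times> {..<r})" using finC by (simp add: R_def)
    show "(\<lambda>d. 1 + d * j) ` C \<subseteq> (\<lambda>(q, a). q ^ a) ` (R \<times> {..<r})"
    proof
      fix n assume "n \<in> (\<lambda>d. 1 + d * j) ` C"
      then obtain d where d: "d \<in> C" "n = 1 + d * j" by blast
      obtain a where a: "a < r" "1 + d * j = aprimedivisor (1 + d * j) ^ a"
        using R[OF d(1) refl] by blast
      have "(aprimedivisor (1 + d * j), a) \<in> R \<times> {..<r}" using d(1) a(1) by (simp add: R_def)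
      moreover have "n = (case (aprimedivisor (1 + d * j), a) of (q, a) \<Rightarrow> q ^ a)"
        unfolding d(2) prod.case by (rule a(2))
      ultimately show "n \<in> (\<lambda>(q, a). q ^ a) ` (R \<times> {..<r})" by (rule rev_image_eqI)
    qed
  qed
  also have "\<dots> = card R * r" by (simp add: card_cartesian_product)
  finally have "card C \<le> card R * r" .
  moreover have "card R \<le> card C" unfolding R_def by (rule card_image_le[OF finC])
  moreover have "\<forall>q\<in>R. prime q \<and> q \<le> z \<and> q - 1 dvd j * K" using R unfolding R_def by blast
  moreover have "finite R" using finC by (simp add: R_def)
  ultimately show ?thesis by blast
qed

text \<open>
  Fermat's theorem modulo each prime, combined by coprimality.
\<close>

lemma Carmichael_prod_primes_dvd:
  fixes R :: "nat set" and n :: nat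
  assumes fin: "finite R" and R: "\<And>q. q \<in> R \<Longrightarrow> prime q \<and> q - 1 dvd n"
  shows "Carmichael (\<Prod>R) dvd n"
  unfolding Carmichael_def
proof (rule Lcm_least, clarify)
  fix a assume "a \<in> totatives (\<Prod>R)"
  hence cop: "coprime a (\<Prod>R)" by (simp add: totatives_def)
  have "[a ^ n = 1] (mod q)" if q: "q \<in> R" for q
  proof -
    have "q dvd \<Prod>R" using fin q by (rule dvd_prodI)
    hence "coprime a q" using cop by (metis coprime_divisors dvd_refl)
    hence "\<not> q dvd a" using R[OF q] by (metis coprime_common_divisor dvd_refl not_prime_unit)
    hence "[a ^ (q - 1) = 1] (mod q)" using R[OF q] by (intro fermat_theorem) auto
    moreover obtain t where "n = (q - 1) * t" using R[OF q] by blast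
    ultimately show ?thesis using cong_pow[of "a ^ (q - 1)" 1 q t] by (simp add: power_mult)
  qed
  hence "[a ^ n = 1] (mod \<Prod>R)"
    using fin R by (intro coprime_cong_prod_nat) (auto intro: primes_coprime)
  thus "ord (\<Prod>R) a dvd n" using ord_divides by blast
qed

text \<open>
  The parameters are \<open>y = k ^ 15\<close>, \<open>z = y ^ (5 * k)\<close> and \<open>r = k ^ 2\<close>.  The exponent 15 provides at
  least \<open>k ^ 12\<close> primes up to \<open>y\<close> beyond the \<open>k\<close> that get used, two powers of \<open>k\<close> more than the loss
  \<open>r ^ 5 = k ^ 10\<close> in the equidistribution bound, so that \<open>k\<close> steps with relative error of order
  \<open>1 / k ^ 2\<close> each are affordable.  The exponent \<open>5 * k\<close> makes \<open>z\<close> exceed \<open>y ^ (3 * k + 10)\<close>, which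
  bounds the contribution of the smooth sums with \<open>U = 4 * y ^ (k + 3)\<close> and \<open>d \<le> y ^ k\<close>.  The
  hypothesis \<open>k ^ 90 \<le> 2 ^ k\<close> says \<open>y ^ 6 \<le> 2 ^ k\<close>, hence \<open>z < 2 ^ r\<close>.
\<close>

theorem many_primes_with_common_multiple:
  fixes k :: nat
  assumes k: "k \<ge> 1000" "k ^ 90 \<le> 2 ^ k"
  shows "\<exists>R n. finite R \<and> n > 0 \<and> n \<le> k ^ (90 * k) \<and>
     (\<forall>q\<in>R. prime q \<and> q < 2 ^ (k ^ 2) \<and> q - 1 dvd n) \<and>
     2 ^ k / (64 * real k ^ 6) < real (card R) \<and> card R \<le> 2 ^ k"
proof -
  define y where "y = k ^ 15"
  define z where "z = y ^ (5 * k)"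
  define U where "U = 4 * y ^ (k + 3)"
  define r where "r = k ^ 2"
  define Q where "Q = {p. prime p \<and> p \<le> y}"
  have k0: "real k > 0" using k by simp
  have ky: "k ^ a \<le> y" if "a \<le> 15" for a
    unfolding y_def using k that by (intro power_increasing) auto
  have y_ge: "y \<ge> 1000" using ky[of 1] k by simp
  have y_pow: "y ^ a \<le> y ^ b" if "a \<le> b" for a b
    using y_ge that by (intro power_increasing) auto
  have "y ^ 6 = k ^ 90" by (simp add: y_def flip: power_mult)
  hence y6: "y ^ 6 \<le> 2 ^ k" using k by simp
  have "y ^ 1 < y ^ 6" using y_ge by (intro power_strict_increasing) auto
  hence y_less: "y < 2 ^ k" using y6 by simp
  have z_ge: "z \<ge> 1000" using y_pow[of 1 "5 * k"] y_ge k unfolding z_def by simp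
  have z_less: "z + 1 < 2 ^ r"
  proof -
    have "z + 1 < 2 * z" using z_ge by simp
    also have "\<dots> \<le> y * z" using y_ge by (intro mult_right_mono) auto
    also have "\<dots> = y ^ (5 * k + 1)" by (simp add: z_def)
    also have "\<dots> \<le> y ^ (6 * k)" using k by (intro y_pow) auto
    also have "\<dots> = (y ^ 6) ^ k" by (simp add: power_mult)
    also have "\<dots> \<le> (2 ^ k) ^ k" by (intro power_mono y6) auto
    also have "\<dots> = 2 ^ r" by (simp add: r_def power2_eq_square flip: power_mult)
    finally show ?thesis .
  qed
  have U_le: "U \<le> z"
  proof -
    have "U \<le> y * y ^ (k + 3)" unfolding U_def using y_ge by (intro mult_right_mono) auto
    also have "\<dots> = y ^ (k + 4)" by (subst power_Suc [symmetric]) (simp add: add.commute)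
    also have "\<dots> \<le> z" unfolding z_def using k by (intro y_pow) auto
    finally show ?thesis .
  qed
  have Q_lower: "real (card Q) - real k \<ge> real k ^ 12"
  proof -
    have "real y / 8 \<le> real (card Q) * real k ^ 2"
      unfolding Q_def using y_ge y_less by (intro prime_count_lower_bound) auto
    moreover have "real y = real k ^ 13 * real k ^ 2" by (simp add: y_def flip: power_add)
    ultimately have "(real k ^ 13 / 8) * real k ^ 2 \<le> real (card Q) * real k ^ 2" by simp
    hence "real k ^ 13 / 8 \<le> real (card Q)" by (rule mult_right_le_imp_le) (use k0 in simp)
    moreover have "real k ^ 13 = real k * real k ^ 12" using power_Suc[of "real k" 12] by simp
    moreover have "1000 * real k ^ 12 \<le> real k * real k ^ 12" using k by (intro mult_right_mono) auto
    moreover have "real k \<le> real k ^ 12" by (rule self_le_power) (use k in auto)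
    ultimately show ?thesis by linarith
  qed
  have kQ: "k < card Q"
  proof -
    have "real k ^ 12 > 0" using k0 by simp
    hence "real k < real (card Q)" using Q_lower by linarith
    thus ?thesis by simp
  qed
  have ky_real: "real k ^ a \<le> real y" if "a \<le> 15" for a
    using ky[OF that] by (metis of_nat_le_iff of_nat_power)
  have y_pow_real: "real y ^ a \<le> real z" if "a \<le> 5 * k" for a
    using y_pow[OF that] unfolding z_def by (metis of_nat_le_iff of_nat_power)
  have smooth_error: "8 * real r * real U ^ 2 * real y ^ 2 * real y ^ k \<le> real z"
  proof -
    have "real U = 4 * real y ^ (k + 3)" "real r = real k ^ 2" by (simp_all add: U_def r_def)
    hence "8 * real r * real U ^ 2 * real y ^ 2 * real y ^ k =
          128 * real k ^ 2 * (real y ^ (k + 3) * real y ^ (k + 3) * real y ^ 2 * real y ^ k)"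
      by (simp only: power2_eq_square) algebra
    also have "\<dots> \<le> real y * real y * (real y ^ (k + 3) * real y ^ (k + 3) * real y ^ 2 * real y ^ k)"
      using y_ge ky_real[of 2] by (intro mult_right_mono mult_mono) auto
    also have "\<dots> = real y ^ (2 + (k + 3 + (k + 3) + 2 + k))"
      by (simp only: power_add power2_eq_square)
    also have "2 + (k + 3 + (k + 3) + 2 + k) = 3 * k + 10" by simp
    also have "real y ^ (3 * k + 10) \<le> real z" using k by (intro y_pow_real) auto
    finally show ?thesis .
  qed
  have small_error: "real y ^ k * real r ^ 2 \<le> real z / real k ^ 2"
  proof -
    have "real r ^ 2 * real k ^ 2 = real k ^ 6" by (simp add: r_def flip: power_mult power_add)
    hence "real y ^ k * real r ^ 2 * real k ^ 2 = real y ^ k * real k ^ 6" by (simp only: mult.assoc)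
    also have "\<dots> \<le> real y ^ k * real y" by (intro mult_left_mono ky_real) auto
    also have "\<dots> = real y ^ (k + 1)" by simp
    also have "\<dots> \<le> real z" using k by (intro y_pow_real) auto
    finally show ?thesis using k0 by (simp add: pos_le_divide_eq)
  qed
  define e where "e = 12 * real z / real k ^ 2"
  have e: "(10 * real r ^ 5 * real z + 8 * real r * real U ^ 2 * real y ^ 2 * real y ^ k) /
             (real (card {p. prime p \<and> p \<le> y}) - real k) + real y ^ k * real r ^ 2 \<le> e"
  proof -
    have "real r ^ 5 = real k ^ 10" by (simp add: r_def flip: power_mult)
    moreover have "1 * real z \<le> real k ^ 10 * real z"
      using k by (intro mult_right_mono one_le_power) auto
    ultimately have "10 * real r ^ 5 * real z + 8 * real r * real U ^ 2 * real y ^ 2 * real y ^ k \<le>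
                     10 * real k ^ 10 * real z + real k ^ 10 * real z"
      using smooth_error by (intro add_mono) simp_all
    also have "\<dots> = 11 * (real k ^ 10 * real z)" by simp
    finally have "(10 * real r ^ 5 * real z + 8 * real r * real U ^ 2 * real y ^ 2 * real y ^ k) / (real (card Q) - real k) \<le>
           11 * (real k ^ 10 * real z) / real k ^ 12"
      using Q_lower k0 by (intro frac_le) simp_all
    also have "\<dots> = 11 * real z / real k ^ 2"
    proof -
      have cancel: "11 * (a * w) / (a * b) = 11 * w / b" if "a \<noteq> 0" for a b w :: real
        using that by simp
      have "real k ^ 12 = real k ^ 10 * real k ^ 2" by (simp flip: power_add)
      show ?thesis unfolding \<open>real k ^ 12 = _\<close> by (rule cancel) (use k0 in simp)
    qed
    finally have "(10 * real r ^ 5 * real z + 8 * real r * real U ^ 2 * real y ^ 2 * real y ^ k) / (real (card Q) - real k) +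
        real y ^ k * real r ^ 2 \<le> 11 * real z / real k ^ 2 + real z / real k ^ 2"
      using small_error by (rule add_mono)
    also have "\<dots> = e" by (simp add: e_def add_divide_distrib [symmetric])
    finally show ?thesis unfolding Q_def .
  qed
  have psi: "psi_class U z 1 \<ge> real z / 16"
  proof -
    have "(\<Sum>n=1..z. mangoldt n) \<le> psi_class U z 1 + real U * real r"
    proof -
      have "(\<Sum>n=1..z. mangoldt n) = (\<Sum>n=1..z. mangoldt_above U n) + (\<Sum>n=1..z. if n \<le> U then mangoldt n else 0)"
        unfolding sum.distrib [symmetric] by (rule sum.cong) (auto simp: mangoldt_above_def)
      also have "(\<Sum>n=1..z. if n \<le> U then mangoldt n else 0 :: real) = (\<Sum>n=1..U. mangoldt n)"
        by (rule sum.mono_neutral_cong_right) (use U_le in auto)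
      also have "(\<Sum>n=1..z. mangoldt_above U n) = psi_class U z 1"
        unfolding psi_class_def by (rule sum.cong) (auto simp: Cong.cong_def)
      finally have "(\<Sum>n=1..z. mangoldt n) = psi_class U z 1 + (\<Sum>n=1..U. mangoldt n)" .
      moreover have "(\<Sum>n=1..U. mangoldt n) \<le> (\<Sum>n=1..U. real r)"
        using U_le z_less by (intro sum_mono mangoldt_le_of_less_power2) auto
      ultimately show ?thesis by simp
    qed
    moreover have "real z / 8 \<le> (\<Sum>n=1..z. mangoldt n)" using z_ge by (intro psi_lower_bound) auto
    moreover have "real U * real r \<le> real z / 16"
    proof -
      have "16 * (real U * real r) = 64 * real k ^ 2 * real y ^ (k + 3)"
        by (simp add: U_def r_def)
      also have "\<dots> \<le> real y * real y * real y ^ (k + 3)"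
        using y_ge ky_real[of 2] by (intro mult_right_mono mult_mono) auto
      also have "\<dots> = real y ^ (1 + 1 + (k + 3))" by (simp only: power_add power_one_right)
      also have "\<dots> \<le> real z" using k by (intro y_pow_real) auto
      finally show ?thesis by simp
    qed
    ultimately show ?thesis by linarith
  qed
  have U1: "4 * y ^ (k + 3) \<le> U" "U \<ge> 1" using y_ge by (auto simp: U_def)
  have r1: "r \<ge> 1" using k by (simp add: r_def)
  have "y \<ge> 1" using y_ge by simp
  from weighted_psi_doubling[OF z_less U1 U_le r1 this kQ[unfolded Q_def] e order_refl]
  obtain K where K: "K > 0" "K \<le> y ^ k" "divisor_count K = 2 ^ k"
    and G: "weighted_psi U z K \<ge> 2 ^ k * (psi_class U z 1 - real k * e)" by blast
  have z0: "real z > 0" using z_ge by simp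
  have "real k * e \<le> real z / 32"
  proof -
    have "real k * e = 12 / real k * real z" using k0 by (simp add: e_def power2_eq_square)
    also have "\<dots> \<le> 1 / 32 * real z" using k by (intro mult_right_mono) (auto simp: field_simps)
    finally show ?thesis by simp
  qed
  hence "real z / 32 \<le> psi_class U z 1 - real k * e" using psi by linarith
  hence "2 ^ k * (real z / 32) \<le> 2 ^ k * (psi_class U z 1 - real k * e)" by (intro mult_left_mono) auto
  hence G': "2 ^ k * (real z / 32) \<le> weighted_psi U z K" using G by linarith
  define M where "M = 2 ^ k / (64 * real k ^ 4)"
  have "real z * real r ^ 2 * M = 2 ^ k * (real z / 64)"
  proof -
    have "real r ^ 2 = real k ^ 4" by (simp add: r_def flip: power_mult)
    thus ?thesis using k0 by (simp add: M_def)
  qed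
  also have "\<dots> < 2 ^ k * (real z / 32)" using z0 by (intro mult_strict_left_mono) auto
  finally have large: "real z * real r ^ 2 * M < weighted_psi U z K" using G' by linarith
  have z_less': "z < 2 ^ r" using z_less by simp
  from weighted_psi_pigeonhole[OF z_less' U1(2) K(1) large]
  obtain j where j: "j \<in> {1..z}"
    "M < real (card {d. d dvd K \<and> 1 + d * j \<le> z \<and> primepow (1 + d * j)})"
    by blast
  define C where "C = {d. d dvd K \<and> 1 + d * j \<le> z \<and> primepow (1 + d * j)}"
  have "j \<ge> 1" using j(1) by simp
  from many_primes_from_prime_powers[OF z_less' K(1) this, folded C_def]
  obtain R where R: "finite R" "\<forall>q\<in>R. prime q \<and> q \<le> z \<and> q - 1 dvd j * K"
      "card C \<le> card R * r" "card R \<le> card C"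
    by blast
  have "card C \<le> divisor_count K"
    unfolding C_def using K(1) by (intro card_mono) auto
  hence "card R \<le> 2 ^ k" using R(4) K(3) by linarith
  moreover have "2 ^ k / (64 * real k ^ 6) < real (card R)"
  proof -
    have "real (card C) \<le> real (card R) * real k ^ 2"
      using R(3) unfolding r_def by (metis of_nat_le_iff of_nat_mult of_nat_power)
    hence "M < real (card R) * real k ^ 2" using j(2) unfolding C_def by linarith
    hence "M / real k ^ 2 < real (card R)" using k0 by (simp add: pos_divide_less_eq)
    moreover have "M / real k ^ 2 = 2 ^ k / (64 * real k ^ 6)"
      by (simp add: M_def flip: power_add)
    ultimately show ?thesis by simp
  qed
  moreover have "j * K \<le> k ^ (90 * k)"
  proof -
    have "j * K \<le> z * y ^ k" using j(1) K(2) by (intro mult_le_mono) auto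
    also have "\<dots> = y ^ (6 * k)" by (simp add: z_def flip: power_add)
    also have "\<dots> = k ^ (90 * k)" by (simp add: y_def flip: power_mult)
    finally show ?thesis .
  qed
  moreover have "j * K > 0" using j(1) K(1) by simp
  moreover have "\<forall>q\<in>R. prime q \<and> q < 2 ^ (k ^ 2) \<and> q - 1 dvd j * K"
  proof
    fix q assume "q \<in> R"
    with R(2) have "prime q" "q \<le> z" "q - 1 dvd j * K" by blast+
    thus "prime q \<and> q < 2 ^ (k ^ 2) \<and> q - 1 dvd j * K" using z_less unfolding r_def by linarith
  qed
  ultimately show ?thesis using R(1) by (intro exI[of _ R] exI[of _ "j * K"] conjI)
qed

text \<open>
  The product of the primes just found has Carmichael function at most their common multiple of
  the \<open>q - 1\<close>, which is \<open>exp\<close> of order \<open>k * ln k\<close>, while its logarithm is exponentially large in \<open>k\<close>.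
\<close>

lemma small_Carmichael:
  fixes k :: nat
  assumes k: "k \<ge> 1000" "k ^ 90 \<le> 2 ^ k"
  shows "\<exists>m>0. exp (real k / 2) / (128 * real k ^ 6) \<le> ln (real m) \<and> ln (real m) \<le> exp (real k) * real k ^ 2 \<and>
           Carmichael m \<le> k ^ (90 * k)"
proof -
  have ln2: "ln 2 \<ge> (1 / 2 :: real)" "ln 2 \<le> (1 :: real)"
    using ln_le_minus_one[of "1 / 2 :: real"] ln_le_minus_one[of "2 :: real"] by (simp_all add: ln_div)
  have two_power: "(2 :: real) ^ k = exp (real k * ln 2)" by (simp add: exp_of_nat_mult)
  have exp_le: "exp (real k / 2) \<le> 2 ^ k"
    unfolding two_power using mult_left_mono[OF ln2(1), of "real k"] by simp
  have le_exp: "2 ^ k \<le> exp (real k)"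
    unfolding two_power using mult_left_mono[OF ln2(2), of "real k"] by simp
  obtain R n where R: "finite R" "n > 0" "n \<le> k ^ (90 * k)"
    "\<And>q. q \<in> R \<Longrightarrow> prime q \<and> q < 2 ^ (k ^ 2) \<and> q - 1 dvd n"
    "2 ^ k / (64 * real k ^ 6) < real (card R)" "card R \<le> 2 ^ k"
    using many_primes_with_common_multiple[OF k] by blast
  define m where "m = \<Prod>R"
  have pos: "q > 0" if "q \<in> R" for q using R(4)[OF that] prime_gt_0_nat by blast
  have "m > 0" unfolding m_def using pos R(1) by (intro prod_pos) auto
  have ln_m: "ln (real m) = (\<Sum>q\<in>R. ln (real q))"
    unfolding m_def of_nat_prod using pos R(1) by (subst ln_prod) auto
  have "(\<Sum>q\<in>R. 1 / 2) \<le> (\<Sum>q\<in>R. ln (real q))"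
  proof (rule sum_mono)
    fix q assume "q \<in> R"
    hence "q \<ge> 2" using R(4) prime_ge_2_nat by blast
    hence "ln 2 \<le> ln (real q)" by (subst ln_le_cancel_iff) auto
    thus "1 / 2 \<le> ln (real q)" using ln2(1) by linarith
  qed
  hence "real (card R) / 2 \<le> ln (real m)" by (simp add: ln_m)
  moreover have "2 ^ k / (128 * real k ^ 6) = 2 ^ k / (64 * real k ^ 6) / 2" by simp
  moreover have "exp (real k / 2) / (128 * real k ^ 6) \<le> 2 ^ k / (128 * real k ^ 6)"
    using exp_le by (intro divide_right_mono) auto
  ultimately have "exp (real k / 2) / (128 * real k ^ 6) \<le> ln (real m)" using R(5) by linarith
  moreover have "ln (real m) \<le> exp (real k) * real k ^ 2"
  proof -
    have "ln (real m) \<le> (\<Sum>q\<in>R. real (k ^ 2))"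
      unfolding ln_m using R(4) by (intro sum_mono ln_le_of_less_power2) auto
    also have "\<dots> = real (card R) * real k ^ 2" by simp
    also have "\<dots> \<le> exp (real k) * real k ^ 2"
    proof (rule mult_right_mono)
      have "real (card R) \<le> 2 ^ k" using R(6) by (metis of_nat_le_iff of_nat_numeral of_nat_power)
      thus "real (card R) \<le> exp (real k)" using le_exp by linarith
    qed simp
    finally show ?thesis .
  qed
  moreover have "Carmichael m \<le> k ^ (90 * k)"
  proof -
    have "Carmichael m dvd n" unfolding m_def using R(1,4) by (intro Carmichael_prod_primes_dvd) auto
    hence "Carmichael m \<le> n" using R(2) by (rule dvd_imp_le)
    thus ?thesis using R(3) by linarith
  qed
  ultimately show ?thesis using \<open>m > 0\<close> by blast
qed

text \<open>
  Applied with \<open>x = ln m\<close>: then \<open>ln x\<close> is of order \<open>k\<close>, so that \<open>x powr (c * ln (ln x))\<close> is \<open>exp\<close> of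
  order \<open>c * k * ln k\<close>.
\<close>

lemma power_less_powr_ln_ln:
  fixes k :: nat and x :: real
  assumes k: "k \<ge> 16" and x: "exp (real k / 4) \<le> x"
  shows "real (k ^ (90 * k)) < x powr (800 * ln (ln x))"
proof -
  have x0: "x > 0" using x exp_gt_zero[of "real k / 4"] by linarith
  have lnk: "ln (real k) > 0" using k by simp
  have L: "ln x \<ge> real k / 4" using x ln_ge_iff[OF x0] by blast
  have "ln (real k / 4) \<le> ln (ln x)" using L k by (subst ln_le_cancel_iff) auto
  moreover have "ln (real k / 4) = ln (real k) - ln 4" using k by (simp add: ln_div)
  moreover have "2 * ln 4 = ln (16 :: real)" using ln_realpow[of 4 2] by simp
  moreover have "ln 16 \<le> ln (real k)" using k by (subst ln_le_cancel_iff) auto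
  ultimately have LL: "ln (real k) / 2 \<le> ln (ln x)" by linarith
  have "real (k ^ (90 * k)) = exp (ln (real k ^ (90 * k)))" using k by simp
  also have "\<dots> = exp (90 * (real k * ln (real k)))" using k by (simp add: ln_realpow)
  also have "\<dots> < exp (800 * ((ln (real k) / 2) * (real k / 4)))"
    using lnk k by simp
  also have "\<dots> \<le> exp (800 * (ln (ln x) * ln x))"
    using LL L lnk by (subst exp_le_cancel_iff, intro mult_left_mono mult_mono) auto
  also have "\<dots> = x powr (800 * ln (ln x))" using x0 by (simp add: powr_def)
  finally show ?thesis .
qed

theorem theorem1:
  shows "\<exists>c\<^sub>2 c\<^sub>3 :: real. c\<^sub>2 > 0 \<and> c\<^sub>3 > 0 \<and>
    (\<forall>\<^sub>F i :: nat in sequentially. \<exists>m :: nat. m > 0 \<and>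
       ln (real m) \<in> {ln (real i) .. ln (real i) powr c\<^sub>2} \<and>
       real (Carmichael m) < ln (real m) powr (c\<^sub>3 * ln (ln (ln (real m)))))"
proof (intro exI conjI)
  \<comment> \<open>The factor 3 exceeds \<open>2\<close>, so that already \<open>exp (k / 2)\<close>, a lower bound for \<open>2 ^ k\<close>, exceeds
    \<open>ln i\<close> by more than any power of \<open>k\<close>.\<close>
  define k where "k = (\<lambda>i :: nat. nat \<lceil>3 * ln (ln (real i))\<rceil>)"
  have k_ge: "3 * ln (ln (real i)) \<le> real (k i)" for i unfolding k_def by linarith
  have "filterlim (\<lambda>i :: nat. 3 * ln (ln (real i))) at_top sequentially" by real_asymp
  hence "filterlim (\<lambda>i. real (k i)) at_top sequentially"
    by (rule filterlim_at_top_mono) (use k_ge in auto)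
  hence lim: "filterlim k sequentially sequentially"
    by (simp add: filterlim_sequentially_iff_filterlim_real)
  have "eventually (\<lambda>k :: nat. real k ^ 90 \<le> 2 ^ k) sequentially" by real_asymp
  hence "eventually (\<lambda>k :: nat. k ^ 90 \<le> 2 ^ k) sequentially"
    by eventually_elim (metis of_nat_le_iff of_nat_numeral of_nat_power)
  moreover have "eventually (\<lambda>k :: nat. exp (real k / 3) \<le> exp (real k / 2) / (128 * real k ^ 6)) sequentially"
    by real_asymp
  moreover have "eventually (\<lambda>k :: nat. exp (real k / 4) \<le> exp (real k / 2) / (128 * real k ^ 6)) sequentially"
    by real_asymp
  moreover have "eventually (\<lambda>k :: nat. exp (real k) * real k ^ 2 \<le> exp (4 * ((real k - 1) / 3))) sequentially"
    by real_asymp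
  moreover have "eventually (\<lambda>k :: nat. k \<ge> 1000) sequentially" by (rule eventually_ge_at_top)
  ultimately have "eventually (\<lambda>k :: nat. k \<ge> 1000 \<and> k ^ 90 \<le> 2 ^ k \<and>
      exp (real k / 3) \<le> exp (real k / 2) / (128 * real k ^ 6) \<and> exp (real k / 4) \<le> exp (real k / 2) / (128 * real k ^ 6) \<and>
      exp (real k) * real k ^ 2 \<le> exp (4 * ((real k - 1) / 3))) sequentially"
    by eventually_elim blast
  from eventually_compose_filterlim[OF this lim] eventually_ge_at_top[of "2 :: nat"]
  show "\<forall>\<^sub>F i :: nat in sequentially. \<exists>m :: nat. m > 0 \<and>
       ln (real m) \<in> {ln (real i) .. ln (real i) powr 4} \<and>
       real (Carmichael m) < ln (real m) powr (800 * ln (ln (ln (real m))))"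
  proof eventually_elim
    case (elim i)
    define l where "l = k i"
    have l: "l \<ge> 1000" "l ^ 90 \<le> 2 ^ l" "exp (real l / 3) \<le> exp (real l / 2) / (128 * real l ^ 6)"
      "exp (real l / 4) \<le> exp (real l / 2) / (128 * real l ^ 6)" "exp (real l) * real l ^ 2 \<le> exp (4 * ((real l - 1) / 3))"
      using elim by (auto simp: l_def)
    obtain m where m: "m > 0" "exp (real l / 2) / (128 * real l ^ 6) \<le> ln (real m)"
      "ln (real m) \<le> exp (real l) * real l ^ 2" "Carmichael m \<le> l ^ (90 * l)"
      using small_Carmichael[OF l(1,2)] by blast
    have lni: "ln (real i) > 0" using elim by simp
    have "ln (real i) = exp (ln (ln (real i)))" using lni by simp
    also have "\<dots> \<le> exp (real l / 3)" using k_ge[of i] by (simp add: l_def)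
    finally have lower: "ln (real i) \<le> ln (real m)" using l(3) m(2) by linarith
    have "real l \<le> 3 * ln (ln (real i)) + 1"
      using l(1) unfolding l_def k_def by linarith
    hence "exp (4 * ((real l - 1) / 3)) \<le> exp (4 * ln (ln (real i)))" by simp
    also have "\<dots> = ln (real i) powr 4" using lni by (simp add: powr_def)
    finally have upper: "ln (real m) \<le> ln (real i) powr 4" using l(5) m(3) by linarith
    have "real (Carmichael m) \<le> real (l ^ (90 * l))" using m(4) by (rule of_nat_mono)
    also have "\<dots> < ln (real m) powr (800 * ln (ln (ln (real m))))"
      using l(1,4) m(2) by (intro power_less_powr_ln_ln) auto
    finally show ?case using m(1) lower upper by auto
  qed
qed auto

end
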